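(* Let $u(x,t)$ be the solution, vanishing for $x\to\pm\infty$, to the problem $$p\left(\frac{\partial}{\partial t}-\frac{\partial}{\partial x}\right)^{\alpha}u(x,t)+(1-p)\left(\frac{\partial}{\partial t}+\frac{\partial}{\partial x}\right)^{\alpha}u(x,t)=f(x,t),\qquad \lim_{t\to0^+}I_t^{1-\alpha}u(x,t)=g(x),\qquad x\in\mathbb{R},\ t>0.$$ Moreover, assume that $f(\cdot,t)\in L^1(\mathbb{R})$ for all $t\in\mathbb{R}_+$ and $f(x,\cdot)\in L^1_{loc}(\mathbb{R}_+)$ for all $x\in\mathbb{R}$. Then the solution $u$ is a probability density function, i.e. $$\int_{-\infty}^{\infty}u(x,t)\,dx=1\qquad\text{and}\qquad \lim_{t\to0^+}u(x,t)=\delta(x),$$ if and only if $$\int_{-\infty}^{\infty}f(x,t)\,dx=\frac{t^{-\alpha}}{\Gamma(1-\alpha)}.$$ Moreover, the solution is given by $$u(x,t)=\int_0^t (G_{t-\tau}*f)(x,\tau)\,d\tau,$$ where $$G_t(x)=\mathcal{F}^{-1}\left\{\mathcal{L}^{-1}\left\{\frac{1}{p(s-i\xi)^{\alpha}+(1-p)(s+i\xi)^{\alpha}}\right\}(t)\right\}(x).$$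
   Context: Here $0<\alpha<1$, $p\in[0,1]$ (the left-hand side of the equation is a convex combination), and the initial datum satisfies $g\in L^1_{loc}(\mathbb{R})$. The two integral conditions are meant for all times $t>0$. $\delta$ is the Dirac delta; the limit $\lim_{t\to0^+}u(x,t)=\delta(x)$ is understood weakly: $\int_{\mathbb{R}}u(x,t)\psi(x)\,dx\to\psi(0)$ for every $\psi\in C_c^\infty(\mathbb{R})$. Fractional integral in time: for $\beta>0$, $I^{\beta}_t y(t)=\frac{1}{\Gamma(\beta)}\int_0^t(t-s)^{\beta-1}y(s)\,ds$. $\mathcal{F}$ is the Fourier transform in $x$, with inverse $\mathcal{F}^{-1}\{v\}(x)=\frac{1}{2\pi}\int_{\mathbb{R}}e^{i\xi x}v(\xi)\,d\xi$; $\mathcal{L}$ is the Laplace transform in $t$, with inverse given by the Bromwich integral. Complex powers use the principal branch. Fractional material derivative: $\left(\frac{\partial}{\partial t}\pm\frac{\partial}{\partial x}\right)^{\alpha}$ is the operator with Fourier–Laplace multiplier $(s\pm i\xi)^{\alpha}$; for $0<\alpha<1$ it has the pointwise form $$\left(\frac{\partial}{\partial t}\pm\frac{\partial}{\partial x}\right)^{\alpha}u(x,t)=\frac{1}{\Gamma(1-\alpha)}\left(\frac{\partial}{\partial t}\pm\frac{\partial}{\partial x}\right)\int_0^t(t-s)^{-\alpha}u(x\mp(t-s),s)\,ds .$$ "Solution" means mild solution, obtained by inverting the Fourier–Laplace transformed problem $\left[p(s-i\xi)^\alpha+(1-p)(s+i\xi)^\alpha\right]U(\xi,s)=F(\xi,s)+\hat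 g(\xi)$, where $U$, $F$ are the Fourier–Laplace transforms of $u$, $f$ and $\hat g$ is the Fourier transform of $g$. Convolution is in the space variable: $(G_{t-\tau}*f)(x,\tau)=\int_{\mathbb{R}}G_{t-\tau}(x-y)f(y,\tau)\,dy$.
   Formalization: The "if" part also assumes u→δ; the equivalence for all t needs both space integrals continuous in t, else it is for a.e. t; the formula (a.e. (x,t), G_t a finite measure) is for u→δ or g=0. As printed it fails: p=1, g=0, f=t^{-α}h(x)/Γ(1-α) gives u→h. *)

theory Defs
  imports "HOL-Complex_Analysis.Complex_Analysis"
begin

text \<open>Space-time functions are written \<open>v x t\<close> (space first); only their values at
  \<open>t > 0\<close> are ever used.\<close>

definition test_function :: "(real \<Rightarrow> real) \<Rightarrow> bool" where
  "test_function \<psi> \<longleftrightarrow>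
     (\<forall>n x. ((deriv ^^ n) \<psi>) differentiable (at x)) \<and> (\<exists>R. \<forall>x. \<bar>x\<bar> > R \<longrightarrow> \<psi> x = 0)"

definition locally_integrable_on :: "real set \<Rightarrow> (real \<Rightarrow> real) \<Rightarrow> bool" where
  "locally_integrable_on S h \<longleftrightarrow> (\<forall>a b. {a..b} \<subseteq> S \<longrightarrow> set_integrable lborel {a..b} h)"

definition fourier :: "(real \<Rightarrow> real) \<Rightarrow> real \<Rightarrow> complex" where
  "fourier h \<xi> = (LINT x|lborel. cis (- (\<xi> * x)) * complex_of_real (h x))"

text \<open>The initial datum is only locally integrable, so its Fourier transform is taken as
  an improper integral; for integrable \<open>g\<close> this is \<^const>\<open>fourier\<close>.\<close>

definition has_fourier :: "(real \<Rightarrow> real) \<Rightarrow> (real \<Rightarrow> complex) \<Rightarrow> bool" where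
  "has_fourier g \<gamma> \<longleftrightarrow>
     (\<forall>\<xi>. ((\<lambda>R. LINT x:{-R..R}|lborel. cis (- (\<xi> * x)) * complex_of_real (g x))
            \<longlongrightarrow> \<gamma> \<xi>) at_top)"

definition fourier_laplace :: "(real \<Rightarrow> real \<Rightarrow> real) \<Rightarrow> real \<Rightarrow> complex \<Rightarrow> complex" where
  "fourier_laplace v \<xi> s =
     (LINT t:{0<..}|lborel. exp (- (s * complex_of_real t)) * fourier (\<lambda>x. v x t) \<xi>)"

text \<open>Absolute convergence of the Fourier--Laplace integral for \<open>Re s \<ge> \<sigma>\<close>.\<close>

definition fl_transformable :: "real \<Rightarrow> (real \<Rightarrow> real \<Rightarrow> real) \<Rightarrow> bool" where
  "fl_transformable \<sigma> v \<longleftrightarrow>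
     set_integrable (lborel \<Otimes>\<^sub>M lborel) (UNIV \<times> {0<..}) (\<lambda>(x, t). exp (- \<sigma> * t) * v x t)"

definition symbol :: "real \<Rightarrow> real \<Rightarrow> real \<Rightarrow> complex \<Rightarrow> complex" where
  "symbol \<alpha> p \<xi> s =
     complex_of_real p * (s - \<i> * complex_of_real \<xi>) powr complex_of_real \<alpha>
     + complex_of_real (1 - p) * (s + \<i> * complex_of_real \<xi>) powr complex_of_real \<alpha>"

definition mild_solution ::
  "real \<Rightarrow> real \<Rightarrow> (real \<Rightarrow> real \<Rightarrow> real) \<Rightarrow> (real \<Rightarrow> real) \<Rightarrow> (real \<Rightarrow> real \<Rightarrow> real) \<Rightarrow> bool" where
  "mild_solution \<alpha> p f g u \<longleftrightarrow>
     (\<exists>\<sigma>\<ge>0. \<exists>\<gamma>. fl_transformable \<sigma> u \<and> fl_transformable \<sigma> f \<and> has_fourier g \<gamma> \<and>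
        (\<forall>\<xi> s. Re s > \<sigma> \<longrightarrow>
           symbol \<alpha> p \<xi> s * fourier_laplace u \<xi> s = fourier_laplace f \<xi> s + \<gamma> \<xi>))"

definition tends_to_dirac :: "(real \<Rightarrow> real \<Rightarrow> real) \<Rightarrow> bool" where
  "tends_to_dirac u \<longleftrightarrow>
     (\<forall>\<psi>. test_function \<psi> \<longrightarrow> ((\<lambda>t. LINT x|lborel. u x t * \<psi> x) \<longlongrightarrow> \<psi> 0) (at_right 0))"

text \<open>Since the integral of a non-integrable function is \<open>0\<close>, the first conjunct includes
  integrability of \<open>u(\<cdot>,t)\<close>.\<close>

definition is_pdf_from_origin :: "(real \<Rightarrow> real \<Rightarrow> real) \<Rightarrow> bool" where
  "is_pdf_from_origin u \<longleftrightarrow> (\<forall>t>0. (LINT x|lborel. u x t) = 1) \<and> tends_to_dirac u"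

text \<open>\<open>y\<close> is the value at \<open>t\<close> of the Bromwich integral of \<open>h\<close>, over any vertical line to the
  right of the abscissa \<open>\<sigma>\<close>.\<close>

definition has_inverse_laplace :: "real \<Rightarrow> (complex \<Rightarrow> complex) \<Rightarrow> real \<Rightarrow> complex \<Rightarrow> bool" where
  "has_inverse_laplace \<sigma> h t y \<longleftrightarrow>
     (\<forall>c>\<sigma>. ((\<lambda>R. contour_integral (linepath (Complex c (- R)) (Complex c R))
                    (\<lambda>s. exp (s * complex_of_real t) * h s) / (2 * of_real pi * \<i>))
              \<longlongrightarrow> y) at_top)"

text \<open>The formula \<open>M(x) = (1 / 2 \<pi>) \<integral> e\<^sup>i\<^sup>\<xi>\<^sup>x v(\<xi>) d\<xi>\<close>, read weakly (paired with test functions),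
  for a finite measure \<open>M\<close>.  Functions \<open>M\<close> would not do: in the kernel below, \<open>p = 0\<close> and
  \<open>p = 1\<close> give a multiple of a Dirac measure at \<open>x = t\<close> and \<open>x = -t\<close>.\<close>

definition has_inverse_fourier :: "(real \<Rightarrow> complex) \<Rightarrow> real measure \<Rightarrow> bool" where
  "has_inverse_fourier v M \<longleftrightarrow>
     finite_measure M \<and> sets M = sets borel \<and>
     (\<forall>\<psi>. test_function \<psi> \<longrightarrow>
        integrable lborel
          (\<lambda>\<xi>. v \<xi> * (LINT x|lborel. cis (\<xi> * x) * complex_of_real (\<psi> x))) \<and>
        complex_of_real (LINT x|M. \<psi> x) =
          (LINT \<xi>|lborel. v \<xi> * (LINT x|lborel. cis (\<xi> * x) * complex_of_real (\<psi> x)))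
          / (2 * of_real pi))"

definition is_kernel :: "real \<Rightarrow> real \<Rightarrow> (real \<Rightarrow> real measure) \<Rightarrow> bool" where
  "is_kernel \<alpha> p G \<longleftrightarrow>
     (\<forall>t>0. \<exists>v. (\<forall>\<xi>. has_inverse_laplace 0 (\<lambda>s. 1 / symbol \<alpha> p \<xi> s) t (v \<xi>)) \<and>
               has_inverse_fourier v (G t))"

text \<open>With \<open>M(dx) = G(x) dx\<close> this is \<open>\<integral> G(x - y) h(y) dy\<close>.\<close>

definition measure_convolution :: "real measure \<Rightarrow> (real \<Rightarrow> real) \<Rightarrow> real \<Rightarrow> real" where
  "measure_convolution M h x = (LINT z|M. h (x - z))"

end

theory Submission
  imports Defs "HOL-Probability.Probability"
begin

text \<open>
  At frequency \<open>0\<close> the transformed equation reads \<open>s\<^sup>\<alpha> m\<^sub>u(s) = m\<^sub>f(s) + \<gamma>(0)\<close> for the Laplace transforms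
  of the total masses, so once \<open>\<gamma> = 0\<close> uniqueness of the Laplace transform gives the equivalence.
  If \<open>u\<close> tends to \<open>\<delta>\<close>, then for every test function \<open>\<psi>\<close> the quantity \<open>s\<^sup>\<alpha>\<close> times the Laplace transform
  of \<open>\<integral> u \<psi>\<close> tends to \<open>0\<close> as \<open>s\<close> grows, because \<open>\<alpha> < 1\<close>, while by the equation it tends to the pairing
  of \<open>\<gamma>\<close> with the Fourier transform of \<open>\<psi>\<close>; hence \<open>\<gamma> = 0\<close>.

  For the kernel let \<open>S, S'\<close> be independent one-sided \<open>\<alpha>\<close>-stable variables, \<open>A = (1-p)\<^bsup>1/\<alpha>\<^esup> S\<close>,
  \<open>B = p\<^bsup>1/\<alpha>\<^esup> S'\<close> and \<open>D = A + B\<close>. Then \<open>E exp(-r((s + i\<xi>) A + (s - i\<xi>) B)) = exp(-r\<^sup>\<alpha> symbol)\<close>; integrating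
  against \<open>\<alpha> r\<^bsup>\<alpha>-1\<^esup> dr\<close> and substituting \<open>r = t / D\<close> exhibits \<open>1 / symbol\<close> as the Fourier--Laplace
  transform of \<open>t\<^bsup>\<alpha>-1\<^esup>\<close> times the law of \<open>t (A - B) / D\<close> weighted by \<open>\<alpha> D\<^bsup>-\<alpha>\<^esup>\<close>. Pointwise Fourier inversion
  turns this into the Bromwich formula, and uniqueness of the two-dimensional Fourier transform into
  the representation of \<open>u\<close>.
\<close>

subsection \<open>Fourier transforms of integrable functions\<close>

text \<open>Transform identities are used on one vertical line Re s = c to the right of \<sigma>:
  the factor e^(-ct) makes the space-time functions integrable, and the Fourier--Laplace transform
  becomes an ordinary Fourier transform, to which uniqueness and inversion apply. The obstacle is
  that \<open>1 / symbol\<close> is not absolutely integrable on such a line, since it decays only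
  like |Im s|^(-\<alpha>); so neither positivity nor finiteness of the kernel can be read off from
  the Bromwich integral. The kernel is therefore built as an explicit positive measure and only then
  recognised by its transform. The stable variables come from the Sibuya law because its generating
  function 1 - (1 - z)^a already contains the desired power and is known for complex z, as required
  by the complex arguments s + i\<xi> and s - i\<xi>. The datum is a second obstacle: \<gamma> is
  only a pointwise limit of truncated integrals, so its continuity and growth must be recovered from
  the equation before it can be paired with test functions.\<close>

definition cfourier :: "(real \<Rightarrow> complex) \<Rightarrow> real \<Rightarrow> complex" where
  "cfourier h \<xi> = (LINT x|lborel. cis (- (\<xi> * x)) * h x)"

lemma fourier_eq_cfourier: "fourier h = cfourier (\<lambda>x. complex_of_real (h x))"
  by (simp add: fourier_def cfourier_def fun_eq_iff)

lemma borel_measurable_cis [measurable]: "cis \<in> borel_measurable borel"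
  by (intro borel_measurable_continuous_onI continuous_intros)

text \<open>On a vertical line the Laplace kernel splits into damping and oscillation; this is how
  Laplace transforms become Fourier transforms of damped functions.\<close>

lemma exp_Complex_mult: "exp (- (Complex c y * of_real t)) = cis (- (y * t)) * of_real (exp (- (c * t)))"
  unfolding cis_conv_exp exp_of_real[symmetric] exp_add[symmetric]
  by (rule arg_cong[where f = exp]) (auto simp: complex_eq_iff)

lemma integrable_cis_mult:
  fixes h :: "'a \<Rightarrow> complex"
  assumes "integrable M h" and [measurable]: "f \<in> borel_measurable M"
  shows "integrable M (\<lambda>x. cis (f x) * h x)"
proof -
  have [measurable]: "h \<in> borel_measurable M"
    using borel_measurable_integrable[OF assms(1)] .
  show ?thesis
    using assms(1) by (rule Bochner_Integration.integrable_bound) (auto simp: norm_mult)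
qed

lemma norm_integral_cis_mult_le:
  fixes h :: "'a \<Rightarrow> complex"
  assumes "integrable M h"
  shows "norm (LINT x|M. cis (f x) * h x) \<le> (LINT x|M. norm (h x))"
  using integral_norm_bound[of M "\<lambda>x. cis (f x) * h x"] by (simp add: norm_mult)

lemma norm_cfourier_le:
  assumes "integrable lborel h"
  shows "norm (cfourier h \<xi>) \<le> (LINT x|lborel. norm (h x))"
  unfolding cfourier_def by (rule norm_integral_cis_mult_le[OF assms])

lemma continuous_cfourier:
  assumes "integrable lborel h"
  shows "continuous_on UNIV (cfourier h)"
proof -
  have [measurable]: "h \<in> borel_measurable borel"
    using borel_measurable_integrable[OF assms] by simp
  have "(\<lambda>n. cfourier h (X n)) \<longlonglongrightarrow> cfourier h x" if "X \<longlonglongrightarrow> x" for X x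
    unfolding cfourier_def
  proof (rule integral_dominated_convergence[where w = "\<lambda>x. norm (h x)"])
    show "AE y in lborel. (\<lambda>n. cis (- (X n * y)) * h y) \<longlonglongrightarrow> cis (- (x * y)) * h y"
      using that by (auto intro!: tendsto_intros)
  qed (use assms in \<open>auto simp: norm_mult\<close>)
  then show ?thesis
    by (simp add: continuous_on_sequentially o_def)
qed

text \<open>The positive and negative parts have the same transform. Normalised, they are densities
  of two laws with equal characteristic functions; Levy's uniqueness theorem identifies the laws and
  hence the densities.\<close>

lemma cfourier_real_eq_0_imp_AE_0:
  fixes h :: "real \<Rightarrow> real"
  assumes h: "integrable lborel h" and 0: "\<And>\<xi>. cfourier (\<lambda>x. complex_of_real (h x)) \<xi> = 0"
  shows "AE x in lborel. h x = 0"
proof -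
  have [measurable]: "h \<in> borel_measurable borel"
    using borel_measurable_integrable[OF h] by simp
  define a where "a x = max 0 (h x)" for x
  define b where "b x = max 0 (- h x)" for x
  have [measurable]: "a \<in> borel_measurable borel" "b \<in> borel_measurable borel"
    unfolding a_def b_def by measurable
  have a: "integrable lborel a" and b: "integrable lborel b"
    using h unfolding a_def b_def by (auto intro!: integrable_max)
  have ab: "h x = a x - b x" and a0: "a x \<ge> 0" and b0: "b x \<ge> 0" for x
    by (auto simp: a_def b_def)
  have eq: "cfourier (\<lambda>x. complex_of_real (a x)) \<xi> = cfourier (\<lambda>x. complex_of_real (b x)) \<xi>" for \<xi>
  proof -
    have "cfourier (\<lambda>x. complex_of_real (h x)) \<xi> =
        cfourier (\<lambda>x. complex_of_real (a x)) \<xi> - cfourier (\<lambda>x. complex_of_real (b x)) \<xi>"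
      unfolding cfourier_def ab of_real_diff right_diff_distrib
      using a b by (intro Bochner_Integration.integral_diff integrable_cis_mult) auto
    then show ?thesis using 0 by simp
  qed
  \<comment> \<open>Frequency 0 shows that both parts have mass \<open>m\<close>; the normalisation
    needs \<open>m > 0\<close>.\<close>
  define m where "m = integral\<^sup>L lborel a"
  have mb: "integral\<^sup>L lborel b = m"
    using eq[of 0] unfolding m_def cfourier_def by simp
  show ?thesis
  proof (cases "m = 0")
    case True
    then have "AE x in lborel. a x = 0" "AE x in lborel. b x = 0"
      using integral_nonneg_eq_0_iff_AE[OF a] integral_nonneg_eq_0_iff_AE[OF b] a0 b0 mb m_def by auto
    then show ?thesis by eventually_elim (simp add: ab)
  next
    case False
    then have m: "m > 0"
      using a0 unfolding m_def by (simp add: order_less_le integral_nonneg_AE)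
    define D where "D c = density lborel (\<lambda>x. ennreal (c x / m))" for c :: "real \<Rightarrow> real"
    \<comment> \<open>\<open>char\<close> integrates e^(+i\<xi>x), hence the reflected
      argument.\<close>
    have rd: "real_distribution (D c)" and ch: "char (D c) = (\<lambda>\<xi>. cfourier (\<lambda>x. complex_of_real (c x)) (-\<xi>) / m)"
      if [measurable]: "c \<in> borel_measurable borel" and c: "integrable lborel c" "integral\<^sup>L lborel c = m" "\<And>x. c x \<ge> 0" for c
    proof -
      have "emeasure (D c) (space (D c)) = (\<integral>\<^sup>+x. ennreal (c x / m) \<partial>lborel)"
        by (simp add: D_def emeasure_density)
      also have "\<dots> = ennreal (LINT x|lborel. c x / m)"
        using c m by (intro nn_integral_eq_integral) auto
      also have "\<dots> = 1" using c m by simp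
      finally interpret prob_space "D c" by (intro prob_spaceI)
      show "real_distribution (D c)"
        by unfold_locales (auto simp: D_def)
      show "char (D c) = (\<lambda>\<xi>. cfourier (\<lambda>x. complex_of_real (c x)) (-\<xi>) / m)"
      proof
        fix \<xi>
        have "char (D c) \<xi> = (LINT x|lborel. (c x / m) *\<^sub>R iexp (\<xi> * x))"
          unfolding char_def D_def using c m
          by (subst integral_density) auto
        also have "\<dots> = cfourier (\<lambda>x. complex_of_real (c x)) (-\<xi>) / m"
          unfolding cfourier_def integral_divide_zero[symmetric]
          by (intro Bochner_Integration.integral_cong) (auto simp: cis_conv_exp scaleR_conv_of_real field_simps)
        finally show "char (D c) \<xi> = cfourier (\<lambda>x. complex_of_real (c x)) (-\<xi>) / m" .
      qed
    qed
    have "char (D a) = char (D b)"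
      using ch[of a] ch[of b] a b a0 b0 mb m_def eq by auto
    with rd[of a] rd[of b] have "D a = D b"
      using a b a0 b0 mb m_def by (intro Levy_uniqueness) auto
    then have "AE x in lborel. ennreal (a x / m) = ennreal (b x / m)"
      unfolding D_def by (subst (asm) sigma_finite_measure.density_unique_iff[OF sigma_finite_lborel]) auto
    then show ?thesis
      by eventually_elim (use m a0 b0 in \<open>auto simp: ab ennreal_inj\<close>)
  qed
qed

text \<open>Real and imaginary parts are combinations of \<open>h\<close> and \<open>cnj h\<close>,
  and conjugation only reflects the frequency, so both parts have vanishing transform.\<close>

lemma cfourier_eq_0_imp_AE_0:
  assumes h: "integrable lborel h" and 0: "\<And>\<xi>. cfourier h \<xi> = 0"
  shows "AE x in lborel. h x = 0"
proof -
  have cnj0: "cfourier (\<lambda>x. cnj (h x)) \<xi> = 0" for \<xi>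
  proof -
    have "cfourier (\<lambda>x. cnj (h x)) \<xi> = cnj (cfourier h (-\<xi>))"
      unfolding cfourier_def by (subst Bochner_Integration.integral_cnj[symmetric]) (simp add: cis_cnj)
    then show ?thesis using 0 by simp
  qed
  have hc: "integrable lborel (\<lambda>x. cnj (h x))" using h by simp
  have re: "complex_of_real (Re z) = (1/2) * z + (1/2) * cnj z"
    and im: "complex_of_real (Im z) = (-\<i>/2) * z + (\<i>/2) * cnj z" for z
    by (auto simp: complex_eq_iff)
  have lin: "cfourier (\<lambda>x. c * h x + d * cnj (h x)) \<xi> = 0" for c d \<xi>
  proof -
    have "cfourier (\<lambda>x. c * h x + d * cnj (h x)) \<xi> =
       (LINT x|lborel. c * (cis (- (\<xi> * x)) * h x) + d * (cis (- (\<xi> * x)) * cnj (h x)))"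
      unfolding cfourier_def by (intro Bochner_Integration.integral_cong) (auto simp: algebra_simps)
    also have "\<dots> = c * cfourier h \<xi> + d * cfourier (\<lambda>x. cnj (h x)) \<xi>"
      unfolding cfourier_def using h hc
      by (subst Bochner_Integration.integral_add) (auto intro!: integrable_mult_right integrable_cis_mult)
    finally show ?thesis using 0 cnj0 by simp
  qed
  have "AE x in lborel. Re (h x) = 0"
    using h lin unfolding re[symmetric] by (intro cfourier_real_eq_0_imp_AE_0) (auto simp only: re intro: integrable_Re)
  moreover have "AE x in lborel. Im (h x) = 0"
    using h lin by (intro cfourier_real_eq_0_imp_AE_0) (auto simp only: im intro: integrable_Im)
  ultimately show ?thesis
    by eventually_elim (simp add: complex_eq_iff)
qed

section \<open>The Riemann-Lebesgue lemma\<close>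

text \<open>Carrying integrability along frees the closure rules below of side conditions, so that
  they fit the inductions over sets and functions.\<close>

definition fourier_decays :: "(real \<Rightarrow> complex) \<Rightarrow> bool" where
  "fourier_decays h \<longleftrightarrow> integrable lborel h \<and> (cfourier h \<longlongrightarrow> 0) at_infinity"

lemma cfourier_add:
  assumes "integrable lborel f" "integrable lborel g"
  shows "cfourier (\<lambda>x. f x + g x) = (\<lambda>\<xi>. cfourier f \<xi> + cfourier g \<xi>)"
  unfolding cfourier_def distrib_left fun_eq_iff using assms
  by (intro allI Bochner_Integration.integral_add integrable_cis_mult) auto

lemma cfourier_diff:
  assumes "integrable lborel f" "integrable lborel g"
  shows "cfourier (\<lambda>x. f x - g x) = (\<lambda>\<xi>. cfourier f \<xi> - cfourier g \<xi>)"
  unfolding cfourier_def right_diff_distrib fun_eq_iff using assms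
  by (intro allI Bochner_Integration.integral_diff integrable_cis_mult) auto

lemma cfourier_cmult: "cfourier (\<lambda>x. c * f x) = (\<lambda>\<xi>. c * cfourier f \<xi>)"
  unfolding cfourier_def by (subst integral_mult_right_zero[symmetric]) (simp add: mult_ac)

lemma cfourier_0: "cfourier (\<lambda>x. 0) = (\<lambda>\<xi>. 0)"
  by (simp add: cfourier_def fun_eq_iff)

lemma integrable_complex_indicator:
  assumes "A \<in> sets M" "emeasure M A < \<infinity>"
  shows "integrable M (\<lambda>x. indicator A x :: complex)"
  using integrable_indicator[OF assms, of "1::complex"] by (simp add: scaleR_conv_of_real of_real_indicator)

lemma fourier_decays_add: "fourier_decays f \<Longrightarrow> fourier_decays g \<Longrightarrow> fourier_decays (\<lambda>x. f x + g x)"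
  unfolding fourier_decays_def using tendsto_add[of "cfourier f" 0 at_infinity "cfourier g" 0]
  by (auto simp: cfourier_add)

lemma fourier_decays_diff: "fourier_decays f \<Longrightarrow> fourier_decays g \<Longrightarrow> fourier_decays (\<lambda>x. f x - g x)"
  unfolding fourier_decays_def using tendsto_diff[of "cfourier f" 0 at_infinity "cfourier g" 0]
  by (auto simp: cfourier_diff)

lemma fourier_decays_cmult: "fourier_decays f \<Longrightarrow> fourier_decays (\<lambda>x. c * f x)"
  unfolding fourier_decays_def using tendsto_mult_left[of "cfourier f" 0 at_infinity c]
  by (auto simp: cfourier_cmult)

text \<open>The sup norm of a transform is at most the L^1 norm of the function, so L^1 limits give
  uniform limits of transforms, and vanishing at infinity survives these.\<close>

lemma fourier_decays_limit:
  assumes s: "\<And>n. fourier_decays (s n)" and h: "integrable lborel h"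
    and lim: "(\<lambda>n. LINT x|lborel. norm (s n x - h x)) \<longlonglongrightarrow> 0"
  shows "fourier_decays h"
  unfolding fourier_decays_def
proof
  show "(cfourier h \<longlongrightarrow> 0) at_infinity"
    unfolding tendsto_iff
  proof safe
    fix e :: real assume e: "e > 0"
    then have "eventually (\<lambda>n. (LINT x|lborel. norm (s n x - h x)) < e/2) sequentially"
      using lim by (intro order_tendstoD) auto
    then obtain n where n: "(LINT x|lborel. norm (s n x - h x)) < e/2"
      by (auto simp: eventually_sequentially)
    have "eventually (\<lambda>\<xi>. dist (cfourier (s n) \<xi>) 0 < e/2) at_infinity"
      using s[of n] e unfolding fourier_decays_def by (intro tendstoD) auto
    then show "eventually (\<lambda>\<xi>. dist (cfourier h \<xi>) 0 < e) at_infinity"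
    proof eventually_elim
      case (elim \<xi>)
      have "norm (cfourier (s n) \<xi> - cfourier h \<xi>) \<le> (LINT x|lborel. norm (s n x - h x))"
        using s[of n] h norm_cfourier_le[of "\<lambda>x. s n x - h x" \<xi>]
        by (simp add: fourier_decays_def cfourier_diff)
      then show ?case
        using n elim norm_triangle_ineq4[of "cfourier (s n) \<xi>" "cfourier (s n) \<xi> - cfourier h \<xi>"]
        by simp
    qed
  qed
qed (fact h)

text \<open>Domination by \<open>w\<close> yields convergence in L^1, with \<open>2 * w\<close>
  dominating the differences.\<close>

lemma fourier_decays_dominated:
  assumes s: "\<And>n. fourier_decays (s n)" and w: "integrable lborel w"
    and lim: "\<And>x. (\<lambda>n. s n x) \<longlonglongrightarrow> h x" and le: "\<And>n x. norm (s n x) \<le> w x"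
  shows "fourier_decays h"
proof -
  have [measurable]: "s n \<in> borel_measurable lborel" "w \<in> borel_measurable lborel" for n
    using s[of n] w by (auto simp: fourier_decays_def dest: borel_measurable_integrable)
  have [measurable]: "h \<in> borel_measurable lborel"
    by (rule borel_measurable_LIMSEQ_metric[of s]) (use lim in auto)
  have h_le: "norm (h x) \<le> w x" for x
    using lim le by (intro LIMSEQ_le_const2[OF tendsto_norm[OF lim]]) auto
  show ?thesis
  proof (rule fourier_decays_limit[OF s])
    have w0: "w x \<ge> 0" for x using le[of 0 x] norm_ge_zero order_trans by blast
    show "integrable lborel h"
      by (rule Bochner_Integration.integrable_bound[OF w]) (use h_le w0 in \<open>auto intro: order_trans\<close>)
    have "(\<lambda>n. integral\<^sup>L lborel (\<lambda>x. norm (s n x - h x))) \<longlonglongrightarrow> integral\<^sup>L lborel (\<lambda>x::real. 0::real)"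
    proof (rule integral_dominated_convergence[where w = "\<lambda>x. 2 * w x" and f = "\<lambda>x::real. 0::real" and s = "\<lambda>n x. norm (s n x - h x)"])
      show "integrable lborel (\<lambda>x. 2 * w x)" using w by simp
      show "AE x in lborel. (\<lambda>n. norm (s n x - h x)) \<longlonglongrightarrow> 0"
        using lim by (intro AE_I2 tendsto_norm_zero) (auto simp: LIM_zero_iff)
      show "AE x in lborel. norm (norm (s n x - h x)) \<le> 2 * w x" for n
      proof (rule AE_I2)
        fix x
        show "norm (norm (s n x - h x)) \<le> 2 * w x"
          using norm_triangle_ineq4[of "s n x" "h x"] le[of n x] h_le[of x] by simp
      qed
    qed auto
    then show "(\<lambda>n. integral\<^sup>L lborel (\<lambda>x. norm (s n x - h x))) \<longlonglongrightarrow> 0" by simp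
  qed
qed

text \<open>The antiderivative of the character has constant modulus 1 / |\<xi>|; its two boundary
  values give the factor 2.\<close>

lemma cfourier_indicator_Icc:
  assumes "a \<le> b" "\<xi> \<noteq> 0"
  shows "norm (cfourier (\<lambda>x. indicator {a..b} x) \<xi>) \<le> 2 / \<bar>\<xi>\<bar>"
proof -
  define F where "F x = (\<i> / complex_of_real \<xi>) * cis (- (\<xi> * x))" for x
  have "((\<lambda>x. cis (- (\<xi> * x))) has_integral (F b - F a)) {a..b}"
  proof (rule fundamental_theorem_of_calculus[OF assms(1)])
    fix x
    show "(F has_vector_derivative cis (- (\<xi> * x))) (at x within {a..b})"
    proof -
      have "((\<lambda>z. (\<i> / complex_of_real \<xi>) * exp (- (\<i> * \<xi> * z))) has_field_derivative
          exp (- (\<i> * \<xi> * of_real x))) (at (of_real x))"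
        using assms by (auto intro!: derivative_eq_intros simp: field_simps)
      from has_vector_derivative_real_field[OF this] show ?thesis
        unfolding F_def cis_conv_exp by (simp add: mult_ac)
    qed
  qed
  moreover have "set_integrable lborel {a..b} (\<lambda>x. cis (- (\<xi> * x)))"
    by (rule borel_integrable_atLeastAtMost') (intro continuous_intros)
  ultimately have "(LINT x:{a..b}|lborel. cis (- (\<xi> * x))) = F b - F a"
    by (metis set_borel_integral_eq_integral(2) integral_unique)
  moreover have "cfourier (\<lambda>x. indicator {a..b} x) \<xi> = (LINT x:{a..b}|lborel. cis (- (\<xi> * x)))"
    unfolding cfourier_def set_lebesgue_integral_def
    by (intro Bochner_Integration.integral_cong) (auto split: split_indicator)
  moreover have "norm (F b - F a) \<le> norm (F b) + norm (F a)"
    by (rule norm_triangle_ineq4)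
  ultimately show ?thesis
    by (simp add: F_def norm_mult norm_divide)
qed

lemma fourier_decays_indicator_Icc: "fourier_decays (\<lambda>x. indicator {a..b} x)"
proof (cases "a \<le> b")
  case True
  have "(cfourier (\<lambda>x. indicator {a..b} x) \<longlongrightarrow> 0) at_infinity"
  proof (rule Lim_null_comparison)
    show "eventually (\<lambda>\<xi>. norm (cfourier (\<lambda>x. indicator {a..b} x) \<xi>) \<le> 2 / \<bar>\<xi>\<bar>) at_infinity"
      using eventually_not_equal_at_infinity[of 0]
      by eventually_elim (use True in \<open>auto intro: cfourier_indicator_Icc\<close>)
    show "((\<lambda>\<xi>::real. 2 / \<bar>\<xi>\<bar>) \<longlongrightarrow> 0) at_infinity"
      by (intro tendsto_divide_0[OF tendsto_const] filterlim_at_top_imp_at_infinity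
         filterlim_norm_at_top[where 'a=real, unfolded real_norm_def])
  qed
  then show ?thesis unfolding fourier_decays_def by (auto intro!: integrable_complex_indicator simp: emeasure_lborel_Icc_eq)
next
  case False
  then show ?thesis by (simp add: fourier_decays_def cfourier_0)
qed

text \<open>A Dynkin argument from the pi-system of half-lines. The window \<open>{-r..r}\<close>
  keeps all indicators integrable, so that complements, being differences inside the window, stay in
  the class.\<close>

lemma fourier_decays_indicator_bounded:
  assumes "A \<in> sets borel"
  shows "fourier_decays (\<lambda>x. indicator (A \<inter> {-r..r}) x)"
proof -
  have "A \<in> sigma_sets UNIV (range (\<lambda>a::real. {..a}))"
    using assms unfolding borel_eq_atMost by simp
  then show ?thesis
  proof (induction rule: sigma_sets_induct_disjoint[rotated 2, consumes 1, case_names basic empty compl union])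
    case (basic A)
    then obtain a where "A = {..a}" by auto
    then have "A \<inter> {-r..r} = {-r..min a r}" by auto
    then show ?case by (simp add: fourier_decays_indicator_Icc)
  next
    case empty
    then show ?case by (simp add: fourier_decays_def cfourier_0)
  next
    case (compl A)
    have "(\<lambda>x. indicator ((UNIV - A) \<inter> {-r..r}) x) = (\<lambda>x. indicator {-r..r} x - indicator (A \<inter> {-r..r}) x :: complex)"
      by (auto split: split_indicator)
    then show ?case using fourier_decays_diff[OF fourier_decays_indicator_Icc compl(2)] by simp
  next
    case (union A)
    \<comment> \<open>Finite partial unions converge pointwise to the union, dominated by the
      indicator of the window.\<close>
    define B where "B n = (\<Union>i<n. A i)" for n :: nat
    have As: "A i \<in> sets borel" for i
      using union(2) unfolding borel_eq_atMost by auto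
    have B: "fourier_decays (\<lambda>x. indicator (B n \<inter> {-r..r}) x)" for n
    proof (induction n)
      case 0
      then show ?case by (simp add: B_def fourier_decays_def cfourier_0)
    next
      case (Suc n)
      have "A n \<inter> B n = {}"
      proof -
        have "A n \<inter> A i = {}" if "i < n" for i
          using disjoint_family_onD[OF union(1), of n i] that by simp
        then show ?thesis by (auto simp: B_def)
      qed
      moreover have "B (Suc n) = B n \<union> A n" by (auto simp: B_def less_Suc_eq)
      ultimately have "(\<lambda>x. indicator (B (Suc n) \<inter> {-r..r}) x) =
          (\<lambda>x. indicator (B n \<inter> {-r..r}) x + indicator (A n \<inter> {-r..r}) x :: complex)"
        by (auto simp: fun_eq_iff indicator_def)
      then show ?case using fourier_decays_add[OF Suc union(3)] by simp
    qed
    have Bs [measurable]: "B n \<in> sets borel" for n using As by (auto simp: B_def)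
    have Us [measurable]: "(\<Union>i. A i) \<in> sets borel" using As by auto
    show ?case
    proof (rule fourier_decays_dominated[OF B])
      show "integrable lborel (indicator {-r..r} :: real \<Rightarrow> real)"
        by (intro integrable_real_indicator) (auto simp: emeasure_lborel_Icc_eq)
      show "(\<lambda>n. indicator (B n \<inter> {-r..r}) x) \<longlonglongrightarrow> (indicator (\<Union> (range A) \<inter> {-r..r}) x :: complex)" for x
      proof (rule tendsto_eventually)
        show "eventually (\<lambda>n. indicator (B n \<inter> {-r..r}) x = (indicator (\<Union> (range A) \<inter> {-r..r}) x :: complex)) sequentially"
        proof (cases "x \<in> (\<Union> (range A))")
          case True
          then obtain i where "x \<in> A i" by auto
          then have "x \<in> B n" if "n \<ge> Suc i" for n using that by (auto simp: B_def)
          then show ?thesis using True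
            by (intro eventually_sequentiallyI[of "Suc i"]) (simp add: indicator_def)
        next
          case False
          then have "x \<notin> B n" for n by (auto simp: B_def)
          then show ?thesis using False by (simp add: indicator_def)
        qed
      qed
      show "norm (indicator (B n \<inter> {-r..r}) x :: complex) \<le> indicator {-r..r} x" for n x
        by (simp add: indicator_def)
    qed
  next
    show "Int_stable (range (\<lambda>a::real. {..a}))"
      by (rule Int_stableI) (auto simp: Int_atMost)
  qed simp
qed

lemma fourier_decays_indicator:
  assumes [measurable]: "A \<in> sets borel" and fin: "emeasure lborel A < \<infinity>"
  shows "fourier_decays (\<lambda>x. indicator A x)"
proof (rule fourier_decays_dominated)
  show "fourier_decays (\<lambda>x. indicator (A \<inter> {-real n..real n}) x)" for n
    by (rule fourier_decays_indicator_bounded) fact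
  show "integrable lborel (indicator A :: real \<Rightarrow> real)"
    using fin by (intro integrable_real_indicator) auto
  show "(\<lambda>n. indicator (A \<inter> {-real n..real n}) x) \<longlonglongrightarrow> (indicator A x :: complex)" for x
  proof (rule tendsto_eventually)
    obtain N where N: "\<bar>x\<bar> \<le> real N" using real_arch_simple by blast
    show "eventually (\<lambda>n. indicator (A \<inter> {-real n..real n}) x = (indicator A x :: complex)) sequentially"
    proof (rule eventually_sequentiallyI[of N])
      fix n assume "N \<le> n"
      then have "\<bar>x\<bar> \<le> real n" using N by simp
      then show "indicator (A \<inter> {-real n..real n}) x = (indicator A x :: complex)"
        by (auto simp: indicator_def)
    qed
  qed
qed (simp_all add: indicator_def)

theorem Riemann_Lebesgue:
  assumes "integrable lborel h"
  shows "(cfourier h \<longlongrightarrow> 0) at_infinity"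
proof -
  from assms have "fourier_decays h"
  proof (induction rule: integrable_induct)
    case (base A c)
    then have "fourier_decays (\<lambda>x. c * indicator A x)" by (intro fourier_decays_cmult fourier_decays_indicator) auto
    moreover have "(\<lambda>x. c * indicator A x) = (\<lambda>x. indicator A x *\<^sub>R c)"
      by (auto simp: indicator_def fun_eq_iff)
    ultimately show ?case by simp
  next
    case (add f g)
    from fourier_decays_add[OF add(3,4)] show ?case .
  next
    case (lim f s)
    show ?case
    proof (rule fourier_decays_dominated[OF lim(5)])
      show "integrable lborel (\<lambda>x. 2 * norm (f x))" using lim(4) by simp
    qed (use lim in auto)
  qed
  then show ?thesis by (simp add: fourier_decays_def)
qed

section \<open>Pointwise Fourier inversion\<close>

lemma (in pair_sigma_finite) integrable_mult_prod:
  fixes f g :: "_ \<Rightarrow> 'c::{real_normed_field, banach, second_countable_topology}"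
  assumes f: "integrable M1 f" and g: "integrable M2 g"
  shows "integrable (M1 \<Otimes>\<^sub>M M2) (\<lambda>(x, y). f x * g y)"
proof (rule Fubini_integrable)
  have [measurable]: "f \<in> borel_measurable M1" "g \<in> borel_measurable M2"
    using f g by auto
  show "(\<lambda>(x, y). f x * g y) \<in> borel_measurable (M1 \<Otimes>\<^sub>M M2)" by measurable
qed (use f g in \<open>auto simp: norm_mult\<close>)

lemma cfourier_gaussian:
  "cfourier (\<lambda>y. complex_of_real (exp (- y\<^sup>2 / 2))) \<eta> = complex_of_real (sqrt (2 * pi) * exp (- \<eta>\<^sup>2 / 2))"
proof -
  have "complex_of_real (exp (- \<eta>\<^sup>2 / 2)) = char std_normal_distribution (- \<eta>)"
    by (simp add: char_std_normal_distribution)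
  also have "\<dots> = (LINT y|lborel. std_normal_density y *\<^sub>R iexp (- \<eta> * y))"
    unfolding char_def by (subst integral_density) auto
  also have "\<dots> = (LINT y|lborel. (1 / complex_of_real (sqrt (2 * pi))) * (cis (- (\<eta> * y)) * complex_of_real (exp (- y\<^sup>2 / 2))))"
    by (intro Bochner_Integration.integral_cong)
       (auto simp: normal_density_def cis_conv_exp scaleR_conv_of_real mult_ac)
  also have "\<dots> = (1 / complex_of_real (sqrt (2 * pi))) * cfourier (\<lambda>y. complex_of_real (exp (- y\<^sup>2 / 2))) \<eta>"
    unfolding cfourier_def by (rule integral_mult_right_zero)
  finally show ?thesis by (simp add: field_simps)
qed

lemma integrable_gaussian: "integrable lborel (\<lambda>y::real. exp (- y\<^sup>2 / 2))"
  and integral_gaussian: "(LINT y|lborel. exp (- y\<^sup>2 / 2)) = sqrt (2 * pi)"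
proof -
  have eq: "(\<lambda>y::real. exp (- y\<^sup>2 / 2)) = (\<lambda>y. sqrt (2 * pi) * std_normal_density y)"
    by (auto simp: normal_density_def fun_eq_iff)
  show "integrable lborel (\<lambda>y::real. exp (- y\<^sup>2 / 2))"
    unfolding eq by (intro integrable_mult_right integrable_normal_density) simp
  show "(LINT y|lborel. exp (- y\<^sup>2 / 2)) = sqrt (2 * pi)"
    unfolding eq by (simp add: integral_normal_density)
qed

lemma tendsto_set_integral_symmetric:
  fixes f :: "real \<Rightarrow> complex"
  assumes "integrable lborel f"
  shows "((\<lambda>R. LINT x:{-R..R}|lborel. f x) \<longlongrightarrow> (LINT x|lborel. f x)) at_top"
  unfolding set_lebesgue_integral_def
proof (rule integral_dominated_convergence_at_top[where w = "\<lambda>x. norm (f x)"])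
  have [measurable]: "f \<in> borel_measurable borel" using assms by auto
  show "(\<lambda>x. indicator {-R..R} x *\<^sub>R f x) \<in> borel_measurable lborel" for R by measurable
  show "AE x in lborel. ((\<lambda>R. indicator {-R..R} x *\<^sub>R f x) \<longlongrightarrow> f x) at_top"
  proof (intro AE_I2 tendsto_eventually)
    fix x :: real
    show "eventually (\<lambda>R. indicator {-R..R} x *\<^sub>R f x = f x) at_top"
      using eventually_ge_at_top[of "\<bar>x\<bar>"] by eventually_elim (auto simp: indicator_def)
  qed
qed (use assms in \<open>auto simp: indicator_def\<close>)

text \<open>The factor \<open>y\<close> absorbs the division by \<open>y\<close> in the
  antiderivative, so \<open>y = 0\<close> needs no separate case.\<close>

lemma integral_cis_Icc:
  assumes "0 \<le> R"
  shows "(LINT \<eta>:{-R..R}|lborel. cis (- (\<eta> * y)) * of_real y) = \<i> * (cis (- (R * y)) - cis (- ((-R) * y)))"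
proof -
  have "((\<lambda>\<eta>. cis (- (\<eta> * y)) * of_real y) has_integral
      (\<i> * exp (- (\<i> * y * R)) - \<i> * exp (- (\<i> * y * (-R))))) {-R..R}"
  proof (rule fundamental_theorem_of_calculus)
    fix x
    have "((\<lambda>z. \<i> * exp (- (\<i> * y * z))) has_field_derivative exp (- (\<i> * y * of_real x)) * y) (at (of_real x))"
      by (auto intro!: derivative_eq_intros simp: field_simps)
    from has_vector_derivative_real_field[OF this]
    show "((\<lambda>x. \<i> * exp (- (\<i> * y * of_real x))) has_vector_derivative cis (- (x * y)) * y) (at x within {-R..R})"
      by (simp add: cis_conv_exp mult_ac)
  qed (use assms in simp)
  moreover have "set_integrable lborel {-R..R} (\<lambda>\<eta>. cis (- (\<eta> * y)) * of_real y)"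
    by (rule borel_integrable_atLeastAtMost') (intro continuous_intros)
  ultimately have "(LINT \<eta>:{-R..R}|lborel. cis (- (\<eta> * y)) * of_real y) = \<i> * exp (- (\<i> * y * R)) - \<i> * exp (- (\<i> * y * (-R)))"
    by (metis set_borel_integral_eq_integral(2) integral_unique)
  then show ?thesis by (simp add: cis_conv_exp mult_ac right_diff_distrib)
qed

text \<open>Formally the transform of y q(y) is i times the derivative of the transform of
  \<open>q\<close>, so its integral gives boundary values. Fubini yields this without
  differentiating a transform.\<close>

lemma integral_Icc_cfourier_mult_id:
  assumes q: "integrable lborel q" and yq: "integrable lborel (\<lambda>y. of_real y * q y)" and R: "R \<ge> 0"
  shows "(LINT \<eta>:{-R..R}|lborel. cfourier (\<lambda>y. of_real y * q y) \<eta>) = \<i> * (cfourier q R - cfourier q (-R))"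
proof -
  have [measurable]: "q \<in> borel_measurable borel" using q by auto
  define f where "f = (\<lambda>\<eta> y. indicator {-R..R} \<eta> *\<^sub>R (cis (- (\<eta> * y)) * (of_real y * q y)))"
  have "integrable lborel (\<lambda>\<eta>. indicator {-R..R} \<eta> :: complex)"
    using R by (intro integrable_complex_indicator) (auto simp: emeasure_lborel_Icc_eq)
  from lborel_pair.integrable_mult_prod[OF this yq]
  have fi: "integrable (lborel \<Otimes>\<^sub>M lborel) (\<lambda>(\<eta>, y). f \<eta> y)"
    by (rule Bochner_Integration.integrable_bound)
       (auto simp: f_def norm_mult indicator_def intro!: borel_measurable_continuous_on_indicator)
  have "(LINT \<eta>:{-R..R}|lborel. cfourier (\<lambda>y. of_real y * q y) \<eta>) = (LINT \<eta>|lborel. LINT y|lborel. f \<eta> y)"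
    unfolding set_lebesgue_integral_def cfourier_def f_def by simp
  also have "\<dots> = (LINT y|lborel. LINT \<eta>|lborel. f \<eta> y)"
    by (rule lborel_pair.Fubini_integral[OF fi, symmetric])
  also have "\<dots> = (LINT y|lborel. \<i> * (cis (- (R * y)) * q y - cis (- ((-R) * y)) * q y))"
  proof (rule Bochner_Integration.integral_cong[OF refl])
    fix y
    have "(LINT \<eta>|lborel. f \<eta> y) = (LINT \<eta>:{-R..R}|lborel. cis (- (\<eta> * y)) * of_real y) * q y"
      unfolding f_def set_lebesgue_integral_def
      by (subst integral_mult_left_zero[symmetric]) (simp add: mult_ac scaleR_conv_of_real)
    then show "(LINT \<eta>|lborel. f \<eta> y) = \<i> * (cis (- (R * y)) * q y - cis (- ((-R) * y)) * q y)"
      unfolding integral_cis_Icc[OF R] by (simp add: algebra_simps)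
  qed
  also have "\<dots> = \<i> * (cfourier q R - cfourier q (-R))"
    unfolding cfourier_def integral_mult_right_zero using q
    by (subst Bochner_Integration.integral_diff) (auto intro!: integrable_cis_mult)
  finally show ?thesis .
qed

lemma Fourier_inversion_at_0:
  fixes k :: "real \<Rightarrow> complex"
  assumes k: "integrable lborel k" and d: "d > 0"
    and lip: "\<And>y. \<bar>y\<bar> < d \<Longrightarrow> norm (k y - k 0) \<le> B * \<bar>y\<bar>"
  shows "((\<lambda>R. LINT \<eta>:{-R..R}|lborel. cfourier k \<eta>) \<longlongrightarrow> 2 * pi * k 0) at_top"
proof -
  have [measurable]: "k \<in> borel_measurable borel" using k by auto
  text \<open>Subtracting \<open>k(0)\<close> times a Gaussian leaves \<open>y q(y)\<close> with \<open>q\<close> integrable; the transform of \<open>y q(y)\<close>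
    integrates to boundary values of the transform of \<open>q\<close>, which vanish by Riemann--Lebesgue.\<close>
  define w :: "real \<Rightarrow> complex" where "w y = of_real (exp (- y\<^sup>2 / 2))" for y
  have [measurable]: "w \<in> borel_measurable borel" unfolding w_def by measurable
  have w: "integrable lborel w" unfolding w_def using integrable_gaussian by simp
  define q where "q y = (k y - k 0 * w y) / of_real y" for y
  \<comment> \<open>At \<open>y = 0\<close> the quotient is 0 by convention and the right side is 0
    because \<open>w 0 = 1\<close>, so the identity holds everywhere.\<close>
  have yq: "(\<lambda>y. of_real y * q y) = (\<lambda>y. k y - k 0 * w y)"
    by (auto simp: q_def w_def fun_eq_iff)
  have k0w: "integrable lborel (\<lambda>y. k 0 * w y)" using w by simp
  have B: "B \<ge> 0"
  proof -
    have "0 \<le> B * (d / 2)"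
      using order_trans[OF norm_ge_zero lip[of "d/2"]] d by simp
    then show ?thesis using d by (simp add: zero_le_mult_iff)
  qed
  have q: "integrable lborel q"
  proof (rule Bochner_Integration.integrable_bound)
    \<comment> \<open>Where |y| < d the Lipschitz bounds of \<open>k\<close> and of the Gaussian
      make \<open>q\<close> bounded; elsewhere dividing by |y| costs at most 1 / d.\<close>
    show "integrable lborel (\<lambda>y. (B + norm (k 0) * d) * indicator {-d..d} y + (norm (k y) + norm (k 0 * w y)) / d)"
      using k k0w w d by (intro Bochner_Integration.integrable_add integrable_divide integrable_norm integrable_mult_right
           integrable_real_indicator) (auto simp: emeasure_lborel_Icc_eq)
    show "AE y in lborel. norm (q y) \<le> norm ((B + norm (k 0) * d) * indicator {-d..d} y + (norm (k y) + norm (k 0 * w y)) / d)"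
    proof (rule AE_I2)
      fix y
      have nn: "(norm (k y) + norm (k 0 * w y)) / d \<ge> 0" using d by auto
      have "norm (q y) \<le> (B + norm (k 0) * d) * indicator {-d..d} y + (norm (k y) + norm (k 0 * w y)) / d"
      proof (cases "\<bar>y\<bar> < d")
        case True
        have n1: "norm (k y - k 0 * w y) \<le> norm (k y - k 0) + norm (k 0) * norm (1 - w y)"
        proof -
          have "k y - k 0 * w y = (k y - k 0) + k 0 * (1 - w y)" by (simp add: algebra_simps)
          then show ?thesis by (metis norm_triangle_ineq norm_mult)
        qed
        have "norm (1 - w y) = \<bar>1 - exp (- y\<^sup>2 / 2)\<bar>"
          unfolding w_def by (metis norm_of_real of_real_1 of_real_diff)
        also have "\<dots> \<le> y\<^sup>2 / 2"
          using exp_ge_add_one_self[of "- y\<^sup>2 / 2"] by (simp add: abs_if)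
        also have "\<dots> \<le> d * \<bar>y\<bar>"
        proof -
          have "y\<^sup>2 = \<bar>y\<bar> * \<bar>y\<bar>" by (simp add: power2_eq_square)
          also have "\<dots> \<le> d * \<bar>y\<bar>" using True by (intro mult_right_mono) auto
          finally show ?thesis using zero_le_power2[of y] by linarith
        qed
        finally have "norm (k 0) * norm (1 - w y) \<le> norm (k 0) * (d * \<bar>y\<bar>)"
          by (rule mult_left_mono) simp
        then have "norm (k y - k 0 * w y) \<le> (B + norm (k 0) * d) * \<bar>y\<bar>"
          using lip[OF True] n1 by (simp add: algebra_simps)
        then have "norm (q y) \<le> B + norm (k 0) * d"
          using B d unfolding q_def by (cases "y = 0") (auto simp: norm_divide divide_simps)
        moreover have "indicator {-d..d} y = (1::real)" using True by (auto simp: indicator_def)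
        ultimately show ?thesis using nn by simp
      next
        case False
        have "norm (q y) \<le> (norm (k y) + norm (k 0 * w y)) / \<bar>y\<bar>"
          unfolding q_def norm_divide using norm_triangle_ineq4[of "k y" "k 0 * w y"]
          by (simp add: divide_right_mono)
        also have "\<dots> \<le> (norm (k y) + norm (k 0 * w y)) / d"
          using False d by (intro divide_left_mono) auto
        finally show ?thesis using B d
          by (intro order_trans[OF _ add_increasing]) (auto simp: indicator_def)
      qed
      then show "norm (q y) \<le> norm ((B + norm (k 0) * d) * indicator {-d..d} y + (norm (k y) + norm (k 0 * w y)) / d)"
        by simp
    qed
  qed (simp add: q_def[abs_def])
  have "((\<lambda>R. \<i> * (cfourier q R - cfourier q (-R))) \<longlongrightarrow> \<i> * (0 - 0)) at_top"
  proof (intro tendsto_intros)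
    show "((\<lambda>R. cfourier q R) \<longlongrightarrow> 0) at_top"
      using Riemann_Lebesgue[OF q] by (rule filterlim_compose) (auto intro: filterlim_at_top_imp_at_infinity filterlim_ident)
    show "((\<lambda>R. cfourier q (- R)) \<longlongrightarrow> 0) at_top"
      using Riemann_Lebesgue[OF q]
      by (rule filterlim_compose) (rule filterlim_at_bot_imp_at_infinity[OF filterlim_uminus_at_bot_at_top])
  qed
  then have lim: "((\<lambda>R. \<i> * (cfourier q R - cfourier q (-R))) \<longlongrightarrow> 0) at_top" by simp
  have "((\<lambda>R. LINT \<eta>:{-R..R}|lborel. cfourier (\<lambda>y. of_real y * q y) \<eta>) \<longlongrightarrow> 0) at_top"
  proof (rule Lim_transform_eventually[OF lim])
    show "eventually (\<lambda>R. \<i> * (cfourier q R - cfourier q (-R)) =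
        (LINT \<eta>:{-R..R}|lborel. cfourier (\<lambda>y. of_real y * q y) \<eta>)) at_top"
      using eventually_ge_at_top[of 0]
    proof eventually_elim
      case (elim R)
      have "integrable lborel (\<lambda>y. of_real y * q y)" unfolding yq using k k0w by simp
      from integral_Icc_cfourier_mult_id[OF q this elim] show ?case by simp
    qed
  qed
  \<comment> \<open>The Gaussian has an integrable transform, so its inversion is one explicit
    integral: sqrt(2 pi) comes from the transform and another sqrt(2 pi) from integrating
    it.\<close>
  moreover have "((\<lambda>R. LINT \<eta>:{-R..R}|lborel. cfourier w \<eta>) \<longlongrightarrow> 2 * pi) at_top"
  proof -
    have eq: "cfourier w = (\<lambda>\<eta>. complex_of_real (sqrt (2 * pi) * exp (- \<eta>\<^sup>2 / 2)))"
      using cfourier_gaussian unfolding w_def by auto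
    have "integrable lborel (cfourier w)" 
      unfolding eq using integrable_gaussian by (intro integrable_of_real integrable_mult_right)
    moreover have "(LINT \<eta>|lborel. cfourier w \<eta>) = 2 * pi"
      unfolding eq integral_complex_of_real using integral_gaussian by simp
    ultimately show ?thesis
      using tendsto_set_integral_symmetric[of "cfourier w"] by simp
  qed
  ultimately have "((\<lambda>R. (LINT \<eta>:{-R..R}|lborel. cfourier (\<lambda>y. of_real y * q y) \<eta>)
      + k 0 * (LINT \<eta>:{-R..R}|lborel. cfourier w \<eta>)) \<longlongrightarrow> 0 + k 0 * (2 * pi)) at_top"
    by (intro tendsto_intros)
  moreover have "(LINT \<eta>:{-R..R}|lborel. cfourier (\<lambda>y. of_real y * q y) \<eta>)
      + k 0 * (LINT \<eta>:{-R..R}|lborel. cfourier w \<eta>) = (LINT \<eta>:{-R..R}|lborel. cfourier k \<eta>)" for R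
  proof -
    have c: "set_integrable lborel {-R..R} (cfourier h)" if "integrable lborel h" for h
      using continuous_cfourier[OF that] by (intro borel_integrable_atLeastAtMost') (auto intro: continuous_on_subset)
    have "cfourier (\<lambda>y. of_real y * q y) = (\<lambda>\<eta>. cfourier k \<eta> - k 0 * cfourier w \<eta>)"
      unfolding yq cfourier_diff[OF k k0w] cfourier_cmult ..
    then show ?thesis
      using c[OF k] c[OF w] by (simp add: set_integral_diff)
  qed
  ultimately show ?thesis by (simp add: mult_ac)
qed

lemma cfourier_translate: "cfourier (\<lambda>x. h (t + x)) \<xi> = cis (\<xi> * t) * cfourier h \<xi>"
proof -
  have "cfourier h \<xi> = (LINT x|lborel. cis (- (\<xi> * (t + x))) * h (t + x))"
    unfolding cfourier_def by (subst lborel_integral_real_affine[of 1 _ t]) auto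
  also have "\<dots> = (LINT x|lborel. cis (- (\<xi> * t)) * (cis (- (\<xi> * x)) * h (t + x)))"
    by (intro Bochner_Integration.integral_cong) (auto simp: cis_mult algebra_simps)
  also have "\<dots> = cis (- (\<xi> * t)) * cfourier (\<lambda>x. h (t + x)) \<xi>"
    unfolding cfourier_def by (rule integral_mult_right_zero)
  finally show ?thesis by (simp add: cis_mult flip: mult.assoc)
qed

theorem Fourier_inversion_at:
  fixes k :: "real \<Rightarrow> complex"
  assumes k: "integrable lborel k" and d: "d > 0"
    and lip: "\<And>y. \<bar>y - t\<bar> < d \<Longrightarrow> norm (k y - k t) \<le> B * \<bar>y - t\<bar>"
  shows "((\<lambda>R. LINT \<eta>:{-R..R}|lborel. cis (\<eta> * t) * cfourier k \<eta>) \<longlongrightarrow> 2 * pi * k t) at_top"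
  using Fourier_inversion_at_0[of "\<lambda>y. k (t + y)" d B] lip[of "t + _"] d
    lborel_integrable_real_affine[OF k, of 1 t]
  by (simp add: cfourier_translate)

subsection \<open>Test functions\<close>

lemma deriv_eq_0_outside:
  fixes \<psi> :: "real \<Rightarrow> real"
  assumes "\<And>x. \<bar>x\<bar> > R \<Longrightarrow> \<psi> x = 0" and "\<bar>x\<bar> > R"
  shows "deriv \<psi> x = 0"
proof -
  have "open {x::real. \<bar>x\<bar> > R}" by (intro open_Collect_less continuous_intros)
  then have "eventually (\<lambda>y. \<psi> y = 0) (nhds x)"
    using assms unfolding eventually_nhds by blast
  then show ?thesis using deriv_cong_ev[of \<psi> "\<lambda>_. 0" x x] by simp
qed

lemma test_function_deriv:
  assumes "test_function \<psi>" shows "test_function (deriv \<psi>)"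
proof -
  from assms obtain R where R: "\<And>x. \<bar>x\<bar> > R \<Longrightarrow> \<psi> x = 0" by (auto simp: test_function_def)
  have "deriv \<psi> x = 0" if "\<bar>x\<bar> > R" for x
    using deriv_eq_0_outside[of R \<psi> x] R that by blast
  moreover have "((deriv ^^ n) (deriv \<psi>)) differentiable (at x)" for n x
  proof -
    have "((deriv ^^ Suc n) \<psi>) differentiable (at x)"
      using assms unfolding test_function_def by blast
    then show ?thesis by (simp add: funpow_swap1)
  qed
  ultimately show ?thesis unfolding test_function_def by blast
qed

lemma test_function_has_derivative:
  assumes "test_function \<psi>" shows "(\<psi> has_real_derivative deriv \<psi> x) (at x)"
proof -
  have "((deriv ^^ 0) \<psi>) differentiable (at x)" using assms unfolding test_function_def by blast
  then show ?thesis by (simp add: DERIV_deriv_iff_real_differentiable)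
qed

lemma test_function_continuous:
  assumes "test_function \<psi>" shows "continuous_on A \<psi>"
  by (intro continuous_at_imp_continuous_on ballI DERIV_isCont[OF test_function_has_derivative[OF assms]])

lemma test_function_measurable [measurable_dest]:
  "test_function \<psi> \<Longrightarrow> \<psi> \<in> borel_measurable borel"
  by (intro borel_measurable_continuous_onI test_function_continuous)

lemma test_function_support:
  assumes "test_function \<psi>"
  obtains R where "R > 0" "\<And>x. \<bar>x\<bar> \<ge> R \<Longrightarrow> \<psi> x = 0"
proof -
  from assms obtain R where R: "\<And>x. \<bar>x\<bar> > R \<Longrightarrow> \<psi> x = 0" by (auto simp: test_function_def)
  show ?thesis by (rule that[of "max 0 R + 1"]) (use R in auto)
qed

lemma test_function_bounded:
  assumes "test_function \<psi>"
  obtains B where "\<And>x. \<bar>\<psi> x\<bar> \<le> B" "B \<ge> 0"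
proof -
  obtain R where R: "R > 0" "\<And>x. \<bar>x\<bar> \<ge> R \<Longrightarrow> \<psi> x = 0" by (rule test_function_support[OF assms]) blast
  have "compact (\<psi> ` {-R..R})"
    by (intro compact_continuous_image test_function_continuous assms compact_Icc)
  then obtain B where B: "\<And>x. x \<in> {-R..R} \<Longrightarrow> norm (\<psi> x) \<le> B"
    using compact_imp_bounded[of "\<psi> ` {-R..R}"] unfolding bounded_iff by blast
  show ?thesis
  proof (rule that)
    show "\<bar>\<psi> x\<bar> \<le> max B 0" for x
    proof (cases "x \<in> {-R..R}")
      case True
      then show ?thesis using B[OF True] by simp
    next
      case False
      then show ?thesis using R(2)[of x] by auto
    qed
  qed simp
qed

lemma test_function_integrable:
  assumes "test_function \<psi>" shows "integrable lborel \<psi>"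
proof -
  obtain R where R: "R > 0" "\<And>x. \<bar>x\<bar> \<ge> R \<Longrightarrow> \<psi> x = 0" by (rule test_function_support[OF assms]) blast
  have "set_integrable lborel {-R..R} \<psi>"
    by (intro borel_integrable_atLeastAtMost' test_function_continuous assms)
  moreover have "(\<lambda>x. indicator {-R..R} x *\<^sub>R \<psi> x) = \<psi>"
  proof
    fix x
    show "indicator {-R..R} x *\<^sub>R \<psi> x = \<psi> x"
      by (cases "x \<in> {-R..R}") (use R(2)[of x] in auto)
  qed
  ultimately show ?thesis unfolding set_integrable_def by simp
qed

text \<open>Integration by parts; the boundary terms vanish because the interval contains the
  support.\<close>

lemma fourier_deriv:
  assumes "test_function \<psi>"
  shows "fourier (deriv \<psi>) \<xi> = \<i> * \<xi> * fourier \<psi> \<xi>"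
proof -
  obtain R where R: "R > 0" "\<And>x. \<bar>x\<bar> \<ge> R \<Longrightarrow> \<psi> x = 0" by (rule test_function_support[OF assms]) blast
  have d0: "deriv \<psi> x = 0" if "\<bar>x\<bar> > R" for x
    by (rule deriv_eq_0_outside[of R]) (use R that in auto)
  define F where "F x = exp (- (\<i> * \<xi>) * of_real x) * complex_of_real (\<psi> x)" for x
  define G where "G x = cis (- (\<xi> * x)) * complex_of_real (deriv \<psi> x) - \<i> * \<xi> * (cis (- (\<xi> * x)) * complex_of_real (\<psi> x))" for x
  have "(G has_integral (F R - F (-R))) {-R..R}"
  proof (rule fundamental_theorem_of_calculus)
    fix x
    have "((\<lambda>x. exp (- (\<i> * \<xi>) * of_real x)) has_vector_derivative (- (\<i> * \<xi>) * exp (- (\<i> * \<xi>) * of_real x))) (at x within {-R..R})"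
      by (rule has_vector_derivative_real_field) (auto intro!: derivative_eq_intros)
    moreover have "((\<lambda>x. complex_of_real (\<psi> x)) has_vector_derivative complex_of_real (deriv \<psi> x)) (at x within {-R..R})"
      by (intro has_vector_derivative_of_real has_vector_derivative_at_within)
         (use test_function_has_derivative[OF assms] in \<open>simp add: has_real_derivative_iff_has_vector_derivative\<close>)
    ultimately show "(F has_vector_derivative G x) (at x within {-R..R})"
      unfolding F_def G_def
      by (auto dest: has_vector_derivative_mult simp: cis_conv_exp algebra_simps)
  qed (use R in simp)
  then have "(G has_integral 0) {-R..R}" using R by (simp add: F_def)
  moreover have "set_integrable lborel {-R..R} G"
    unfolding G_def by (intro borel_integrable_atLeastAtMost' continuous_intros
       test_function_continuous test_function_deriv assms)
  ultimately have "(LINT x:{-R..R}|lborel. G x) = 0"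
    by (metis set_borel_integral_eq_integral(2) integral_unique)
  moreover have "(\<lambda>x. indicator {-R..R} x *\<^sub>R G x) = G"
  proof
    fix x
    show "indicator {-R..R} x *\<^sub>R G x = G x"
    proof (cases "x \<in> {-R..R}")
      case False
      then have "\<bar>x\<bar> > R" by auto
      then show ?thesis using R(2)[of x] d0[of x] by (simp add: G_def)
    qed simp
  qed
  ultimately have "integral\<^sup>L lborel G = 0" unfolding set_lebesgue_integral_def by simp
  moreover have "integral\<^sup>L lborel G = fourier (deriv \<psi>) \<xi> - \<i> * \<xi> * fourier \<psi> \<xi>"
    unfolding G_def fourier_def integral_mult_right_zero[symmetric]
    by (intro Bochner_Integration.integral_diff integrable_mult_right integrable_cis_mult)
       (auto intro!: test_function_integrable test_function_deriv assms)
  ultimately show ?thesis by simp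
qed

text \<open>Fourth-order decay beats a quadratically growing factor and leaves an integrable one.
  The constant combines the bounds for the derivatives of order 0 and 4 with
  \<open>(1 + \<xi>\<^sup>2)\<^sup>2 \<le> 2 * (1 + \<xi> ^ 4)\<close>.\<close>

lemma fourier_test_function_decay:
  assumes "test_function \<psi>"
  obtains C where "C \<ge> 0" "\<And>\<xi>. norm (fourier \<psi> \<xi>) \<le> C / (1 + \<xi>\<^sup>2)\<^sup>2"
proof -
  have t: "test_function ((deriv ^^ n) \<psi>)" for n
    by (induction n) (auto intro: assms test_function_deriv)
  have f: "fourier ((deriv ^^ n) \<psi>) \<xi> = (\<i> * \<xi>) ^ n * fourier \<psi> \<xi>" for n \<xi>
    by (induction n) (auto simp: fourier_deriv t)
  define C where "C n = (LINT x|lborel. norm (complex_of_real ((deriv ^^ n) \<psi> x)))" for n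
  have C: "norm (fourier ((deriv ^^ n) \<psi>) \<xi>) \<le> C n" for n \<xi>
    unfolding C_def fourier_eq_cfourier
    by (intro norm_cfourier_le) (auto intro: test_function_integrable t)
  show ?thesis
  proof (rule that)
    have C0: "C n \<ge> 0" for n unfolding C_def by (rule Bochner_Integration.integral_nonneg) simp
    then show "2 * (C 0 + C 4) \<ge> 0" by simp
    fix \<xi> :: real
    have "norm (fourier \<psi> \<xi>) * (1 + \<xi> ^ 4) \<le> C 0 + C 4"
      using C[of 0 \<xi>] C[of 4 \<xi>] unfolding f by (simp add: norm_mult norm_power algebra_simps)
    moreover have "(1 + \<xi>\<^sup>2)\<^sup>2 \<le> 2 * (1 + \<xi> ^ 4)"
    proof -
      have "2 * (1 + \<xi> ^ 4) - (1 + \<xi>\<^sup>2)\<^sup>2 = (1 - \<xi>\<^sup>2)\<^sup>2" by algebra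
      then show ?thesis using zero_le_power2[of "1 - \<xi>\<^sup>2"] by linarith
    qed
    then have "norm (fourier \<psi> \<xi>) * (1 + \<xi>\<^sup>2)\<^sup>2 \<le> norm (fourier \<psi> \<xi>) * (2 * (1 + \<xi> ^ 4))"
      by (intro mult_left_mono) auto
    then have "norm (fourier \<psi> \<xi>) * (1 + \<xi>\<^sup>2)\<^sup>2 \<le> 2 * (norm (fourier \<psi> \<xi>) * (1 + \<xi> ^ 4))"
      by (simp only: mult.left_commute)
    ultimately have "norm (fourier \<psi> \<xi>) * (1 + \<xi>\<^sup>2)\<^sup>2 \<le> 2 * (C 0 + C 4)"
      by (meson mult_le_cancel_left_pos order_trans zero_less_numeral)
    moreover have "(1 + \<xi>\<^sup>2)\<^sup>2 > 0"
      by (intro zero_less_power add_pos_nonneg) auto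
    ultimately show "norm (fourier \<psi> \<xi>) \<le> 2 * (C 0 + C 4) / (1 + \<xi>\<^sup>2)\<^sup>2"
      by (simp add: pos_le_divide_eq)
  qed
qed

lemma integrable_inverse_1_plus_square': "integrable lborel (\<lambda>x::real. 1 / (1 + x\<^sup>2))"
  using integrable_inverse_1_plus_square by (simp add: set_integrable_def einterval_def inverse_eq_divide)

text \<open>Half of the decay cancels the growth of \<open>v\<close>; the other half is integrable.
  This is what allows the transform of the initial datum to be paired with test functions.\<close>

lemma integrable_mult_fourier_test_function:
  assumes \<psi>: "test_function \<psi>" and [measurable]: "v \<in> borel_measurable borel"
    and v: "\<And>\<xi>. norm (v \<xi>) \<le> D * (1 + \<xi>\<^sup>2)"
  shows "integrable lborel (\<lambda>\<xi>. v \<xi> * fourier \<psi> \<xi>)"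
proof -
  obtain C where C: "C \<ge> 0" "\<And>\<xi>. norm (fourier \<psi> \<xi>) \<le> C / (1 + \<xi>\<^sup>2)\<^sup>2"
    by (rule fourier_test_function_decay[OF \<psi>]) blast
  have [measurable]: "fourier \<psi> \<in> borel_measurable borel"
    unfolding fourier_eq_cfourier
    by (intro borel_measurable_continuous_onI continuous_cfourier) (auto intro: test_function_integrable \<psi>)
  have D: "D \<ge> 0" using order_trans[OF norm_ge_zero v[of 0]] by simp
  show ?thesis
  proof (rule Bochner_Integration.integrable_bound)
    show "integrable lborel (\<lambda>x::real. D * C * (1 / (1 + x\<^sup>2)))"
      by (intro integrable_mult_right integrable_inverse_1_plus_square')
    show "AE x in lborel. norm (v x * fourier \<psi> x) \<le> norm (D * C * (1 / (1 + x\<^sup>2)))"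
    proof (rule AE_I2)
      fix x :: real
      have p: "1 + x\<^sup>2 > 0" by (simp add: add_pos_nonneg)
      have "norm (v x * fourier \<psi> x) \<le> (D * (1 + x\<^sup>2)) * (C / (1 + x\<^sup>2)\<^sup>2)"
        unfolding norm_mult using C D p by (intro mult_mono v) auto
      also have "\<dots> = D * C * (1 / (1 + x\<^sup>2))" using p by (simp add: power2_eq_square)
      finally show "norm (v x * fourier \<psi> x) \<le> norm (D * C * (1 / (1 + x\<^sup>2)))"
        by (metis abs_ge_self order_trans real_norm_def)
    qed
  qed simp
qed

lemma integrable_fourier_test_function:
  assumes "test_function \<psi>" shows "integrable lborel (fourier \<psi>)"
  using integrable_mult_fourier_test_function[OF assms, of "\<lambda>_. 1" 1] by simp

text \<open>Pointwise inversion gives a limit of truncated integrals; since the transform is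
  integrable, that limit is a Lebesgue integral.\<close>

lemma test_function_inversion:
  assumes \<psi>: "test_function \<psi>"
  shows "(LINT \<eta>|lborel. cis (\<eta> * x) * fourier \<psi> \<eta>) = 2 * pi * \<psi> x"
proof -
  obtain B where B: "\<And>x. \<bar>deriv \<psi> x\<bar> \<le> B" "B \<ge> 0"
    by (rule test_function_bounded[OF test_function_deriv[OF \<psi>]]) blast
  have a1: "((\<lambda>R. LINT \<eta>:{-R..R}|lborel. cis (\<eta> * x) * fourier \<psi> \<eta>) \<longlongrightarrow> 2 * pi * complex_of_real (\<psi> x)) at_top"
    unfolding fourier_eq_cfourier
  proof (rule Fourier_inversion_at[where d = 1 and B = B])
    fix y
    have "norm (\<psi> y - \<psi> x) \<le> B * norm (y - x)"
      by (rule field_differentiable_bound[of UNIV])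
         (use B test_function_has_derivative[OF \<psi>] in \<open>auto intro: has_field_derivative_at_within\<close>)
    then show "norm (complex_of_real (\<psi> y) - complex_of_real (\<psi> x)) \<le> B * \<bar>y - x\<bar>"
      by (simp flip: of_real_diff)
  qed (use test_function_integrable[OF \<psi>] in auto)
  have a2: "((\<lambda>R. LINT \<eta>:{-R..R}|lborel. cis (\<eta> * x) * fourier \<psi> \<eta>) \<longlongrightarrow> (LINT \<eta>|lborel. cis (\<eta> * x) * fourier \<psi> \<eta>)) at_top"
    by (intro tendsto_set_integral_symmetric integrable_cis_mult integrable_fourier_test_function \<psi>) simp
  show ?thesis
    using tendsto_unique[OF trivial_limit_at_top_linorder a2 a1] by simp
qed

text \<open>Dilations shrink the support and translations multiply the transform by characters. Both
  serve to show that a function whose pairings with all transforms of test functions vanish is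
  itself 0.\<close>

lemma test_function_affine:
  assumes \<psi>: "test_function \<psi>" and a: "a \<noteq> 0"
  shows "test_function (\<lambda>x. \<psi> (a * x + b))"
proof -
  have t: "((deriv ^^ n) \<psi>) differentiable (at x)" for n x
    using \<psi> by (auto simp: test_function_def)
  have dd: "((\<lambda>x. c * (deriv ^^ n) \<psi> (a * x + b)) has_real_derivative c * a * (deriv ^^ Suc n) \<psi> (a * x + b)) (at x)" for n x c
  proof -
    have d: "((deriv ^^ n) \<psi> has_real_derivative (deriv ^^ Suc n) \<psi> (a * x + b)) (at (a * x + b))"
      using t[of n "a * x + b"] by (simp add: DERIV_deriv_iff_real_differentiable)
    have lin: "((\<lambda>x. a * x + b) has_real_derivative a) (at x)"
      by (auto intro!: derivative_eq_intros)
    from DERIV_chain2[where g = "\<lambda>x. a * x + b" and x = x and Db = a and s = UNIV, OF d lin]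
    have "((\<lambda>x. (deriv ^^ n) \<psi> (a * x + b)) has_real_derivative (deriv ^^ Suc n) \<psi> (a * x + b) * a) (at x)"
      by simp
    from DERIV_cmult[OF this, of c] show ?thesis by (simp add: mult_ac)
  qed
  have eq: "(deriv ^^ n) (\<lambda>x. \<psi> (a * x + b)) = (\<lambda>x. a ^ n * (deriv ^^ n) \<psi> (a * x + b))" for n
  proof (induction n)
    case (Suc n)
    then have "(deriv ^^ Suc n) (\<lambda>x. \<psi> (a * x + b)) = deriv (\<lambda>x. a ^ n * (deriv ^^ n) \<psi> (a * x + b))"
      by simp
    also have "\<dots> = (\<lambda>x. a ^ Suc n * (deriv ^^ Suc n) \<psi> (a * x + b))"
    proof
      fix x
      show "deriv (\<lambda>x. a ^ n * (deriv ^^ n) \<psi> (a * x + b)) x = a ^ Suc n * (deriv ^^ Suc n) \<psi> (a * x + b)"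
        using DERIV_imp_deriv[OF dd[of "a ^ n" n x]] by (simp add: mult_ac)
    qed
    finally show ?case .
  qed simp
  obtain R where R: "R > 0" "\<And>x. \<bar>x\<bar> \<ge> R \<Longrightarrow> \<psi> x = 0" by (rule test_function_support[OF \<psi>]) blast
  have "\<psi> (a * x + b) = 0" if x: "\<bar>x\<bar> > (R + \<bar>b\<bar>) / \<bar>a\<bar>" for x
  proof -
    have "R + \<bar>b\<bar> < \<bar>a * x\<bar>" using x a by (simp add: abs_mult field_simps)
    then show ?thesis by (intro R) linarith
  qed
  moreover have "((deriv ^^ n) (\<lambda>x. \<psi> (a * x + b))) differentiable (at x)" for n x
    unfolding eq using dd[of "a ^ n" n x] by (auto simp: real_differentiable_def)
  ultimately show ?thesis
    unfolding test_function_def by blast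
qed

section \<open>Smooth bump functions\<close>

text \<open>\<open>q = 1\<close>, \<open>k = 0\<close> is the classical bump. The polynomial and the
  pole order are parameters because they are all that differentiation changes, so smoothness becomes
  one induction.\<close>

definition bump_family :: "real poly \<Rightarrow> nat \<Rightarrow> real \<Rightarrow> real" where
  "bump_family q k x =
     (if \<bar>x\<bar> < 1 then poly q x * inverse (1 - x\<^sup>2) ^ k * exp (- inverse (1 - x\<^sup>2)) else 0)"

text \<open>Inside the interval this is the product rule over the common denominator
  \<open>(1 - x\<^sup>2) ^ (k + 2)\<close>, where \<open>[:1, 0, -1:]\<close> is
  \<open>1 - x\<^sup>2\<close>. At the endpoints the exponential beats every pole, so the function
  vanishes to second order and its derivative is 0.\<close>

lemma bump_family_has_derivative:
  "(bump_family q k has_real_derivative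
      bump_family (pderiv q * [:1, 0, -1:]\<^sup>2 + smult (2 * real k) ([:0, 1:] * q * [:1, 0, -1:]) - [:0, 2:] * q) (k + 2) x) (at x)"
  (is "(_ has_real_derivative bump_family ?q' _ x) _")
proof -
  consider "\<bar>x\<bar> < 1" | "\<bar>x\<bar> > 1" | "\<bar>x\<bar> = 1" by linarith
  then show ?thesis
  proof cases
    case 1
    define i where "i = inverse (1 - x\<^sup>2)"
    have "x\<^sup>2 < 1" using 1 by (simp add: abs_square_less_1)
    then have v: "1 - x\<^sup>2 \<noteq> 0" "i * (1 - x\<^sup>2) = 1" by (auto simp: i_def)
    have di: "((\<lambda>x. inverse (1 - x\<^sup>2)) has_real_derivative 2 * x * i\<^sup>2) (at x)"
      using v by (auto intro!: derivative_eq_intros simp: i_def power2_eq_square)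
    \<comment> \<open>For \<open>k = 0\<close> the truncated exponent \<open>k - 1\<close> is
      harmless because the factor \<open>real k\<close> is 0.\<close>
    have ki: "real k * i ^ (k - 1) * i\<^sup>2 = real k * i ^ (k + 1)"
      by (cases k) (auto simp: power2_eq_square)
    have "((\<lambda>x. poly q x * inverse (1 - x\<^sup>2) ^ k * exp (- inverse (1 - x\<^sup>2))) has_real_derivative
       (poly (pderiv q) x * i ^ k + (real k * i ^ (k - 1) * i\<^sup>2) * 2 * x * poly q x - poly q x * i ^ k * 2 * x * i\<^sup>2) * exp (- i)) (at x)"
      by (rule derivative_eq_intros di poly_DERIV refl)+ (simp add: i_def[symmetric] algebra_simps)
    also have "(poly (pderiv q) x * i ^ k + (real k * i ^ (k - 1) * i\<^sup>2) * 2 * x * poly q x - poly q x * i ^ k * 2 * x * i\<^sup>2) * exp (- i)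
       = poly ?q' x * i ^ (k + 2) * exp (- i)"
    proof -
      define w where "w = 1 - x\<^sup>2"
      have iw: "i * w = 1" using v(2) by (simp add: w_def)
      have e: "i ^ (k + 2) * w\<^sup>2 = i ^ k * (i * w)\<^sup>2" "i ^ (k + 2) * w = i ^ (k + 1) * (i * w)"
        by (simp_all add: power_add power_mult_distrib power2_eq_square mult_ac)
      have *: "i ^ k = i ^ (k + 2) * w\<^sup>2" "i ^ (k + 1) = i ^ (k + 2) * w" "i ^ k * i\<^sup>2 = i ^ (k + 2)"
        unfolding e iw by (simp_all only: power_one mult_1_right power_add)
      have gen: "P * a + K * b * 2 * x * r - r * 2 * x * c = P * (C * w\<^sup>2) + K * (C * w) * 2 * x * r - r * 2 * x * C"
        if "a = C * w\<^sup>2" "b = C * w" "c = C" for a b c C P K r :: real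
        using that by simp
      have "poly (pderiv q) x * i ^ k + (real k * i ^ (k + 1)) * 2 * x * poly q x - poly q x * i ^ k * 2 * x * i\<^sup>2
          = poly (pderiv q) x * i ^ k + (real k * i ^ (k + 1)) * 2 * x * poly q x - poly q x * 2 * x * (i ^ k * i\<^sup>2)"
        by (simp only: mult_ac)
      also have "\<dots> = poly (pderiv q) x * (i ^ (k + 2) * w\<^sup>2) + (real k * (i ^ (k + 2) * w)) * 2 * x * poly q x - poly q x * 2 * x * i ^ (k + 2)"
        by (rule gen[OF *])
      also have "\<dots> = (poly (pderiv q) x * w\<^sup>2 + 2 * real k * (x * poly q x * w) - 2 * x * poly q x) * i ^ (k + 2)"
        by (simp only: algebra_simps)
      also have "(poly (pderiv q) x * w\<^sup>2 + 2 * real k * (x * poly q x * w) - 2 * x * poly q x) = poly ?q' x"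
        by (simp add: w_def power2_eq_square algebra_simps)
      finally show ?thesis unfolding ki by (rule arg_cong[where f = "\<lambda>z. z * exp (- i)"])
    qed
    also have "\<dots> = bump_family ?q' (k + 2) x"
      using 1 by (simp add: bump_family_def i_def)
    finally show ?thesis
    proof (rule has_field_derivative_transform_within_open[where S = "{-1<..<1}"])
      show "poly q y * inverse (1 - y\<^sup>2) ^ k * exp (- inverse (1 - y\<^sup>2)) = bump_family q k y" if "y \<in> {-1<..<1}" for y
        using that by (auto simp: bump_family_def)
    qed (use 1 in auto)
  next
    case 2
    have "((\<lambda>x. 0) has_real_derivative bump_family ?q' (k + 2) x) (at x)"
      using 2 by (simp add: bump_family_def)
    then show ?thesis
    proof (rule has_field_derivative_transform_within_open[where S = "{x. \<bar>x\<bar> > 1}"])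
      show "open {x::real. \<bar>x\<bar> > 1}" by (intro open_Collect_less continuous_intros)
    qed (use 2 in \<open>auto simp: bump_family_def\<close>)
  next
    case 3
    obtain C where C: "\<And>y. y \<in> {-1..1} \<Longrightarrow> \<bar>poly q y\<bar> \<le> C"
    proof -
      have "compact (poly q ` {-1..1})" by (intro compact_continuous_image continuous_intros compact_Icc)
      then obtain B where "\<forall>z\<in>poly q ` {-1..1}. norm z \<le> B"
        using compact_imp_bounded[of "poly q ` {-1..1}"] unfolding bounded_iff by blast
      then show ?thesis by (intro that[of B]) auto
    qed
    have "\<bar>poly q 0\<bar> \<le> C" by (rule C) simp
    then have C0: "C \<ge> 0" by linarith
    \<comment> \<open>The series of \<open>exp (inverse v)\<close> dominates its term of order
      \<open>k + 2\<close>, whence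
      \<open>inverse v ^ k * exp (- inverse v) \<le> N * v\<^sup>2\<close>; the two powers of
      \<open>v\<close> left over force the derivative to be 0.\<close>
    define N :: real where "N = fact (k + 2)"
    have N: "N > 0" by (simp add: N_def del: fact_Suc)
    have bnd: "\<bar>bump_family q k y\<bar> \<le> 4 * C * N * (\<bar>y - x\<bar> * \<bar>y - x\<bar>)" for y
    proof (cases "\<bar>y\<bar> < 1")
      case True
      define v where "v = 1 - y\<^sup>2"
      have "y\<^sup>2 < 1" using True by (simp add: abs_square_less_1)
      then have v: "v > 0" by (simp add: v_def)
      have "inverse v ^ (k + 2) / N \<le> exp (inverse v)"
      proof -
        have "(\<Sum>n\<in>{k + 2}. inverse v ^ n /\<^sub>R fact n) \<le> (\<Sum>n. inverse v ^ n /\<^sub>R fact n)"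
          using v by (intro sum_le_suminf sums_summable[OF exp_converges]) auto
        then show ?thesis using exp_converges[of "inverse v"] by (simp add: sums_iff divide_inverse mult.commute N_def del: fact_Suc power_Suc)
      qed
      then have "inverse v ^ (k + 2) \<le> exp (inverse v) * N"
        using N by (subst (asm) pos_divide_le_eq) auto
      then have ineq: "inverse v ^ (k + 2) * (v\<^sup>2 * exp (- inverse v)) \<le> exp (inverse v) * N * (v\<^sup>2 * exp (- inverse v))"
        by (rule mult_right_mono) simp
      have e1: "inverse v ^ (k + 2) * (v\<^sup>2 * exp (- inverse v)) = inverse v ^ k * exp (- inverse v) * (inverse v * v)\<^sup>2"
        by (simp only: power_add power_mult_distrib mult_ac)
      have e2: "exp (inverse v) * N * (v\<^sup>2 * exp (- inverse v)) = N * v\<^sup>2 * (exp (inverse v) * exp (- inverse v))"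
        by (simp only: mult_ac)
      have "inverse v * v = 1" using v by simp
      then have "inverse v ^ k * exp (- inverse v) \<le> N * v\<^sup>2"
        using ineq unfolding e1 e2 exp_minus_inverse by simp
      \<comment> \<open>\<open>v\<close> is \<open>(1 - y) * (1 + y)\<close>, and the factor that
        does not vanish at \<open>x\<close> is at most 2.\<close>
      moreover have "v \<le> 2 * \<bar>y - x\<bar>"
      proof -
        have "v \<le> 2 * (1 - y)" "v \<le> 2 * (1 + y)"
          using zero_le_power2[of "1 - y"] zero_le_power2[of "1 + y"]
          by (simp_all add: v_def power2_eq_square algebra_simps)
        moreover have "x = 1 \<or> x = -1" using 3 by linarith
        ultimately show ?thesis using True by (elim disjE) (simp_all add: abs_if)
      qed
      then have "v\<^sup>2 \<le> (2 * \<bar>y - x\<bar>)\<^sup>2" using v by (intro power_mono) auto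
      then have "N * v\<^sup>2 \<le> N * (2 * \<bar>y - x\<bar>)\<^sup>2" using N by (intro mult_left_mono) auto
      ultimately have ub: "inverse v ^ k * exp (- inverse v) \<le> N * (2 * \<bar>y - x\<bar>)\<^sup>2" by linarith
      have "\<bar>poly q y\<bar> * (inverse v ^ k * exp (- inverse v)) \<le> C * (N * (2 * \<bar>y - x\<bar>)\<^sup>2)"
      proof (rule mult_mono)
        show "\<bar>poly q y\<bar> \<le> C" using True by (intro C) auto
      qed (use C0 v ub in \<open>auto simp del: power_Suc\<close>)
      moreover have "C * (N * (2 * \<bar>y - x\<bar>)\<^sup>2) = 4 * C * N * (\<bar>y - x\<bar> * \<bar>y - x\<bar>)"
        by (simp add: power2_eq_square)
      moreover have "\<bar>bump_family q k y\<bar> = \<bar>poly q y\<bar> * (inverse v ^ k * exp (- inverse v))"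
        using True v by (simp add: bump_family_def v_def[symmetric] abs_mult)
      ultimately show ?thesis by linarith
    next
      case False
      then show ?thesis using C0 N by (simp add: bump_family_def)
    qed
    have fx: "bump_family q k x = 0" using 3 by (simp add: bump_family_def)
    have "((\<lambda>y. (bump_family q k y - bump_family q k x) / (y - x)) \<longlongrightarrow> 0) (at x)"
    proof (rule Lim_null_comparison)
      show "eventually (\<lambda>y. norm ((bump_family q k y - bump_family q k x) / (y - x)) \<le> 4 * C * N * \<bar>y - x\<bar>) (at x)"
        unfolding eventually_at_filter
      proof (intro always_eventually allI impI)
        fix y assume "y \<noteq> x"
        then show "norm ((bump_family q k y - bump_family q k x) / (y - x)) \<le> 4 * C * N * \<bar>y - x\<bar>"
          using bnd[of y] unfolding fx real_norm_def abs_divide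
          by (subst pos_divide_le_eq) (simp_all add: mult.assoc del: abs_mult_self_eq)
      qed
      have "((\<lambda>y. 4 * C * N * \<bar>y - x\<bar>) \<longlongrightarrow> 4 * C * N * \<bar>x - x\<bar>) (at x)"
        by (intro tendsto_intros)
      then show "((\<lambda>y. 4 * C * N * \<bar>y - x\<bar>) \<longlongrightarrow> 0) (at x)" by simp
    qed
    then show ?thesis using 3 by (simp add: has_field_derivative_iff bump_family_def)
  qed
qed

lemma test_function_bump: "test_function (bump_family q k)"
proof -
  have "\<exists>q' k'. (deriv ^^ n) (bump_family q k) = bump_family q' k'" for n
  proof (induction n)
    case (Suc n)
    then obtain q' k' where "(deriv ^^ n) (bump_family q k) = bump_family q' k'" by blast
    then have "(deriv ^^ Suc n) (bump_family q k) = deriv (bump_family q' k')" by simp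
    moreover have "deriv (bump_family q' k') = bump_family
       (pderiv q' * [:1, 0, -1:]\<^sup>2 + smult (2 * real k') ([:0, 1:] * q' * [:1, 0, -1:]) - [:0, 2:] * q') (k' + 2)"
      by (rule ext, rule DERIV_imp_deriv, rule bump_family_has_derivative)
    ultimately show ?case by metis
  qed auto
  then have "((deriv ^^ n) (bump_family q k)) differentiable (at x)" for n x
    using bump_family_has_derivative real_differentiable_def by metis
  moreover have "bump_family q k x = 0" if "\<bar>x\<bar> > 1" for x
    using that by (simp add: bump_family_def)
  ultimately show ?thesis unfolding test_function_def by blast
qed

text \<open>A bump that is positive only for |x| < 1 / (|\<eta>| + 1) sees the cosine only at
  arguments of modulus below 1 < pi / 2, so the real part of its transform is positive.\<close>

lemma exists_test_function_fourier_nonzero: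
  "\<exists>\<psi>. test_function \<psi> \<and> fourier \<psi> \<eta> \<noteq> 0"
proof -
  define a where "a = \<bar>\<eta>\<bar> + 1"
  have a: "a > 0" by (simp add: a_def)
  define \<phi> where "\<phi> = bump_family 1 0"
  define \<psi> where "\<psi> x = \<phi> (a * x + 0)" for x
  have \<psi>: "test_function \<psi>" unfolding \<psi>_def \<phi>_def
    using a by (intro test_function_affine test_function_bump) auto
  have \<psi>0: "\<psi> x = 0" if "\<bar>x\<bar> \<ge> 1 / a" for x
    using that a by (auto simp: \<psi>_def \<phi>_def bump_family_def field_simps abs_mult)
  have \<psi>pos: "\<psi> x > 0" if "\<bar>x\<bar> < 1 / a" for x
    using that a by (auto simp: \<psi>_def \<phi>_def bump_family_def field_simps abs_mult)
  have cos: "cos (\<eta> * x) > 0" if "\<bar>x\<bar> < 1 / a" for x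
  proof -
    have "\<bar>\<eta> * x\<bar> \<le> a * \<bar>x\<bar>" by (simp add: abs_mult a_def algebra_simps)
    also have "\<dots> < 1" using that a by (simp add: field_simps)
    finally have "\<bar>\<eta> * x\<bar> < pi / 2" using pi_gt3 by linarith
    then show ?thesis by (intro cos_gt_zero_pi) auto
  qed
  have i: "integrable lborel (\<lambda>x. cos (\<eta> * x) * \<psi> x)"
    by (rule Bochner_Integration.integrable_bound[OF test_function_integrable[OF \<psi>]])
       (use test_function_measurable[OF \<psi>] in \<open>auto simp: abs_mult intro!: mult_left_le_one_le\<close>)
  have "Re (fourier \<psi> \<eta>) = (LINT x|lborel. cos (\<eta> * x) * \<psi> x)"
    unfolding fourier_def
    by (subst integral_Re[symmetric]) (auto intro!: integrable_cis_mult test_function_integrable \<psi>)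
  also have "\<dots> > 0"
  proof -
    have nn: "cos (\<eta> * x) * \<psi> x \<ge> 0" for x
      using \<psi>0[of x] \<psi>pos[of x] cos[of x] by (cases "\<bar>x\<bar> < 1 / a") auto
    have "(LINT x|lborel. cos (\<eta> * x) * \<psi> x) \<noteq> 0"
    proof
      assume "(LINT x|lborel. cos (\<eta> * x) * \<psi> x) = 0"
      then have "AE x in lborel. cos (\<eta> * x) * \<psi> x = 0"
        using integral_nonneg_eq_0_iff_AE[OF i] nn by auto
      then have "AE x in lborel. \<not> \<bar>x\<bar> < 1 / a"
      proof eventually_elim
        case (elim x)
        then show ?case using \<psi>pos[of x] cos[of x] by auto
      qed
      then have "emeasure lborel {x \<in> space lborel. \<bar>x\<bar> < 1 / a} = 0"
        by (rule emeasure_eq_0_AE)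
      also have "{x \<in> space lborel. \<bar>x\<bar> < 1 / a} = {-(1/a)<..<1/a}" by auto
      finally show False using a by (simp add: emeasure_lborel_Ioo)
    qed
    moreover have "(LINT x|lborel. cos (\<eta> * x) * \<psi> x) \<ge> 0"
      by (intro Bochner_Integration.integral_nonneg nn)
    ultimately show ?thesis by linarith
  qed
  finally show ?thesis using \<psi> by force
qed

section \<open>Principal powers in the right half-plane\<close>

text \<open>A positive factor leaves the argument unchanged, so no branch correction appears. The
  scaling arguments for the stable law and for the symbol rest on this.\<close>

lemma powr_scale_of_real:
  fixes z :: complex
  assumes "r > 0"
  shows "(of_real r * z) powr (of_real a) = of_real (r powr a) * z powr (of_real a)"
proof (cases "z = 0")
  case False
  have "(of_real r * z) powr (of_real a) = exp (of_real a * (of_real (ln r) + Ln z))"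
    using assms False by (simp add: powr_def Ln_times_of_real Ln_of_real)
  also have "\<dots> = exp (of_real (a * ln r)) * exp (of_real a * Ln z)"
    by (simp add: distrib_left exp_add)
  also have "exp (complex_of_real (a * ln r)) = of_real (r powr a)"
    using assms unfolding exp_of_real by (simp add: powr_def)
  finally show ?thesis using False by (simp add: powr_def)
qed simp

text \<open>The argument of \<open>z\<close> is below pi / 2 in modulus, so that of the power is
  below \<open>a * pi / 2\<close>, where the cosine stays positive.\<close>

lemma Re_powr_ge:
  fixes z :: complex
  assumes "Re z > 0" "0 < a" "a < 1"
  shows "Re (z powr of_real a) \<ge> norm z powr a * cos (a * pi / 2)"
proof -
  have z: "z \<noteq> 0" using assms by auto
  have "\<bar>Im (Ln z)\<bar> < pi / 2" using Re_Ln_pos_lt[OF z] assms by simp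
  then have le: "\<bar>a * Im (Ln z)\<bar> \<le> a * pi / 2" using assms by (simp add: abs_mult)
  have "a * pi \<le> pi" using assms by (simp add: mult_le_cancel_right1)
  then have "cos (a * pi / 2) \<le> cos \<bar>a * Im (Ln z)\<bar>"
    using le assms by (intro cos_monotone_0_pi_le) auto
  then show ?thesis
    using z by (simp add: powr_def Re_exp powr_def[of "norm z"])
qed

lemma cos_half_pi_pos: "0 < a \<Longrightarrow> a < 1 \<Longrightarrow> cos (a * pi / 2) > (0::real)"
proof -
  assume a: "0 < a" "a < 1"
  then have "0 < a * pi" "a * pi < 1 * pi" by (auto intro: mult_strict_right_mono)
  then show ?thesis by (intro cos_gt_zero_pi) (use pi_gt_zero in linarith)+
qed

lemma Re_powr_pos:
  fixes z :: complex
  assumes "Re z > 0" "0 < a" "a < 1"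
  shows "Re (z powr of_real a) > 0"
proof -
  have "norm z powr a * cos (a * pi / 2) > 0"
    using assms cos_half_pi_pos[of a] by (intro mult_pos_pos) auto
  then show ?thesis using Re_powr_ge[OF assms] by linarith
qed

subsection \<open>One-sided stable laws\<close>

text \<open>Probabilities of the Sibuya distribution, i.e. the coefficients of \<open>1 - (1 - z)\<^sup>a\<close>. Sums of \<open>n\<close>
  independent copies, rescaled by \<open>n\<^bsup>-1/a\<^esup>\<close>, converge to the stable law.\<close>

definition sibuya :: "real \<Rightarrow> nat \<Rightarrow> real" where
  "sibuya a j = (if j = 0 then 0 else - pochhammer (- a) j / fact j)"

text \<open>In the product (-a)(1 - a)(2 - a)... only the first factor is negative, and the sign in
  the definition cancels it.\<close>

lemma sibuya_nonneg:
  assumes "0 < a" "a < 1" shows "sibuya a j \<ge> 0"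
proof (cases j)
  case (Suc n)
  have "pochhammer (1 - a) n > 0" using assms by (intro pochhammer_pos) auto
  then show ?thesis using assms Suc
    by (simp add: sibuya_def pochhammer_rec divide_nonneg_pos)
qed (simp add: sibuya_def)

lemma sibuya_generating_function:
  assumes "norm z < 1"
  shows "(\<lambda>j. complex_of_real (sibuya a j) * z ^ j) sums (1 - (1 - z) powr of_real a)"
proof -
  have "(\<lambda>n. (complex_of_real a gchoose n) * (-z) ^ n) sums (1 + (-z)) powr of_real a"
    using assms by (intro gen_binomial_complex) simp
  also have "(\<lambda>n. (complex_of_real a gchoose n) * (-z) ^ n) = (\<lambda>n. complex_of_real (pochhammer (- a) n / fact n) * z ^ n)"
  proof
    fix n
    have "(complex_of_real a gchoose n) = (-1) ^ n * complex_of_real (pochhammer (- a) n) / fact n"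
      by (simp add: gbinomial_pochhammer flip: pochhammer_of_real)
    then show "(complex_of_real a gchoose n) * (-z) ^ n = complex_of_real (pochhammer (- a) n / fact n) * z ^ n"
      by (simp add: power_minus[of z] mult_ac)
  qed
  finally have "(\<lambda>n. complex_of_real (pochhammer (- a) n / fact n) * z ^ n) sums ((1 - z) powr of_real a)"
    by simp
  \<comment> \<open>The constant terms cancel, in accordance with
    \<open>sibuya a 0 = 0\<close>.\<close>
  from sums_diff[OF sums_single[of 0 "\<lambda>_. 1"] this]
  have s: "(\<lambda>n. (if n = 0 then 1 else 0) - complex_of_real (pochhammer (- a) n / fact n) * z ^ n) sums (1 - (1 - z) powr of_real a)"
    by simp
  have eq: "(\<lambda>n. (if n = 0 then 1 else 0) - complex_of_real (pochhammer (- a) n / fact n) * z ^ n) = (\<lambda>j. complex_of_real (sibuya a j) * z ^ j)"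
    by (auto simp: sibuya_def fun_eq_iff)
  show ?thesis using s unfolding eq .
qed

lemma sibuya_generating_function_real:
  assumes "0 < x" "x < 1"
  shows "(\<lambda>j. sibuya a j * x ^ j) sums (1 - (1 - x) powr a)"
proof -
  have "(\<lambda>j. complex_of_real (sibuya a j) * of_real x ^ j) sums (1 - (1 - of_real x) powr of_real a)"
    using assms by (intro sibuya_generating_function) simp
  also have "1 - (1 - complex_of_real x) powr of_real a = of_real (1 - (1 - x) powr a)"
  proof -
    have "1 - complex_of_real x = of_real (1 - x)" by simp
    then show ?thesis using powr_of_real[of "1 - x" a] assms by simp
  qed
  finally show ?thesis
    by (simp only: sums_of_real_iff flip: of_real_power of_real_mult)
qed

text \<open>An Abel argument resting on nonnegativity: letting the argument tend to 1 bounds the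
  partial sums by 1, and conversely the generating function is bounded by the full sum.\<close>

lemma sibuya_sums_1:
  assumes a: "0 < a" "a < 1"
  shows "sibuya a sums 1"
proof -
  \<comment> \<open>\<open>n + 2\<close> rather than \<open>n + 1\<close> keeps \<open>x 0\<close>
    positive, as the real generating function requires.\<close>
  define x where "x n = 1 - 1 / real (n + 2)" for n
  have x: "0 < x n" "x n < 1" for n by (auto simp: x_def field_simps)
  have xl: "x \<longlonglongrightarrow> 1"
    unfolding x_def by real_asymp
  have gl: "(\<lambda>n. 1 - (1 - x n) powr a) \<longlonglongrightarrow> 1"
    unfolding x_def using a by real_asymp
  have part: "(\<Sum>j<m. sibuya a j) \<le> 1" for m
  proof (rule LIMSEQ_le_const2)
    show "(\<lambda>n. \<Sum>j<m. sibuya a j * x n ^ j) \<longlonglongrightarrow> (\<Sum>j<m. sibuya a j)"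
      using xl by (auto intro!: tendsto_eq_intros)
    have "(\<Sum>j<m. sibuya a j * x n ^ j) \<le> 1" for n
    proof -
      have "(\<Sum>j<m. sibuya a j * x n ^ j) \<le> (\<Sum>j. sibuya a j * x n ^ j)"
        using sibuya_generating_function_real[OF x, of a n] sibuya_nonneg[OF a] x
        by (intro sum_le_suminf) (auto simp: sums_iff less_imp_le)
      also have "\<dots> = 1 - (1 - x n) powr a"
        using sibuya_generating_function_real[OF x, of a n] by (simp add: sums_iff)
      finally show ?thesis by (smt (verit) powr_ge_zero)
    qed
    then show "\<exists>N. \<forall>n\<ge>N. (\<Sum>j<m. sibuya a j * x n ^ j) \<le> 1" by blast
  qed
  have sm: "summable (sibuya a)"
    using sibuya_nonneg[OF a] part by (intro bounded_imp_summable[where B = 1]) (auto simp: lessThan_Suc_atMost[symmetric] simp del: sum.lessThan_Suc)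
  have "suminf (sibuya a) \<le> 1" using sm part by (intro suminf_le_const) auto
  moreover have "1 \<le> suminf (sibuya a)"
  proof (rule LIMSEQ_le_const2[OF gl])
    have "1 - (1 - x n) powr a \<le> suminf (sibuya a)" for n
    proof -
      have "1 - (1 - x n) powr a = (\<Sum>j. sibuya a j * x n ^ j)"
        using sibuya_generating_function_real[OF x, of a n] by (simp add: sums_iff)
      also have "\<dots> \<le> suminf (sibuya a)"
        using sibuya_generating_function_real[OF x, of a n] sibuya_nonneg[OF a] x
        by (intro suminf_le sm) (auto simp: sums_iff less_imp_le power_le_one mult_left_le)
      finally show ?thesis .
    qed
    then show "\<exists>N. \<forall>n\<ge>N. 1 - (1 - x n) powr a \<le> suminf (sibuya a)" by blast
  qed
  ultimately show ?thesis using sm by (simp add: sums_iff)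
qed

section \<open>Laplace transforms of laws on the half-line\<close>

text \<open>The formula is demanded on the open half-plane, where the exponential is bounded by 1
  almost surely. Complex \<open>z\<close> is essential because the symbol takes powers of complex
  arguments.\<close>

definition laplace_law :: "real measure \<Rightarrow> (complex \<Rightarrow> complex) \<Rightarrow> bool" where
  "laplace_law M \<phi> \<longleftrightarrow> real_distribution M \<and> (AE x in M. 0 \<le> x) \<and>
     (\<forall>z. Re z > 0 \<longrightarrow> (LINT x|M. exp (- (z * complex_of_real x))) = \<phi> z)"

lemma laplace_law_integrable:
  assumes "laplace_law M \<phi>" "Re z > 0"
  shows "integrable M (\<lambda>x. exp (- (z * complex_of_real x)))"
proof -
  interpret real_distribution M using assms by (simp add: laplace_law_def)
  have "AE x in M. 0 \<le> x" using assms by (simp add: laplace_law_def)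
  then have "AE x in M. norm (exp (- (z * complex_of_real x))) \<le> 1"
    by eventually_elim (use assms(2) in \<open>auto simp: norm_exp_eq_Re\<close>)
  then show ?thesis by (intro integrable_const_bound[where B = 1]) auto
qed

text \<open>Supplies |1 - w n| \<le> 1 in \<open>sibuya_scaling_limit\<close>, where that number is
  the transform of a probability law.\<close>

lemma laplace_law_norm_le:
  assumes "laplace_law M \<phi>" "Re z > 0"
  shows "norm (\<phi> z) \<le> 1"
proof -
  interpret real_distribution M using assms by (simp add: laplace_law_def)
  have AE: "AE x in M. 0 \<le> x" using assms by (simp add: laplace_law_def)
  have "\<phi> z = (LINT x|M. exp (- (z * complex_of_real x)))"
    using assms by (simp add: laplace_law_def)
  also have "norm \<dots> \<le> (LINT x|M. norm (exp (- (z * complex_of_real x))))"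
    by (rule integral_norm_bound)
  also have "\<dots> \<le> (LINT x|M. 1)"
  proof (rule integral_mono_AE)
    show "AE x in M. norm (exp (- (z * complex_of_real x))) \<le> 1"
      using AE by eventually_elim (use assms(2) in \<open>auto simp: norm_exp_eq_Re\<close>)
    show "integrable M (\<lambda>x. norm (exp (- (z * complex_of_real x))))"
      by (intro integrable_norm laplace_law_integrable[OF assms])
  qed simp
  also have "\<dots> = 1" using prob_space by simp
  finally show ?thesis .
qed

text \<open>A law on the naturals has as Laplace transform its generating function at e^(-z), a
  point of the open unit disc.\<close>

lemma laplace_law_sibuya:
  assumes a: "0 < a" "a < 1"
  shows "\<exists>M. laplace_law M (\<lambda>z. 1 - (1 - exp (- z)) powr of_real a)"
proof -
  define X where "X = embed_pmf (sibuya a)"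
  have "(\<integral>\<^sup>+x. ennreal (sibuya a x) \<partial>count_space UNIV) = 1"
    using sibuya_sums_1[OF a] sibuya_nonneg[OF a]
    by (simp add: nn_integral_count_space_nat suminf_ennreal2 sums_iff)
  then have X: "pmf X = sibuya a"
    unfolding X_def using sibuya_nonneg[OF a] by (intro ext pmf_embed_pmf) auto
  define M where "M = distr (measure_pmf X) borel real"
  have "real_distribution M"
    unfolding M_def by (intro real_distribution.intro measure_pmf.prob_space_distr) (auto simp: real_distribution_axioms_def)
  moreover have "AE x in M. 0 \<le> x"
    unfolding M_def by (subst AE_distr_iff) auto
  moreover have "(LINT x|M. exp (- (z * complex_of_real x))) = 1 - (1 - exp (- z)) powr of_real a" if z: "Re z > 0" for z
  proof -
    have nz: "norm (exp (- z)) < 1" using z by (simp add: norm_exp_eq_Re)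
    have e: "exp (- (z * of_nat j)) = exp (- z) ^ j" for j
      using exp_of_nat_mult[of j "- z"] by (simp add: mult.commute)
    have "(LINT x|M. exp (- (z * complex_of_real x))) = (LINT j|measure_pmf X. exp (- z) ^ j)"
      unfolding M_def by (subst integral_distr) (auto simp: e)
    also have "\<dots> = (LINT j|count_space UNIV. sibuya a j *\<^sub>R exp (- z) ^ j)"
      unfolding measure_pmf_eq_density X by (subst integral_density) (auto simp: sibuya_nonneg[OF a])
    also have "\<dots> = (\<Sum>j. sibuya a j *\<^sub>R exp (- z) ^ j)"
    proof (rule integral_count_space_nat)
      have "summable (\<lambda>j. norm (sibuya a j *\<^sub>R exp (- z) ^ j))"
      proof (rule summable_comparison_test'[of "sibuya a" 0])
        show "summable (sibuya a)" using sibuya_sums_1[OF a] by (simp add: sums_iff)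
        show "norm (norm (sibuya a n *\<^sub>R exp (- z) ^ n)) \<le> sibuya a n" for n
          using sibuya_nonneg[OF a, of n] nz
          by (simp add: norm_power mult_left_le power_le_one)
      qed
      then show "integrable (count_space UNIV) (\<lambda>j. sibuya a j *\<^sub>R exp (- z) ^ j)"
        by (simp add: integrable_count_space_nat_iff)
    qed
    also have "\<dots> = 1 - (1 - exp (- z)) powr of_real a"
      using sibuya_generating_function[OF nz, of a] by (simp add: sums_iff scaleR_conv_of_real)
    finally show ?thesis .
  qed
  ultimately show ?thesis unfolding laplace_law_def by blast
qed

lemma laplace_law_convolution:
  assumes M: "laplace_law M \<phi>" and N: "laplace_law N \<psi>"
  shows "laplace_law (distr (M \<Otimes>\<^sub>M N) borel (\<lambda>(x, y). x + y)) (\<lambda>z. \<phi> z * \<psi> z)"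
proof -
  interpret M: real_distribution M using M by (simp add: laplace_law_def)
  interpret N: real_distribution N using N by (simp add: laplace_law_def)
  interpret MN: pair_prob_space M N ..
  let ?D = "distr (M \<Otimes>\<^sub>M N) borel (\<lambda>(x, y). x + y)"
  have "prob_space ?D" by (rule MN.prob_space_distr) simp
  then have "real_distribution ?D" by (simp add: real_distribution_def real_distribution_axioms_def)
  moreover have AE: "AE p in M \<Otimes>\<^sub>M N. 0 \<le> fst p \<and> 0 \<le> snd p"
  proof (rule MN.AE_pair_measure)
    show "AE x in M. AE y in N. 0 \<le> fst (x, y) \<and> 0 \<le> snd (x, y)"
      using M N unfolding laplace_law_def by auto
  qed measurable
  then have "AE p in M \<Otimes>\<^sub>M N. 0 \<le> (case p of (x, y) \<Rightarrow> x + y)"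
    by eventually_elim auto
  then have "AE x in ?D. 0 \<le> x" by (subst AE_distr_iff) auto
  moreover have "(LINT x|?D. exp (- (z * complex_of_real x))) = \<phi> z * \<psi> z" if z: "Re z > 0" for z
  proof -
    let ?e = "\<lambda>x. exp (- (z * complex_of_real x))"
    have ee: "?e (x + y) = ?e x * ?e y" for x y
      by (simp add: algebra_simps flip: exp_add)
    have "(LINT x|?D. ?e x) = (LINT p|(M \<Otimes>\<^sub>M N). ?e (fst p + snd p))"
      by (subst integral_distr) (auto simp: case_prod_beta)
    also have "\<dots> = (LINT p|(M \<Otimes>\<^sub>M N). ?e (fst p) * ?e (snd p))"
      unfolding ee ..
    also have "\<dots> = (LINT x|M. LINT y|N. ?e x * ?e y)"
    proof (subst MN.integral_fst'[symmetric])
      show "integrable (M \<Otimes>\<^sub>M N) (\<lambda>p. ?e (fst p) * ?e (snd p))"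
        using MN.integrable_mult_prod[OF laplace_law_integrable[OF M z] laplace_law_integrable[OF N z]]
        unfolding case_prod_unfold .
    qed simp
    also have "\<dots> = \<phi> z * \<psi> z"
      using M N z by (simp add: laplace_law_def)
    finally show ?thesis .
  qed
  ultimately show ?thesis unfolding laplace_law_def by blast
qed

lemma laplace_law_scale:
  assumes M: "laplace_law M \<phi>" and c: "c > 0"
  shows "laplace_law (distr M borel (\<lambda>x. c * x)) (\<lambda>z. \<phi> (z * of_real c))"
proof -
  interpret M: real_distribution M using M by (simp add: laplace_law_def)
  have "real_distribution (distr M borel (\<lambda>x. c * x))"
    by (simp add: real_distribution_def real_distribution_axioms_def M.prob_space_distr)
  moreover have "AE x in distr M borel (\<lambda>x. c * x). 0 \<le> x"
    using M c by (subst AE_distr_iff) (auto simp: laplace_law_def zero_le_mult_iff)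
  moreover have "(LINT x|distr M borel (\<lambda>x. c * x). exp (- (z * complex_of_real x))) = \<phi> (z * of_real c)" if z: "Re z > 0" for z
  proof -
    have "Re (z * of_real c) > 0" using z c by simp
    then have "(LINT x|M. exp (- (z * of_real c * complex_of_real x))) = \<phi> (z * of_real c)"
      using M unfolding laplace_law_def by blast
    then show ?thesis by (subst integral_distr) (auto simp: mult.assoc)
  qed
  ultimately show ?thesis unfolding laplace_law_def by blast
qed

lemma laplace_law_power:
  assumes M: "laplace_law M \<phi>"
  shows "\<exists>N. laplace_law N (\<lambda>z. \<phi> z ^ n)"
proof (induction n)
  case 0
  have "laplace_law (return borel 0) (\<lambda>z. 1)"
    unfolding laplace_law_def
    by (auto simp: real_distribution_def real_distribution_axioms_def prob_space_return AE_return integral_return)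
  then show ?case by auto
next
  case (Suc n)
  then obtain N where "laplace_law N (\<lambda>z. \<phi> z ^ n)" by blast
  from laplace_law_convolution[OF M this] show ?case by auto
qed

section \<open>Passage to the stable limit\<close>

lemma one_minus_exp_over_tendsto:
  assumes h: "(h \<longlongrightarrow> 0) F" "eventually (\<lambda>n. h n \<noteq> 0) F"
  shows "((\<lambda>n. (1 - exp (- h n)) / (h n :: complex)) \<longlongrightarrow> 1) F"
proof -
  have "((\<lambda>z. 1 - exp (- z)) has_field_derivative 1) (at (0::complex))"
    by (auto intro!: derivative_eq_intros)
  then have "((\<lambda>z. (1 - exp (- z)) / z) \<longlongrightarrow> 1) (at (0::complex))"
    by (simp add: has_field_derivative_iff)
  then show ?thesis
    by (rule filterlim_compose) (use h in \<open>simp add: filterlim_at\<close>)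
qed

text \<open>Near 0 the function 1 - e^(-h) behaves like h, so \<open>of_nat (Suc n) * w n\<close>
  tends to z^a by homogeneity. The power of \<open>1 - w n\<close> is compared with the same power
  of \<open>exp (- w n)\<close>: both bases lie in the unit disc, so the error is at most n + 1
  times the one-step error, which is o(w n).\<close>

lemma sibuya_scaling_limit:
  assumes a: "0 < a" "a < 1" and z: "Re z > 0"
  shows "(\<lambda>n. (1 - (1 - exp (- (z * of_real (real (Suc n) powr (- (1 / a)))))) powr of_real a) ^ Suc n)
    \<longlonglongrightarrow> exp (- (z powr of_real a))"
proof -
  define e where "e n = real (Suc n) powr (- (1 / a))" for n
  have e: "e n > 0" for n by (simp add: e_def)
  have ea: "e n powr a * real (Suc n) = 1" for n
  proof -
    have "e n powr a = real (Suc n) powr (- 1)"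
      using a unfolding e_def powr_powr by simp
    then show ?thesis by (simp add: powr_minus del: of_nat_Suc)
  qed
  have e0: "e \<longlonglongrightarrow> 0"
    unfolding e_def using a by real_asymp
  define h where "h n = z * of_real (e n)" for n
  have z0: "z \<noteq> 0" using z by auto
  have h: "h \<longlonglongrightarrow> 0" unfolding h_def using e0 by (auto intro!: tendsto_eq_intros)
  have h_nz: "h n \<noteq> 0" for n using z0 e[of n] by (simp add: h_def)
  define v where "v n = (1 - exp (- h n)) / h n" for n
  have v: "v \<longlonglongrightarrow> 1"
    unfolding v_def using h h_nz by (intro one_minus_exp_over_tendsto) auto
  define w where "w n = (1 - exp (- h n)) powr of_real a" for n
  have nw: "of_nat (Suc n) * w n = (z * v n) powr of_real a" for n
  proof -
    have "1 - exp (- h n) = of_real (e n) * (z * v n)"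
      using h_nz[of n] e[of n] z0 by (simp add: v_def h_def)
    then have "w n = of_real (e n powr a) * (z * v n) powr of_real a"
      unfolding w_def by (simp only: powr_scale_of_real[OF e])
    then have "of_nat (Suc n) * w n = of_real (e n powr a * real (Suc n)) * (z * v n) powr of_real a"
      by simp
    then show ?thesis unfolding ea by simp
  qed
  have nwl: "(\<lambda>n. of_nat (Suc n) * w n) \<longlonglongrightarrow> z powr of_real a"
  proof -
    have zn: "z \<notin> \<real>\<^sub>\<le>\<^sub>0" using z by (auto simp: complex_nonpos_Reals_iff)
    have "(\<lambda>n. (z * v n) powr of_real a) \<longlonglongrightarrow> (z * 1) powr of_real a"
      using zn v by (intro tendsto_intros) auto
    then show ?thesis unfolding nw by simp
  qed
  have w0: "w \<longlonglongrightarrow> 0"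
  proof -
    have "(\<lambda>n. (of_nat (Suc n) * w n) * of_real (inverse (real (Suc n)))) \<longlonglongrightarrow> z powr of_real a * of_real 0"
      by (intro tendsto_intros nwl LIMSEQ_inverse_real_of_nat)
    moreover have "(\<lambda>n. (of_nat (Suc n) * w n) * of_real (inverse (real (Suc n)))) = w"
      by (rule ext) (simp add: field_simps del: of_nat_Suc)
    ultimately show ?thesis by simp
  qed
  have Reh: "Re (1 - exp (- h n)) > 0" for n
  proof -
    have "norm (exp (- h n)) < 1" using z e[of n] by (simp add: norm_exp_eq_Re h_def)
    then have "Re (exp (- h n)) < 1" using complex_Re_le_cmod[of "exp (- h n)"] by linarith
    then show ?thesis by simp
  qed
  have wpos: "Re (w n) > 0" for n
    unfolding w_def using Reh a by (intro Re_powr_pos)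
  have w_nz: "w n \<noteq> 0" for n using wpos[of n] by auto
  obtain M where M: "laplace_law M (\<lambda>z. 1 - (1 - exp (- z)) powr of_real a)"
    using laplace_law_sibuya[OF a] by blast
  have n1: "norm (1 - w n) \<le> 1" for n
    using laplace_law_norm_le[OF M, of "h n"] z e[of n] by (simp add: w_def h_def)
  have n2: "norm (exp (- w n)) \<le> 1" for n
    using wpos[of n] by (simp add: norm_exp_eq_Re)
  have "(\<lambda>n. (1 - w n) ^ Suc n - exp (- w n) ^ Suc n) \<longlonglongrightarrow> 0"
  proof (rule Lim_null_comparison)
    show "eventually (\<lambda>n. norm ((1 - w n) ^ Suc n - exp (- w n) ^ Suc n) \<le>
        norm (of_nat (Suc n) * w n) * norm ((1 - exp (- w n)) / w n - 1)) sequentially"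
    proof (rule always_eventually, rule allI)
      fix n
      have "norm ((1 - w n) ^ Suc n - exp (- w n) ^ Suc n) \<le> real (Suc n) * norm ((1 - w n) - exp (- w n))"
        by (rule norm_power_diff[OF n1 n2])
      also have "(1 - w n) - exp (- w n) = w n * ((1 - exp (- w n)) / w n - 1)"
        using w_nz[of n] by (simp add: field_simps)
      finally show "norm ((1 - w n) ^ Suc n - exp (- w n) ^ Suc n) \<le>
        norm (of_nat (Suc n) * w n) * norm ((1 - exp (- w n)) / w n - 1)"
        by (simp add: norm_mult mult.assoc del: power_Suc of_nat_Suc)
    qed
    have "(\<lambda>n. norm (of_nat (Suc n) * w n) * norm ((1 - exp (- w n)) / w n - 1)) \<longlonglongrightarrow> norm (z powr of_real a) * norm (1 - 1 :: complex)"
      using w0 w_nz by (intro tendsto_intros nwl one_minus_exp_over_tendsto) auto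
    then show "(\<lambda>n. norm (of_nat (Suc n) * w n) * norm ((1 - exp (- w n)) / w n - 1)) \<longlonglongrightarrow> 0" by simp
  qed
  moreover have "(\<lambda>n. exp (- w n) ^ Suc n) \<longlonglongrightarrow> exp (- (z powr of_real a))"
  proof -
    have "exp (- w n) ^ Suc n = exp (- (of_nat (Suc n) * w n))" for n
      by (simp add: exp_of_nat_mult[symmetric] del: power_Suc of_nat_Suc)
    then show ?thesis using nwl by (auto intro!: tendsto_intros simp del: of_nat_Suc power_Suc)
  qed
  ultimately have "(\<lambda>n. ((1 - w n) ^ Suc n - exp (- w n) ^ Suc n) + exp (- w n) ^ Suc n) \<longlonglongrightarrow> 0 + exp (- (z powr of_real a))"
    by (rule tendsto_add)
  then show ?thesis by (simp add: w_def h_def e_def del: power_Suc)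
qed

text \<open>The last bound, uniform in \<open>n\<close>, is there for tightness. It is Bernoulli's
  inequality, once 1 - e^(-x) \<le> x has given (n + 1) w \<le> l^a.\<close>

lemma stable_law_aux:
  assumes a: "0 < a" "a < 1"
  obtains L :: "nat \<Rightarrow> real measure" where "\<And>n. real_distribution (L n)" "\<And>n. AE x in L n. 0 \<le> x"
    "\<And>z. Re z > 0 \<Longrightarrow> (\<lambda>n. LINT x|L n. exp (- (z * complex_of_real x))) \<longlonglongrightarrow> exp (- (z powr of_real a))"
    "\<And>n l. l > 0 \<Longrightarrow> (LINT x|L n. exp (- (l * x))) \<ge> 1 - l powr a"
proof -
  obtain M where M: "laplace_law M (\<lambda>z. 1 - (1 - exp (- z)) powr of_real a)"
    using laplace_law_sibuya[OF a] by blast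
  define e where "e n = real (Suc n) powr (- (1 / a))" for n
  have e: "e n > 0" for n by (simp add: e_def)
  have ea: "e n powr a * real (Suc n) = 1" for n
  proof -
    have "e n powr a = real (Suc n) powr (- 1)"
      using a unfolding e_def powr_powr by simp
    then show ?thesis by (simp add: powr_minus del: of_nat_Suc)
  qed
  have "\<exists>N. laplace_law N (\<lambda>z. (1 - (1 - exp (- (z * of_real (e n)))) powr of_real a) ^ Suc n)" for n
  proof -
    obtain N where N: "laplace_law N (\<lambda>z. (1 - (1 - exp (- z)) powr of_real a) ^ Suc n)"
      using laplace_law_power[OF M] by blast
    from laplace_law_scale[OF N e[of n]] show ?thesis by blast
  qed
  then obtain L where L: "\<And>n. laplace_law (L n) (\<lambda>z. (1 - (1 - exp (- (z * of_real (e n)))) powr of_real a) ^ Suc n)"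
    by metis
  show ?thesis
  proof (rule that)
    show "real_distribution (L n)" "AE x in L n. 0 \<le> x" for n
      using L[of n] by (auto simp: laplace_law_def)
    show "(\<lambda>n. LINT x|L n. exp (- (z * complex_of_real x))) \<longlonglongrightarrow> exp (- (z powr of_real a))" if z: "Re z > 0" for z
    proof -
      have "(LINT x|L n. exp (- (z * complex_of_real x))) = (1 - (1 - exp (- (z * of_real (e n)))) powr of_real a) ^ Suc n" for n
        using L[of n] z unfolding laplace_law_def by blast
      then show ?thesis using sibuya_scaling_limit[OF a z] unfolding e_def by presburger
    qed
    show "(LINT x|L n. exp (- (l * x))) \<ge> 1 - l powr a" if l: "l > 0" for n and l :: real
    proof -
      define w where "w = (1 - exp (- (l * e n))) powr a"
      have le: "l * e n > 0" using l e[of n] by simp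
      have u: "0 \<le> 1 - exp (- (l * e n))" "1 - exp (- (l * e n)) \<le> 1" using le by auto
      have w: "0 \<le> w" "w \<le> 1" using u a unfolding w_def by (auto intro: powr_le1)
      have "1 - exp (- (l * e n)) \<le> l * e n"
        using exp_ge_add_one_self[of "- (l * e n)"] by simp
      then have "w \<le> (l * e n) powr a"
        unfolding w_def using u a by (intro powr_mono2) auto
      also have "\<dots> = l powr a * e n powr a" using l e[of n] by (simp add: powr_mult)
      finally have "real (Suc n) * w \<le> real (Suc n) * (l powr a * e n powr a)"
        by (rule mult_left_mono) simp
      also have "\<dots> = l powr a * (e n powr a * real (Suc n))" by (simp only: mult_ac)
      also have "\<dots> = l powr a" unfolding ea by simp
      finally have nw: "real (Suc n) * w \<le> l powr a" .
      have "complex_of_real (LINT x|L n. exp (- (l * x))) = (LINT x|L n. exp (- (complex_of_real l * complex_of_real x)))"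
        unfolding integral_complex_of_real[symmetric] by (simp add: exp_of_real[symmetric])
      also have "\<dots> = (1 - (1 - exp (- (complex_of_real l * of_real (e n)))) powr of_real a) ^ Suc n"
        using L[of n] l unfolding laplace_law_def by simp
      also have "1 - exp (- (complex_of_real l * of_real (e n))) = of_real (1 - exp (- (l * e n)))"
        by (simp add: exp_of_real[symmetric])
      also have "(of_real (1 - exp (- (l * e n)))) powr complex_of_real a = of_real w"
        unfolding w_def by (rule powr_of_real[OF u(1)])
      also have "(1 - complex_of_real w) ^ Suc n = of_real ((1 - w) ^ Suc n)"
        by simp
      finally have "(LINT x|L n. exp (- (l * x))) = (1 - w) ^ Suc n"
        by (simp only: of_real_eq_iff)
      moreover have "1 + real (Suc n) * (- w) \<le> (1 + (- w)) ^ Suc n"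
        using w by (intro Bernoulli_inequality) auto
      ultimately show ?thesis using nw by simp
    qed
  qed
qed

text \<open>A weak limit of rescaled sums of Sibuya variables. It has no atom at 0 because its
  transform tends to 0 along the positive axis; strict positivity later permits division by
  \<open>D\<close>.\<close>

theorem stable_law_exists:
  assumes a: "0 < a" "a < 1"
  obtains \<nu> where "real_distribution \<nu>" "AE x in \<nu>. 0 < x"
    "\<And>z. Re z > 0 \<Longrightarrow> (LINT x|\<nu>. exp (- (z * complex_of_real x))) = exp (- (z powr of_real a))"
proof -
  obtain L :: "nat \<Rightarrow> real measure" where L: "\<And>n. real_distribution (L n)" "\<And>n. AE x in L n. 0 \<le> x"
    and lim: "\<And>z. Re z > 0 \<Longrightarrow> (\<lambda>n. LINT x|L n. exp (- (z * complex_of_real x))) \<longlonglongrightarrow> exp (- (z powr of_real a))"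
    and ge: "\<And>n l. l > 0 \<Longrightarrow> (LINT x|L n. exp (- (l * x))) \<ge> 1 - l powr a"
    by (rule stable_law_aux[OF a]) blast
  interpret L: real_distribution "L n" for n by (rule L)
  \<comment> \<open>A Markov inequality for 1 - e^(-x/K), which is at least 1 - e^(-1) beyond
    \<open>K\<close> and whose mean is controlled by the uniform bound.\<close>
  have tail: "measure (L n) {x. x > K} * (1 - exp (-1)) \<le> (1 / K) powr a" if K: "K > 0" for K n
  proof -
    have i: "integrable (L n) (\<lambda>x. exp (- (1 / K * x)))"
    proof (rule L.integrable_const_bound[where B = 1])
      show "AE x in L n. norm (exp (- (1 / K * x))) \<le> 1"
        using L(2)[of n] by eventually_elim (use K in auto)
    qed simp
    have "measure (L n) {x. x > K} * (1 - exp (-1)) = (LINT x|L n. (1 - exp (-1)) * indicator {x. x > K} x)"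
      by simp
    also have "\<dots> \<le> (LINT x|L n. 1 - exp (- (1 / K * x)))"
    proof (rule integral_mono_AE)
      show "integrable (L n) (\<lambda>x. (1 - exp (-1)) * indicator {x. x > K} x)"
        by (intro integrable_mult_right L.integrable_const_bound[where B = 1]) (auto simp: indicator_def)
      show "AE x in L n. (1 - exp (-1)) * indicator {x. x > K} x \<le> 1 - exp (- (1 / K * x))"
        using L(2)[of n] by eventually_elim (use K in \<open>auto simp: indicator_def field_simps\<close>)
    qed (use i in simp)
    also have "\<dots> = 1 - (LINT x|L n. exp (- (1 / K * x)))"
      using i L.prob_space by (subst Bochner_Integration.integral_diff) auto
    also have "\<dots> \<le> (1 / K) powr a" using ge[of "1 / K" n] K by simp
    finally show ?thesis .
  qed
  have "tight L"
    unfolding tight_def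
  proof (intro conjI allI impI L)
    fix \<epsilon> :: real assume \<epsilon>: "\<epsilon> > 0"
    have p: "1 - exp (-1::real) > 0" by simp
    have "((\<lambda>K. (1 / K) powr a) \<longlongrightarrow> 0) at_top"
      using a by real_asymp
    then have "eventually (\<lambda>K. (1 / K) powr a < \<epsilon> * (1 - exp (-1)) \<and> K > 0) at_top"
      using \<epsilon> p by (intro eventually_conj order_tendstoD eventually_gt_at_top) auto
    then obtain K where K: "(1 / K) powr a < \<epsilon> * (1 - exp (-1))" "K > 0"
      by (metis (mono_tags, lifting) eventually_happens trivial_limit_at_top_linorder)
    \<comment> \<open>The left end is -1 because the interval excludes it and only
      \<open>0 \<le> x\<close> is known.\<close>
    have "measure (L n) {-1<..K} > 1 - \<epsilon>" for n
    proof -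
      have "measure (L n) {x. x > K} * (1 - exp (-1)) < \<epsilon> * (1 - exp (-1))"
        using tail[OF K(2), of n] K(1) by linarith
      then have "measure (L n) {x. x > K} < \<epsilon>" using p by (simp only: mult_less_cancel_right_pos)
      moreover have "1 = measure (L n) ({-1<..K} \<union> {x. x > K})"
      proof -
        have "AE x in L n. x \<in> {-1<..K} \<union> {x. x > K}"
          using L(2)[of n] by eventually_elim auto
        then show ?thesis by (subst (asm) L.AE_in_set_eq_1) auto
      qed
      moreover have "measure (L n) ({-1<..K} \<union> {x. x > K}) \<le> measure (L n) {-1<..K} + measure (L n) {x. x > K}"
        by (rule measure_Un_le) auto
      ultimately show ?thesis by linarith
    qed
    then show "\<exists>a b. a < b \<and> (\<forall>n. 1 - \<epsilon> < measure (L n) {a<..b})"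
      using K(2) by (intro exI[of _ "-1"] exI[of _ K]) auto
  qed
  from tight_imp_convergent_subsubsequence[OF this strict_mono_id]
  obtain r M where r: "strict_mono (r :: nat \<Rightarrow> nat)" and M: "real_distribution M" and conv: "weak_conv_m (\<lambda>n. L (r n)) M"
    by (auto simp: o_def)
  interpret M: real_distribution M by (rule M)
  \<comment> \<open>Weak convergence is tested with functions bounded and continuous on the whole
    line. Pushing forward by \<open>max 0\<close> turns e^(-zx) into such a function and makes the
    limit nonnegative at once.\<close>
  define \<nu> where "\<nu> = distr M borel (\<lambda>x. max 0 x)"
  have rd: "real_distribution \<nu>"
    unfolding \<nu>_def by (simp add: real_distribution_def real_distribution_axioms_def M.prob_space_distr)
  interpret N: real_distribution \<nu> by (rule rd)
  have LT: "(LINT x|\<nu>. exp (- (z * complex_of_real x))) = exp (- (z powr of_real a))" if z: "Re z > 0" for z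
  proof (rule LIMSEQ_unique)
    let ?f = "\<lambda>x. exp (- (z * complex_of_real (max 0 x)))"
    have "(\<lambda>n. integral\<^sup>L (L (r n)) ?f) \<longlonglongrightarrow> integral\<^sup>L M ?f"
    proof (rule weak_conv_imp_integral_bdd_continuous_conv[of "\<lambda>n. L (r n)" M ?f 1, OF L(1) M conv])
      show "isCont ?f x" for x
      proof -
        have "isCont (\<lambda>x::real. max 0 x) x"
          using continuous_on_max[OF continuous_on_const continuous_on_id, of UNIV "0::real"]
          by (simp add: continuous_on_eq_continuous_at)
        then show ?thesis by (intro continuous_intros)
      qed
      show "norm (?f x) \<le> 1" for x using z by (simp add: norm_exp_eq_Re)
    qed
    moreover have "integral\<^sup>L (L n) ?f = (LINT x|L n. exp (- (z * complex_of_real x)))" for n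
    proof (rule integral_cong_AE)
      show "AE x in L n. ?f x = exp (- (z * complex_of_real x))"
        using L(2)[of n] by eventually_elim (simp add: max_def)
    qed auto
    moreover have "integral\<^sup>L M ?f = (LINT x|\<nu>. exp (- (z * complex_of_real x)))"
      unfolding \<nu>_def by (subst integral_distr) auto
    ultimately show "(\<lambda>n. LINT x|L (r n). exp (- (z * complex_of_real x))) \<longlonglongrightarrow> (LINT x|\<nu>. exp (- (z * complex_of_real x)))"
      by simp
    show "(\<lambda>n. LINT x|L (r n). exp (- (z * complex_of_real x))) \<longlonglongrightarrow> exp (- (z powr of_real a))"
      using LIMSEQ_subseq_LIMSEQ[OF lim[OF z] r] by (simp add: o_def)
  qed
  have nn: "AE x in \<nu>. 0 \<le> x" unfolding \<nu>_def by (subst AE_distr_iff) auto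
  \<comment> \<open>Along the integers the transform tends to the mass of {0} by dominated
    convergence, and to 0 by its formula.\<close>
  have "(\<lambda>n. LINT x|\<nu>. exp (- (complex_of_real (real (Suc n)) * complex_of_real x))) \<longlonglongrightarrow> (LINT x|\<nu>. indicator {0} x)"
  proof (rule integral_dominated_convergence[where w = "\<lambda>_. 1"])
    show "AE x in \<nu>. (\<lambda>n. exp (- (complex_of_real (real (Suc n)) * complex_of_real x))) \<longlonglongrightarrow> indicator {0} x"
      using nn
    proof eventually_elim
      case (elim x)
      show ?case
      proof (cases "x = 0")
        case False
        with elim have "x > 0" by simp
        then have "(\<lambda>n. exp (- (real (Suc n) * x))) \<longlonglongrightarrow> 0" by real_asymp
        then have "(\<lambda>n. complex_of_real (exp (- (real (Suc n) * x)))) \<longlonglongrightarrow> of_real 0"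
          by (rule tendsto_of_real)
        then show ?thesis using False by (simp add: exp_of_real[symmetric])
      qed simp
    qed
    show "AE x in \<nu>. norm (exp (- (complex_of_real (real (Suc n)) * complex_of_real x))) \<le> 1" for n
      using nn by eventually_elim (simp add: norm_exp_eq_Re)
  qed auto
  moreover have "(\<lambda>n. LINT x|\<nu>. exp (- (complex_of_real (real (Suc n)) * complex_of_real x))) \<longlonglongrightarrow> 0"
  proof -
    have "(\<lambda>n. exp (- (real (Suc n) powr a))) \<longlonglongrightarrow> 0" using a by real_asymp
    then have "(\<lambda>n. complex_of_real (exp (- (real (Suc n) powr a)))) \<longlonglongrightarrow> of_real 0"
      by (rule tendsto_of_real)
    moreover have "(LINT x|\<nu>. exp (- (complex_of_real (real (Suc n)) * complex_of_real x))) = complex_of_real (exp (- (real (Suc n) powr a)))" for n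
    proof -
      have "complex_of_real (real (Suc n)) powr of_real a = of_real (real (Suc n) powr a)"
        by (rule powr_of_real) simp
      then show ?thesis using LT[of "complex_of_real (real (Suc n))"] by (simp add: exp_of_real[symmetric] del: of_nat_Suc)
    qed
    ultimately show ?thesis by simp
  qed
  ultimately have "(LINT x|\<nu>. indicator {0} x :: complex) = 0" by (rule LIMSEQ_unique)
  moreover have "(LINT x|\<nu>. indicator {0} x :: complex) = (LINT x|\<nu>. complex_of_real (indicator {0} x))"
    by (intro Bochner_Integration.integral_cong) (auto simp: indicator_def)
  moreover have "\<dots> = complex_of_real (measure \<nu> {0})"
    unfolding integral_complex_of_real by simp
  ultimately have "measure \<nu> {0} = 0" by simp
  then have "AE x in \<nu>. x \<noteq> 0"
    by (subst AE_iff_measurable[of "{0}"]) (auto simp: N.emeasure_eq_measure)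
  then have "AE x in \<nu>. 0 < x" using nn by eventually_elim simp
  then show ?thesis using that[OF rd _ LT] by blast
qed

subsection \<open>The kernel\<close>

lemma Gamma_integral_lborel:
  fixes a :: real
  assumes a: "a > 0"
  shows "integrable lborel (\<lambda>t. indicator {0<..} t * (t powr (a - 1) * exp (- t)))"
    and "(LINT t|lborel. indicator {0<..} t * (t powr (a - 1) * exp (- t))) = Gamma a"
proof -
  let ?f = "\<lambda>t::real. t powr (a - 1) * exp (- t)"
  have "((\<lambda>t. t powr (a - 1) / exp t) has_integral Gamma a) {0..}"
    by (rule Gamma_integral_real[OF a])
  also have "(\<lambda>t::real. t powr (a - 1) / exp t) = ?f"
    by (auto simp: exp_minus divide_inverse)
  finally have "(?f has_integral Gamma a) {0..}" .
  then have "(\<integral>\<^sup>+t. ennreal (indicator {0..} t * ?f t) \<partial>lborel) = ennreal (Gamma a)"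
    by (intro nn_integral_has_integral_lebesgue) auto
  also have "(\<integral>\<^sup>+t. ennreal (indicator {0..} t * ?f t) \<partial>lborel) = (\<integral>\<^sup>+t. ennreal (indicator {0<..} t * ?f t) \<partial>lborel)"
    by (intro nn_integral_cong) (auto simp: indicator_def)
  finally have n: "(\<integral>\<^sup>+t. ennreal (indicator {0<..} t * ?f t) \<partial>lborel) = ennreal (Gamma a)" .
  have "has_bochner_integral lborel (\<lambda>t. indicator {0<..} t * ?f t) (Gamma a)"
    using a by (intro has_bochner_integral_nn_integral n) (auto intro: less_imp_le Gamma_real_pos)
  then show "integrable lborel (\<lambda>t. indicator {0<..} t * ?f t)" "(LINT t|lborel. indicator {0<..} t * ?f t) = Gamma a"
    by (auto simp: has_bochner_integral_iff)
qed

lemma integrable_powr_exp: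
  fixes a c :: real
  assumes a: "a > 0" and c: "c > 0"
  shows "integrable lborel (\<lambda>t. indicator {0<..} t * (t powr (a - 1) * exp (- (c * t))))"
proof -
  have "integrable lborel (\<lambda>t. c powr (1 - a) * (indicator {0<..} (0 + c * t) * ((0 + c * t) powr (a - 1) * exp (- (0 + c * t)))))"
    using c by (intro integrable_mult_right lborel_integrable_real_affine[OF Gamma_integral_lborel(1)[OF a]]) auto
  also have "(\<lambda>t. c powr (1 - a) * (indicator {0<..} (0 + c * t) * ((0 + c * t) powr (a - 1) * exp (- (0 + c * t))))) =
     (\<lambda>t. indicator {0<..} t * (t powr (a - 1) * exp (- (c * t))))"
  proof
    fix t
    have "c powr (1 - a) * c powr (a - 1) = 1" using c by (simp flip: powr_add)
    then show "c powr (1 - a) * (indicator {0<..} (0 + c * t) * ((0 + c * t) powr (a - 1) * exp (- (0 + c * t)))) =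
      indicator {0<..} t * (t powr (a - 1) * exp (- (c * t)))"
      using c by (cases "t > 0") (auto simp: indicator_def powr_mult zero_less_mult_iff mult.assoc[symmetric])
  qed
  finally show ?thesis .
qed

text \<open>The weight is the differential of r^a, so an antiderivative is explicit; absolute
  integrability is the same computation with \<open>Re w\<close>. With \<open>w\<close> the symbol,
  this is where its reciprocal comes from.\<close>

lemma integral_powr_exp_powr:
  fixes w :: complex
  assumes a: "a > 0" and w: "Re w > 0"
  shows "set_integrable lborel {0<..} (\<lambda>r. of_real (a * r powr (a - 1)) * exp (- (of_real (r powr a) * w)))"
    and "(LINT r:{0<..}|lborel. of_real (a * r powr (a - 1)) * exp (- (of_real (r powr a) * w))) = 1 / w"
proof -
  have ei: "einterval 0 \<infinity> = {0::real<..}" by (auto simp: einterval_def)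
  have w0: "w \<noteq> 0" using w by auto
  let ?f = "\<lambda>r. of_real (a * r powr (a - 1)) * exp (- (of_real (r powr a) * w))"
  let ?g = "\<lambda>r. (a * r powr (a - 1)) * exp (- (r powr a * Re w))"
  let ?G = "\<lambda>r. - exp (- (r powr a * Re w)) / Re w"
  let ?F = "\<lambda>r. - exp (- (of_real (r powr a) * w)) / w"
  have g: "set_integrable lborel (einterval 0 \<infinity>) ?g"
  proof (rule interval_integral_FTC_nonneg[where F = ?G and A = "- inverse (Re w)" and B = 0])
    show "DERIV ?G x :> ?g x" if "0 < ereal x" for x
      using that w by (auto intro!: derivative_eq_intros simp: field_simps powr_diff)
    show "isCont ?g x" if "0 < ereal x" for x
      using that by (auto intro!: continuous_intros)
    have "(?G \<longlongrightarrow> - inverse (Re w)) (at_right 0)" using a w by real_asymp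
    then show "((?G \<circ> real_of_ereal) \<longlongrightarrow> - inverse (Re w)) (at_right 0)"
      by (simp add: ereal_tendsto_simps zero_ereal_def)
    have "(?G \<longlongrightarrow> 0) at_top" using a w by real_asymp
    then show "((?G \<circ> real_of_ereal) \<longlongrightarrow> 0) (at_left \<infinity>)"
      by (simp add: ereal_tendsto_simps)
  qed (use a in auto)
  have f: "set_integrable lborel (einterval 0 \<infinity>) ?f"
    using g unfolding set_integrable_def
    by (rule Bochner_Integration.integrable_bound) (use a in \<open>auto simp: norm_mult norm_exp_eq_Re indicator_def\<close>)
  then show "set_integrable lborel {0<..} ?f" unfolding ei .
  have "(LBINT x=0..\<infinity>. ?f x) = 0 - (- 1 / w)"
  proof (rule interval_integral_FTC_integrable[where F = ?F])
    show "(?F has_vector_derivative ?f x) (at x)" if "0 < ereal x" for x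
    proof -
      have 1: "((\<lambda>r. r powr a) has_vector_derivative (a * x powr (a - 1))) (at x)"
        using that unfolding has_real_derivative_iff_has_vector_derivative[symmetric]
        by (auto intro!: derivative_eq_intros)
      have "((\<lambda>z. - exp (- (of_real z * w)) / w) has_vector_derivative exp (- (of_real (x powr a) * w))) (at (x powr a))"
        by (rule has_vector_derivative_real_field[where f = "\<lambda>z. - exp (- (z * w)) / w"])
           (use w0 in \<open>auto intro!: derivative_eq_intros\<close>)
      from vector_diff_chain_at[OF 1 this] show ?thesis
        by (simp add: o_def scaleR_conv_of_real)
    qed
    show "isCont ?f x" if "0 < ereal x" for x
      using that by (auto intro!: continuous_intros)
    have "((\<lambda>r::real. r powr a) \<longlongrightarrow> 0) (at_right 0)" using a by real_asymp
    then have "(?F \<longlongrightarrow> - exp (- (of_real 0 * w)) / w) (at_right 0)"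
      by (intro tendsto_intros) (use w0 in auto)
    then show "((?F \<circ> real_of_ereal) \<longlongrightarrow> - 1 / w) (at_right 0)"
      by (simp add: ereal_tendsto_simps zero_ereal_def)
    have "((\<lambda>r. exp (- (r powr a * Re w)) / norm w) \<longlongrightarrow> 0) at_top"
      using a w w0 by real_asymp
    then have "(?F \<longlongrightarrow> 0) at_top"
      by (rule Lim_null_comparison[rotated]) (simp add: norm_divide norm_exp_eq_Re)
    then show "((?F \<circ> real_of_ereal) \<longlongrightarrow> 0) (at_left \<infinity>)"
      by (simp add: ereal_tendsto_simps)
  qed (use f in auto)
  then show "(LINT r:{0<..}|lborel. ?f r) = 1 / w"
    by (simp add: interval_lebesgue_integral_def ei)
qed

text \<open>Both shifted arguments have modulus at least \<open>Re s\<close>, and a convex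
  combination keeps the bound. It does not depend on \<xi>, which later gives a dominating
  function.\<close>

lemma Re_symbol_ge:
  assumes \<alpha>: "0 < \<alpha>" "\<alpha> < 1" and p: "0 \<le> p" "p \<le> 1" and s: "Re s > 0"
  shows "Re (symbol \<alpha> p \<xi> s) \<ge> Re s powr \<alpha> * cos (\<alpha> * pi / 2)"
proof -
  have c: "cos (\<alpha> * pi / 2) > 0" by (rule cos_half_pi_pos[OF \<alpha>])
  have *: "Re (z powr of_real \<alpha>) \<ge> Re s powr \<alpha> * cos (\<alpha> * pi / 2)" if "Re z = Re s" for z :: complex
  proof -
    have "Re s powr \<alpha> \<le> norm z powr \<alpha>"
      using s that \<alpha> complex_Re_le_cmod[of z] by (intro powr_mono2) auto
    then show ?thesis
      using Re_powr_ge[of z \<alpha>] s \<alpha> c that by (smt (verit) mult_right_mono)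
  qed
  let ?A = "(s - \<i> * \<xi>) powr of_real \<alpha>" and ?B = "(s + \<i> * \<xi>) powr of_real \<alpha>"
  let ?m = "Re s powr \<alpha> * cos (\<alpha> * pi / 2)"
  have "p * ?m + (1 - p) * ?m \<le> p * Re ?A + (1 - p) * Re ?B"
    using p by (intro add_mono mult_left_mono *) auto
  also have "\<dots> = Re (symbol \<alpha> p \<xi> s)" by (simp add: symbol_def)
  finally show ?thesis by (simp add: algebra_simps)
qed

lemma Re_symbol_pos:
  assumes \<alpha>: "0 < \<alpha>" "\<alpha> < 1" and p: "0 \<le> p" "p \<le> 1" and s: "Re s > 0"
  shows "Re (symbol \<alpha> p \<xi> s) > 0"
proof -
  have "Re s powr \<alpha> * cos (\<alpha> * pi / 2) > 0"
    using cos_half_pi_pos[OF \<alpha>] s by (intro mult_pos_pos) auto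
  then show ?thesis using Re_symbol_ge[OF assms, of \<xi>] by linarith
qed

lemma symbol_0: "symbol \<alpha> p 0 s = s powr of_real \<alpha>"
  by (simp add: symbol_def algebra_simps)

text \<open>The symbol is homogeneous of degree \<alpha> in (s, \<xi>), so the kernel is
  self-similar: a single measure on velocities \<open>x\<close> determines it at all times, up to
  the power of \<open>t\<close>.\<close>

definition kernel_transform :: "real \<Rightarrow> real measure \<Rightarrow> real \<Rightarrow> real \<Rightarrow> complex" where
  "kernel_transform \<alpha> \<mu> \<xi> t = of_real (t powr (\<alpha> - 1)) * (LINT x|\<mu>. cis (- (\<xi> * (t * x))))"

text \<open>The support bound is finite propagation speed and comes from |A - B| \<le> A + B. It
  makes the transform of the measure Lipschitz, which pointwise inversion needs.\<close>

theorem kernel_measure_exists: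
  assumes \<alpha>: "0 < \<alpha>" "\<alpha> < 1" and p: "0 \<le> p" "p \<le> 1"
  obtains \<mu> :: "real measure" where "finite_measure \<mu>" "sets \<mu> = sets borel" "AE x in \<mu>. \<bar>x\<bar> \<le> 1"
    "\<And>\<xi> s. Re s > 0 \<Longrightarrow>
       (LINT t:{0<..}|lborel. exp (- (s * of_real t)) * kernel_transform \<alpha> \<mu> \<xi> t) = 1 / symbol \<alpha> p \<xi> s"
proof -
  obtain \<nu> where rd: "real_distribution \<nu>" and pos: "AE x in \<nu>. 0 < x"
    and LT: "\<And>z. Re z > 0 \<Longrightarrow> (LINT x|\<nu>. exp (- (z * complex_of_real x))) = exp (- (z powr of_real \<alpha>))"
    by (rule stable_law_exists[OF \<alpha>]) blast
  interpret N: real_distribution \<nu> by (rule rd)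
  interpret NN: pair_prob_space \<nu> \<nu> ..
  define \<Omega> where "\<Omega> = \<nu> \<Otimes>\<^sub>M \<nu>"
  interpret O: prob_space \<Omega> unfolding \<Omega>_def by unfold_locales
  interpret LO: pair_sigma_finite lborel \<Omega> ..
  have sets_\<Omega> [measurable_cong]: "sets \<Omega> = sets (borel \<Otimes>\<^sub>M borel)"
    unfolding \<Omega>_def by (intro sets_pair_measure_cong) auto
  \<comment> \<open>Scaling a stable variable by k multiplies its exponent by k^\<alpha>; the powers
    1 / \<alpha> therefore produce the weights 1 - p and p. For p = 0 or p = 1 one of the two
    variables is identically 0.\<close>
  define A where "A \<omega> = (1 - p) powr (1 / \<alpha>) * fst \<omega>" for \<omega> :: "real \<times> real"
  define B where "B \<omega> = p powr (1 / \<alpha>) * snd \<omega>" for \<omega> :: "real \<times> real"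
  define D where "D \<omega> = A \<omega> + B \<omega>" for \<omega>
  define X where "X \<omega> = (A \<omega> - B \<omega>) / D \<omega>" for \<omega>
  have [measurable]: "A \<in> borel_measurable (borel \<Otimes>\<^sub>M borel)" "B \<in> borel_measurable (borel \<Otimes>\<^sub>M borel)"
    unfolding A_def B_def by measurable
  have [measurable]: "D \<in> borel_measurable (borel \<Otimes>\<^sub>M borel)" unfolding D_def by measurable
  have [measurable]: "X \<in> borel_measurable (borel \<Otimes>\<^sub>M borel)" unfolding X_def by measurable
  have AE: "AE \<omega> in \<Omega>. A \<omega> \<ge> 0 \<and> B \<omega> \<ge> 0 \<and> D \<omega> > 0"
  proof -
    have "AE \<omega> in \<Omega>. 0 < fst \<omega> \<and> 0 < snd \<omega>"
      unfolding \<Omega>_def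
    proof (rule NN.AE_pair_measure)
      show "AE x in \<nu>. AE y in \<nu>. 0 < fst (x, y) \<and> 0 < snd (x, y)"
        using pos by auto
    qed measurable
    then show ?thesis
    proof eventually_elim
      case (elim \<omega>)
      then have "A \<omega> \<ge> 0" "B \<omega> \<ge> 0" by (auto simp: A_def B_def)
      moreover have "A \<omega> > 0 \<or> B \<omega> > 0"
        using elim p by (cases "p = 0") (auto simp: A_def B_def)
      ultimately show ?case unfolding D_def by linarith
    qed
  qed
  have LT1: "(LINT x|\<nu>. exp (- (of_real r * (z * of_real (q powr (1 / \<alpha>) * x))))) = exp (- (of_real (r powr \<alpha>) * (of_real q * z powr of_real \<alpha>)))"
    if "r > 0" "Re z > 0" "q \<ge> 0" for r q :: real and z
  proof (cases "q = 0")
    case True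
    then show ?thesis using N.prob_space by simp
  next
    case False
    define k where "k = r * q powr (1 / \<alpha>)"
    have k: "k > 0" using that False by (simp add: k_def)
    have ka: "k powr \<alpha> = r powr \<alpha> * q"
      using that \<alpha> by (simp add: k_def powr_mult powr_powr)
    have "(LINT x|\<nu>. exp (- (of_real r * (z * of_real (q powr (1 / \<alpha>) * x))))) = (LINT x|\<nu>. exp (- ((of_real k * z) * of_real x)))"
      by (simp add: k_def mult_ac)
    also have "\<dots> = exp (- ((of_real k * z) powr of_real \<alpha>))"
      using k that by (intro LT) simp
    finally show ?thesis using powr_scale_of_real[OF k, of z \<alpha>] ka by (simp add: mult.assoc)
  qed
  \<comment> \<open>Since both arguments share the real part \<open>c\<close>, the modulus sees
    \<open>A\<close> and \<open>B\<close> only through \<open>D\<close>.\<close>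
  have bnd: "norm (exp (- (of_real r * (z * of_real (A \<omega>) + w * of_real (B \<omega>))))) = exp (- (c * r * D \<omega>))"
    if "Re z = c" "Re w = c" for r c z w \<omega>
    using that by (simp add: norm_exp_eq_Re D_def algebra_simps)
  have int\<omega>: "integrable \<Omega> (\<lambda>\<omega>. exp (- (of_real r * (z * of_real (A \<omega>) + w * of_real (B \<omega>)))))"
    if "r > 0" "Re z > 0" "Re w = Re z" for r z w
  proof (rule O.integrable_const_bound[where B = 1])
    show "AE \<omega> in \<Omega>. norm (exp (- (of_real r * (z * of_real (A \<omega>) + w * of_real (B \<omega>))))) \<le> 1"
      using AE by eventually_elim (use that in \<open>subst bnd[of _ "Re z"], auto intro!: mult_nonneg_nonneg\<close>)
  qed measurable
  have LT2: "(LINT \<omega>|\<Omega>. exp (- (of_real r * (z * of_real (A \<omega>) + w * of_real (B \<omega>)))))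
      = exp (- (of_real (r powr \<alpha>) * (of_real p * w powr of_real \<alpha> + of_real (1 - p) * z powr of_real \<alpha>)))"
    if rzw: "r > 0" "Re z > 0" "Re w = Re z" for r z w
  proof -
    let ?a = "\<lambda>x. exp (- (of_real r * (z * of_real ((1 - p) powr (1 / \<alpha>) * x))))"
    let ?b = "\<lambda>y. exp (- (of_real r * (w * of_real (p powr (1 / \<alpha>) * y))))"
    have eq: "exp (- (of_real r * (z * of_real (A (x, y)) + w * of_real (B (x, y))))) = ?a x * ?b y" for x y
      by (simp add: A_def B_def algebra_simps flip: exp_add)
    have "(LINT \<omega>|\<Omega>. exp (- (of_real r * (z * of_real (A \<omega>) + w * of_real (B \<omega>))))) =
       (LINT x|\<nu>. LINT y|\<nu>. ?a x * ?b y)"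
      using NN.integral_fst'[OF int\<omega>[OF rzw, unfolded \<Omega>_def]] unfolding \<Omega>_def eq by simp
    also have "\<dots> = (LINT x|\<nu>. ?a x) * (LINT y|\<nu>. ?b y)" by simp
    also have "\<dots> = exp (- (of_real (r powr \<alpha>) * (of_real p * w powr of_real \<alpha> + of_real (1 - p) * z powr of_real \<alpha>)))"
      using rzw p by (subst (1 2) LT1) (auto simp: algebra_simps simp flip: exp_add)
    finally show ?thesis .
  qed
  define g where "g z w = (\<lambda>(r, \<omega>). indicator {0<..} r *\<^sub>R (complex_of_real (\<alpha> * r powr (\<alpha> - 1)) *
      exp (- (of_real r * (z * of_real (A \<omega>) + w * of_real (B \<omega>))))))" for z w
  have gm [measurable]: "g z w \<in> borel_measurable (lborel \<Otimes>\<^sub>M \<Omega>)" for z w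
    unfolding g_def by measurable
  have gi: "integrable (lborel \<Otimes>\<^sub>M \<Omega>) (g z w)" if zw: "Re z > 0" "Re w = Re z" for z w
  proof (rule LO.Fubini_integrable[OF gm])
    define c where "c = Re z"
    have c: "c > 0" using zw by (simp add: c_def)
    show "AE r in lborel. integrable \<Omega> (\<lambda>\<omega>. g z w (r, \<omega>))"
    proof (rule AE_I2)
      fix r :: real
      show "integrable \<Omega> (\<lambda>\<omega>. g z w (r, \<omega>))"
        using int\<omega>[OF _ zw, of r] by (cases "r > 0") (auto simp: g_def)
    qed
    \<comment> \<open>The absolute integral is the same formula at the real point z = w = c, so
      \<open>LT2\<close> itself evaluates it.\<close>
    have eq: "(LINT \<omega>|\<Omega>. norm (g z w (r, \<omega>))) =
      norm (indicator {0<..} r *\<^sub>R (complex_of_real (\<alpha> * r powr (\<alpha> - 1)) * exp (- (of_real (r powr \<alpha>) * of_real (c powr \<alpha>)))))" for r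
    proof (cases "r > 0")
      case True
      have "complex_of_real (LINT \<omega>|\<Omega>. exp (- (c * r * D \<omega>))) =
         (LINT \<omega>|\<Omega>. exp (- (of_real r * (of_real c * of_real (A \<omega>) + of_real c * of_real (B \<omega>)))))"
        unfolding integral_complex_of_real[symmetric]
        by (intro Bochner_Integration.integral_cong) (auto simp: D_def algebra_simps simp flip: exp_of_real)
      also have "\<dots> = exp (- (of_real (r powr \<alpha>) * (of_real p * of_real c powr of_real \<alpha> + of_real (1 - p) * of_real c powr of_real \<alpha>)))"
        using True c by (subst LT2) auto
      also have "of_real p * of_real c powr of_real \<alpha> + of_real (1 - p) * of_real c powr of_real \<alpha> = complex_of_real (c powr \<alpha>)"
        using powr_of_real[of c \<alpha>] c by (simp add: algebra_simps)
      also have "exp (- (of_real (r powr \<alpha>) * complex_of_real (c powr \<alpha>))) = of_real (exp (- (r powr \<alpha> * c powr \<alpha>)))"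
        by (simp flip: exp_of_real)
      finally have "(LINT \<omega>|\<Omega>. exp (- (c * r * D \<omega>))) = exp (- (r powr \<alpha> * c powr \<alpha>))"
        by (simp only: of_real_eq_iff)
      moreover have "norm (g z w (r, \<omega>)) = (\<alpha> * r powr (\<alpha> - 1)) * exp (- (c * r * D \<omega>))" for \<omega>
        using True \<alpha> bnd[of z c w r \<omega>] zw by (simp add: g_def norm_mult c_def)
      ultimately show ?thesis using True \<alpha> by (simp add: norm_mult norm_exp_eq_Re)
    qed (simp add: g_def)
    have "set_integrable lborel {0<..} (\<lambda>r. complex_of_real (\<alpha> * r powr (\<alpha> - 1)) * exp (- (of_real (r powr \<alpha>) * of_real (c powr \<alpha>))))"
      using \<alpha> c by (intro integral_powr_exp_powr) auto
    then show "integrable lborel (\<lambda>r. LINT \<omega>|\<Omega>. norm (g z w (r, \<omega>)))"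
      unfolding eq set_integrable_def by (rule integrable_norm)
  qed
  \<comment> \<open>With r = t / D the damping e^(-st) is free of randomness, because A + B = D.
    What remains random is the velocity, from A - B = D X, and the weight that r^(\<alpha>-1) dr
    leaves behind.\<close>
  have substitution: "(LINT r|lborel. g (s + \<i> * \<xi>) (s - \<i> * \<xi>) (r, \<omega>)) =
      (\<alpha> * D \<omega> powr (- \<alpha>)) *\<^sub>R (LINT t|lborel. indicator {0<..} t *\<^sub>R (of_real (t powr (\<alpha> - 1)) * exp (- (s * of_real t)) * cis (- (\<xi> * (t * X \<omega>)))))"
    if D: "D \<omega> > 0" for s \<xi> \<omega>
  proof -
    have AX: "D \<omega> * X \<omega> = A \<omega> - B \<omega>" using D by (simp add: X_def)
    have "(LINT r|lborel. g (s + \<i> * \<xi>) (s - \<i> * \<xi>) (r, \<omega>)) = (1 / D \<omega>) *\<^sub>R (LINT t|lborel. g (s + \<i> * \<xi>) (s - \<i> * \<xi>) (t / D \<omega>, \<omega>))"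
      using D by (subst lborel_integral_real_affine[of "1 / D \<omega>" _ 0]) auto
    also have "\<dots> = (LINT t|lborel. (\<alpha> * D \<omega> powr (- \<alpha>)) *\<^sub>R (indicator {0<..} t *\<^sub>R (of_real (t powr (\<alpha> - 1)) * exp (- (s * of_real t)) * cis (- (\<xi> * (t * X \<omega>))))))"
      unfolding integral_scaleR_right[symmetric]
    proof (rule Bochner_Integration.integral_cong[OF refl])
      fix t
      show "(1 / D \<omega>) *\<^sub>R g (s + \<i> * \<xi>) (s - \<i> * \<xi>) (t / D \<omega>, \<omega>) =
        (\<alpha> * D \<omega> powr (- \<alpha>)) *\<^sub>R (indicator {0<..} t *\<^sub>R (of_real (t powr (\<alpha> - 1)) * exp (- (s * of_real t)) * cis (- (\<xi> * (t * X \<omega>)))))"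
      proof (cases "t > 0")
        case True
        have 1: "complex_of_real (t / D \<omega>) * ((s + \<i> * \<xi>) * of_real (A \<omega>) + (s - \<i> * \<xi>) * of_real (B \<omega>)) = s * t + \<i> * of_real (\<xi> * (t * X \<omega>))"
        proof -
          have AXc: "complex_of_real (D \<omega>) * of_real (X \<omega>) = of_real (A \<omega>) - of_real (B \<omega>)"
            using AX by (simp flip: of_real_mult of_real_diff)
          have "(s + \<i> * \<xi>) * of_real (A \<omega>) + (s - \<i> * \<xi>) * of_real (B \<omega>) = s * of_real (A \<omega> + B \<omega>) + \<i> * \<xi> * (of_real (A \<omega>) - of_real (B \<omega>))"
            by (simp add: algebra_simps)
          also have "\<dots> = of_real (D \<omega>) * (s + \<i> * \<xi> * of_real (X \<omega>))"
            unfolding D_def[symmetric] AXc[symmetric] by (simp add: algebra_simps)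
          finally have "(s + \<i> * \<xi>) * of_real (A \<omega>) + (s - \<i> * \<xi>) * of_real (B \<omega>) = of_real (D \<omega>) * (s + \<i> * \<xi> * of_real (X \<omega>))" .
          then show ?thesis using D by (simp add: field_simps)
        qed
        have 2: "(1 / D \<omega>) * (\<alpha> * (t / D \<omega>) powr (\<alpha> - 1)) = (\<alpha> * D \<omega> powr (- \<alpha>)) * t powr (\<alpha> - 1)"
        proof -
          have "(t / D \<omega>) powr (\<alpha> - 1) = t powr (\<alpha> - 1) * D \<omega> powr (1 - \<alpha>)"
          proof -
            have "D \<omega> powr (1 - \<alpha>) = inverse (D \<omega> powr (\<alpha> - 1))"
              using powr_minus[of "D \<omega>" "\<alpha> - 1"] by simp
            moreover have "(t / D \<omega>) powr (\<alpha> - 1) = t powr (\<alpha> - 1) / D \<omega> powr (\<alpha> - 1)"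
              using True D by (simp add: powr_divide)
            ultimately show ?thesis by (metis divide_inverse)
          qed
          moreover have "(1 / D \<omega>) * D \<omega> powr (1 - \<alpha>) = D \<omega> powr (- \<alpha>)"
            using D by (simp add: powr_diff powr_minus divide_simps)
          moreover have "(1 / D \<omega>) * (\<alpha> * (t powr (\<alpha> - 1) * D \<omega> powr (1 - \<alpha>))) = \<alpha> * ((1 / D \<omega>) * D \<omega> powr (1 - \<alpha>)) * t powr (\<alpha> - 1)"
            by (simp only: mult_ac)
          ultimately show ?thesis by presburger
        qed
        have "(1 / D \<omega>) *\<^sub>R g (s + \<i> * \<xi>) (s - \<i> * \<xi>) (t / D \<omega>, \<omega>) =
           complex_of_real ((1 / D \<omega>) * (\<alpha> * (t / D \<omega>) powr (\<alpha> - 1))) * exp (- (s * t + \<i> * of_real (\<xi> * (t * X \<omega>))))"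
          using True D unfolding 1[symmetric] by (simp add: g_def scaleR_conv_of_real mult_ac)
        also have "exp (- (s * t + \<i> * of_real (\<xi> * (t * X \<omega>)))) = exp (- (s * t)) * cis (- (\<xi> * (t * X \<omega>)))"
          by (simp add: cis_conv_exp flip: exp_add)
        finally show ?thesis unfolding 2 using True by (simp add: scaleR_conv_of_real mult_ac)
      qed (use D in \<open>auto simp: g_def zero_less_divide_iff\<close>)
    qed
    finally show ?thesis unfolding integral_scaleR_right .
  qed
  define q where "q \<omega> = \<alpha> * D \<omega> powr (- \<alpha>)" for \<omega>
  have [measurable]: "q \<in> borel_measurable (borel \<Otimes>\<^sub>M borel)" unfolding q_def by measurable
  have q0: "q \<omega> \<ge> 0" for \<omega> using \<alpha> by (simp add: q_def)
  \<comment> \<open>Finiteness of this negative moment of \<open>D\<close> is read off from Fubini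
    at s = 1, \<xi> = 0, where the inner integral is
    \<open>q \<omega> * Gamma \<alpha>\<close>.\<close>
  have qi: "integrable \<Omega> q"
  proof -
    have "integrable \<Omega> (\<lambda>\<omega>. LINT r|lborel. g 1 1 (r, \<omega>))"
      using gi[of 1 1] by (intro LO.integrable_snd) (auto simp: case_prod_beta)
    moreover have "AE \<omega> in \<Omega>. (LINT r|lborel. g 1 1 (r, \<omega>)) = complex_of_real (q \<omega> * Gamma \<alpha>)"
      using AE
    proof eventually_elim
      case (elim \<omega>)
      have "(LINT t|lborel. indicator {0<..} t *\<^sub>R (complex_of_real (t powr (\<alpha> - 1)) * exp (- (1 * of_real t)) * cis (- (0 * (t * X \<omega>))))) =
         (LINT t|lborel. complex_of_real (indicator {0<..} t * (t powr (\<alpha> - 1) * exp (- t))))"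
        by (intro Bochner_Integration.integral_cong) (auto simp: indicator_def simp flip: exp_of_real)
      also have "\<dots> = of_real (Gamma \<alpha>)"
        unfolding integral_complex_of_real using Gamma_integral_lborel(2)[of \<alpha>] \<alpha> by simp
      finally show ?case using substitution[of \<omega> 1 0] elim by (simp add: q_def scaleR_conv_of_real)
    qed
    ultimately have "integrable \<Omega> (\<lambda>\<omega>. complex_of_real (q \<omega> * Gamma \<alpha>))"
      by (subst (asm) integrable_cong_AE) (auto)
    then have "integrable \<Omega> (\<lambda>\<omega>. q \<omega> * Gamma \<alpha>)"
      using integrable_Re by fastforce
    moreover have "Gamma \<alpha> > 0" using \<alpha> by (intro Gamma_real_pos) auto
    ultimately show ?thesis by simp
  qed
  define \<mu> where "\<mu> = distr (density \<Omega> q) borel X"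
  have int\<mu>: "(LINT x|\<mu>. h x) = (LINT \<omega>|\<Omega>. q \<omega> *\<^sub>R h (X \<omega>))" if [measurable]: "h \<in> borel_measurable borel" for h :: "real \<Rightarrow> complex"
    unfolding \<mu>_def using q0 by (subst integral_distr) (auto intro!: integral_density)
  show ?thesis
  proof (rule that)
    have "emeasure (density \<Omega> q) (space (density \<Omega> q)) \<noteq> \<infinity>"
    proof -
      have "(\<integral>\<^sup>+\<omega>. ennreal (q \<omega>) \<partial>\<Omega>) = ennreal (LINT \<omega>|\<Omega>. q \<omega>)"
        using qi q0 by (intro nn_integral_eq_integral) auto
      then show ?thesis by (simp add: emeasure_density)
    qed
    then interpret Q: finite_measure "density \<Omega> q" by (intro finite_measureI) auto
    show "finite_measure \<mu>" unfolding \<mu>_def by (intro Q.finite_measure_distr) auto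
    show "sets \<mu> = sets borel" by (simp add: \<mu>_def)
    have "AE \<omega> in \<Omega>. \<bar>X \<omega>\<bar> \<le> 1"
      using AE by eventually_elim (auto simp: X_def D_def abs_if divide_simps)
    then show "AE x in \<mu>. \<bar>x\<bar> \<le> 1"
      unfolding \<mu>_def by (subst AE_distr_iff) (auto simp: AE_density)
    fix \<xi> :: real and s :: complex assume s: "Re s > 0"
    let ?e = "\<lambda>t x. indicator {0<..} t *\<^sub>R (complex_of_real (t powr (\<alpha> - 1)) * exp (- (s * of_real t)) * cis (- (\<xi> * (t * x))))"
    have hi: "integrable (lborel \<Otimes>\<^sub>M \<Omega>) (\<lambda>(t, \<omega>). q \<omega> *\<^sub>R ?e t (X \<omega>))"
    proof (rule Bochner_Integration.integrable_bound)
      show "integrable (lborel \<Otimes>\<^sub>M \<Omega>) (\<lambda>(t, \<omega>). (indicator {0<..} t * (t powr (\<alpha> - 1) * exp (- (Re s * t)))) * q \<omega>)"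
        using \<alpha> s by (intro LO.integrable_mult_prod integrable_powr_exp qi) auto
      show "AE x in lborel \<Otimes>\<^sub>M \<Omega>. norm (case x of (t, \<omega>) \<Rightarrow> q \<omega> *\<^sub>R ?e t (X \<omega>)) \<le>
         norm (case x of (t, \<omega>) \<Rightarrow> (indicator {0<..} t * (t powr (\<alpha> - 1) * exp (- (Re s * t)))) * q \<omega>)"
        using q0 by (intro AE_I2) (auto simp: norm_mult norm_exp_eq_Re indicator_def)
    qed measurable
    have "(LINT t:{0<..}|lborel. exp (- (s * of_real t)) * kernel_transform \<alpha> \<mu> \<xi> t) = (LINT t|lborel. LINT \<omega>|\<Omega>. q \<omega> *\<^sub>R ?e t (X \<omega>))"
      unfolding set_lebesgue_integral_def
    proof (rule Bochner_Integration.integral_cong[OF refl])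
      fix t :: real
      have "indicator {0<..} t *\<^sub>R (exp (- (s * of_real t)) * kernel_transform \<alpha> \<mu> \<xi> t) = (LINT x|\<mu>. ?e t x)"
        unfolding kernel_transform_def integral_scaleR_right integral_mult_right_zero by (simp add: mult_ac)
      also have "\<dots> = (LINT \<omega>|\<Omega>. q \<omega> *\<^sub>R ?e t (X \<omega>))" by (rule int\<mu>) measurable
      finally show "indicator {0<..} t *\<^sub>R (exp (- (s * of_real t)) * kernel_transform \<alpha> \<mu> \<xi> t) = (LINT \<omega>|\<Omega>. q \<omega> *\<^sub>R ?e t (X \<omega>))" .
    qed
    also have "\<dots> = (LINT \<omega>|\<Omega>. LINT t|lborel. q \<omega> *\<^sub>R ?e t (X \<omega>))"
      by (rule LO.Fubini_integral[OF hi, symmetric])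
    also have "\<dots> = (LINT \<omega>|\<Omega>. LINT r|lborel. g (s + \<i> * \<xi>) (s - \<i> * \<xi>) (r, \<omega>))"
    proof (rule integral_cong_AE)
      show "AE \<omega> in \<Omega>. (LINT t|lborel. q \<omega> *\<^sub>R ?e t (X \<omega>)) = (LINT r|lborel. g (s + \<i> * \<xi>) (s - \<i> * \<xi>) (r, \<omega>))"
        using AE
      proof eventually_elim
        case (elim \<omega>)
        then have "D \<omega> > 0" by simp
        from substitution[OF this, of s \<xi>] show ?case
          unfolding q_def[symmetric] by (simp only: integral_scaleR_right)
      qed
    qed measurable
    also have "\<dots> = (LINT r|lborel. LINT \<omega>|\<Omega>. g (s + \<i> * \<xi>) (s - \<i> * \<xi>) (r, \<omega>))"
      using gi[of "s + \<i> * \<xi>" "s - \<i> * \<xi>"] s by (intro LO.Fubini_integral) (auto simp: case_prod_beta)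
    also have "\<dots> = (LINT r:{0<..}|lborel. of_real (\<alpha> * r powr (\<alpha> - 1)) * exp (- (of_real (r powr \<alpha>) * symbol \<alpha> p \<xi> s)))"
      unfolding set_lebesgue_integral_def
    proof (rule Bochner_Integration.integral_cong[OF refl])
      fix r :: real
      show "(LINT \<omega>|\<Omega>. g (s + \<i> * \<xi>) (s - \<i> * \<xi>) (r, \<omega>)) =
        indicator {0<..} r *\<^sub>R (of_real (\<alpha> * r powr (\<alpha> - 1)) * exp (- (of_real (r powr \<alpha>) * symbol \<alpha> p \<xi> s)))"
        using s LT2[of r "s + \<i> * \<xi>" "s - \<i> * \<xi>"] by (cases "r > 0") (auto simp: g_def symbol_def)
    qed
    also have "\<dots> = 1 / symbol \<alpha> p \<xi> s"
      using \<alpha> Re_symbol_pos[OF \<alpha> p s] by (intro integral_powr_exp_powr) auto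
    finally show "(LINT t:{0<..}|lborel. exp (- (s * of_real t)) * kernel_transform \<alpha> \<mu> \<xi> t) = 1 / symbol \<alpha> p \<xi> s" .
  qed
qed

section \<open>Inversion formulas for the kernel\<close>

text \<open>\<open>laplace\<close> is the only link between the measure and the equation; from here
  on the stable variables do not reappear.\<close>

locale transport_kernel =
  fixes \<alpha> p :: real and \<mu> :: "real measure"
  assumes \<alpha>: "0 < \<alpha>" "\<alpha> < 1" and p: "0 \<le> p" "p \<le> 1"
    and fin: "finite_measure \<mu>" and sets_\<mu>: "sets \<mu> = sets borel" and bounded: "AE x in \<mu>. \<bar>x\<bar> \<le> 1"
    and laplace: "\<And>\<xi> s. Re s > 0 \<Longrightarrow>
       (LINT t:{0<..}|lborel. exp (- (s * of_real t)) * kernel_transform \<alpha> \<mu> \<xi> t) = 1 / symbol \<alpha> p \<xi> s"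
begin

sublocale finite_measure \<mu> by (rule fin)

declare sets_\<mu> [measurable_cong, simp]

abbreviation kt :: "real \<Rightarrow> real \<Rightarrow> complex" where "kt \<equiv> kernel_transform \<alpha> \<mu>"

definition mchar :: "real \<Rightarrow> complex" where "mchar y = (LINT x|\<mu>. cis (- (y * x)))"

definition mass :: real where "mass = measure \<mu> UNIV"

lemma space_\<mu> [simp]: "space \<mu> = UNIV"
  using sets_eq_imp_space_eq[OF sets_\<mu>] by simp

lemma mass_nonneg: "mass \<ge> 0" by (simp add: mass_def)

lemma integrable_cis_\<mu>: "integrable \<mu> (\<lambda>x. cis (f x))" if [measurable]: "f \<in> borel_measurable borel"
  by (rule integrable_const_bound[where B = 1]) auto

lemma kt_eq: "kt \<xi> t = of_real (t powr (\<alpha> - 1)) * mchar (\<xi> * t)"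
  by (simp add: kernel_transform_def mchar_def mult.assoc)

lemma mchar_measurable [measurable]: "mchar \<in> borel_measurable borel"
  unfolding mchar_def[abs_def] by measurable

lemma norm_mchar_le: "norm (mchar y) \<le> mass"
proof -
  have "norm (mchar y) \<le> (LINT x|\<mu>. norm (cis (- (y * x))))"
    unfolding mchar_def by (rule integral_norm_bound)
  then show ?thesis by (simp add: mass_def)
qed

lemma norm_cis_diff_le: "norm (cis a - cis b) \<le> \<bar>a - b\<bar>"
proof -
  have "norm (cis a - cis b) = norm (cis b * (cis (a - b) - 1))"
    by (simp add: algebra_simps cis_mult)
  also have "\<dots> = norm (iexp (a - b) - (\<Sum>k\<le>0. (\<i> * (a - b)) ^ k / fact k))"
    by (simp add: norm_mult cis_conv_exp)
  also have "\<dots> \<le> \<bar>a - b\<bar> ^ Suc 0 / fact (Suc 0)"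
    by (rule iexp_approx1)
  finally show ?thesis by simp
qed

text \<open>The character is 1-Lipschitz and velocities are bounded by 1 almost everywhere.\<close>

lemma mchar_lipschitz: "norm (mchar y - mchar z) \<le> mass * \<bar>y - z\<bar>"
proof -
  have "mchar y - mchar z = (LINT x|\<mu>. cis (- (y * x)) - cis (- (z * x)))"
    unfolding mchar_def by (intro Bochner_Integration.integral_diff[symmetric] integrable_cis_\<mu>) auto
  also have "norm \<dots> \<le> (LINT x|\<mu>. norm (cis (- (y * x)) - cis (- (z * x))))"
    by (rule integral_norm_bound)
  also have "\<dots> \<le> (LINT x|\<mu>. \<bar>y - z\<bar>)"
  proof (rule integral_mono_AE)
    show "integrable \<mu> (\<lambda>x. norm (cis (- (y * x)) - cis (- (z * x))))"
      by (intro integrable_norm Bochner_Integration.integrable_diff integrable_cis_\<mu>) auto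
    show "AE x in \<mu>. norm (cis (- (y * x)) - cis (- (z * x))) \<le> \<bar>y - z\<bar>"
      using bounded
    proof eventually_elim
      case (elim x)
      have "norm (cis (- (y * x)) - cis (- (z * x))) \<le> \<bar>- (y * x) - - (z * x)\<bar>"
        by (rule norm_cis_diff_le)
      also have "\<dots> = \<bar>y - z\<bar> * \<bar>x\<bar>" by (simp add: abs_mult[symmetric] algebra_simps)
      also have "\<dots> \<le> \<bar>y - z\<bar> * 1" using elim by (intro mult_left_mono) auto
      finally show ?case by simp
    qed
  qed simp
  also have "\<dots> = mass * \<bar>y - z\<bar>" by (simp add: mass_def)
  finally show ?thesis .
qed

definition damped :: "real \<Rightarrow> real \<Rightarrow> real \<Rightarrow> complex" where
  "damped c \<xi> t = indicator {0<..} t *\<^sub>R (of_real (exp (- (c * t))) * kt \<xi> t)"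

lemma damped_integrable:
  assumes c: "c > 0"
  shows "integrable lborel (damped c \<xi>)"
proof (rule Bochner_Integration.integrable_bound)
  show "integrable lborel (\<lambda>t. (indicator {0<..} t * (t powr (\<alpha> - 1) * exp (- (c * t)))) * mass)"
    using \<alpha> c by (intro integrable_mult_left integrable_powr_exp) auto
  show "damped c \<xi> \<in> borel_measurable lborel"
    unfolding damped_def[abs_def] kt_eq by measurable
  show "AE t in lborel. norm (damped c \<xi> t) \<le> norm ((indicator {0<..} t * (t powr (\<alpha> - 1) * exp (- (c * t)))) * mass)"
  proof (rule AE_I2)
    fix t
    have "t powr (\<alpha> - 1) * exp (- (c * t)) * norm (mchar (\<xi> * t)) \<le> t powr (\<alpha> - 1) * exp (- (c * t)) * mass"
      by (intro mult_left_mono norm_mchar_le) auto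
    then show "norm (damped c \<xi> t) \<le> norm ((indicator {0<..} t * (t powr (\<alpha> - 1) * exp (- (c * t)))) * mass)"
      using mass_nonneg by (auto simp: damped_def kt_eq norm_mult indicator_def mult_ac)
  qed
qed

lemma cfourier_damped:
  assumes c: "c > 0"
  shows "cfourier (damped c \<xi>) \<eta> = 1 / symbol \<alpha> p \<xi> (Complex c \<eta>)"
proof -
  have "cfourier (damped c \<xi>) \<eta> = (LINT t:{0<..}|lborel. exp (- (Complex c \<eta> * of_real t)) * kt \<xi> t)"
    unfolding cfourier_def set_lebesgue_integral_def
  proof (rule Bochner_Integration.integral_cong[OF refl])
    fix t
    show "cis (- (\<eta> * t)) * damped c \<xi> t = indicator {0<..} t *\<^sub>R (exp (- (Complex c \<eta> * of_real t)) * kt \<xi> t)"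
      unfolding exp_Complex_mult by (simp add: damped_def mult_ac)
  qed
  also have "\<dots> = 1 / symbol \<alpha> p \<xi> (Complex c \<eta>)"
    using c by (intro laplace) simp
  finally show ?thesis .
qed

text \<open>The power of \<open>t\<close> is singular only at 0; near a positive time the function
  is a differentiable factor times a Lipschitz one.\<close>

lemma damped_lipschitz_at:
  assumes t: "t > 0"
  shows "\<exists>d>0. \<exists>B. \<forall>y. \<bar>y - t\<bar> < d \<longrightarrow> norm (damped c \<xi> y - damped c \<xi> t) \<le> B * \<bar>y - t\<bar>"
proof -
  define F where "F y = exp (- (c * y)) * y powr (\<alpha> - 1)" for y
  have "(F has_real_derivative (exp (- (c * t)) * ((\<alpha> - 1) * t powr (\<alpha> - 1 - 1)) - c * exp (- (c * t)) * t powr (\<alpha> - 1))) (at t)"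
    unfolding F_def using t by (auto intro!: derivative_eq_intros)
  then obtain D where D: "((\<lambda>y. (F y - F t) / (y - t)) \<longlongrightarrow> D) (at t)"
    by (auto simp: has_field_derivative_iff)
  have "eventually (\<lambda>y. dist ((F y - F t) / (y - t)) D < 1) (at t)"
    using D by (intro tendstoD) auto
  then obtain d where d: "d > 0" "\<And>y. y \<noteq> t \<Longrightarrow> dist y t < d \<Longrightarrow> dist ((F y - F t) / (y - t)) D < 1"
    by (auto simp: eventually_at)
  define K where "K = \<bar>D\<bar> + 1"
  have K: "K \<ge> 0" by (simp add: K_def)
  have FL: "\<bar>F y - F t\<bar> \<le> K * \<bar>y - t\<bar>" if "\<bar>y - t\<bar> < d" for y
  proof (cases "y = t")
    case False
    have "dist ((F y - F t) / (y - t)) D < 1" using d(2)[OF False] that by (simp add: dist_real_def)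
    then have "\<bar>(F y - F t) / (y - t)\<bar> \<le> K" unfolding K_def dist_real_def by linarith
    then show ?thesis using False by (simp add: abs_divide pos_divide_le_eq)
  qed simp
  \<comment> \<open>The minimum with \<open>t\<close> keeps \<open>y\<close> positive, away from the
    cut-off at 0; \<open>B\<close> collects the constants of the product estimate.\<close>
  define e where "e = min d t"
  define B where "B = (\<bar>F t\<bar> + K * e) * (mass * \<bar>\<xi>\<bar>) + K * mass"
  have e: "e > 0" using d t by (simp add: e_def)
  have "norm (damped c \<xi> y - damped c \<xi> t) \<le> B * \<bar>y - t\<bar>" if y: "\<bar>y - t\<bar> < e" for y
  proof -
    have yd: "\<bar>y - t\<bar> < d" and y0: "y > 0" using y by (auto simp: e_def)
    have eq: "damped c \<xi> x = of_real (F x) * mchar (\<xi> * x)" if "x > 0" for x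
      using that by (simp add: damped_def F_def kt_eq)
    have "damped c \<xi> y - damped c \<xi> t = of_real (F y) * (mchar (\<xi> * y) - mchar (\<xi> * t)) + of_real (F y - F t) * mchar (\<xi> * t)"
      unfolding eq[OF y0] eq[OF t] by (simp add: algebra_simps)
    also have "norm \<dots> \<le> \<bar>F y\<bar> * norm (mchar (\<xi> * y) - mchar (\<xi> * t)) + \<bar>F y - F t\<bar> * norm (mchar (\<xi> * t))"
      by (rule order_trans[OF norm_triangle_ineq]) (simp add: norm_mult flip: of_real_diff)
    also have "\<dots> \<le> (\<bar>F t\<bar> + K * e) * (mass * (\<bar>\<xi>\<bar> * \<bar>y - t\<bar>)) + (K * \<bar>y - t\<bar>) * mass"
    proof (intro add_mono mult_mono)
      have "\<bar>F y\<bar> \<le> \<bar>F t\<bar> + \<bar>F y - F t\<bar>" by linarith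
      moreover have "K * \<bar>y - t\<bar> \<le> K * e" using K y by (intro mult_left_mono) auto
      ultimately show "\<bar>F y\<bar> \<le> \<bar>F t\<bar> + K * e" using FL[OF yd] by linarith
      show "norm (mchar (\<xi> * y) - mchar (\<xi> * t)) \<le> mass * (\<bar>\<xi>\<bar> * \<bar>y - t\<bar>)"
        using mchar_lipschitz[of "\<xi> * y" "\<xi> * t"] by (simp add: abs_mult flip: right_diff_distrib)
    qed (use K e FL[OF yd] norm_mchar_le mass_nonneg in auto)
    also have "\<dots> = B * \<bar>y - t\<bar>" by (simp add: B_def algebra_simps)
    finally show ?thesis .
  qed
  then show ?thesis using e by blast
qed

text \<open>The integrand decays only like |Im s|^(-\<alpha>), so absolute convergence fails;
  inversion holds as a limit of symmetric truncations, thanks to the Lipschitz condition at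
  \<open>t\<close>.\<close>

lemma has_inverse_laplace_kt:
  assumes t: "t > 0"
  shows "has_inverse_laplace 0 (\<lambda>s. 1 / symbol \<alpha> p \<xi> s) t (kt \<xi> t)"
  unfolding has_inverse_laplace_def
proof (intro allI impI)
  fix c :: real assume c: "0 < c"
  let ?I = "\<lambda>R. LINT \<eta>:{-R..R}|lborel. cis (\<eta> * t) * cfourier (damped c \<xi>) \<eta>"
  obtain d B where d: "d > 0" and B: "\<And>y. \<bar>y - t\<bar> < d \<Longrightarrow> norm (damped c \<xi> y - damped c \<xi> t) \<le> B * \<bar>y - t\<bar>"
    using damped_lipschitz_at[OF t] by blast
  have "(?I \<longlongrightarrow> 2 * pi * damped c \<xi> t) at_top"
    by (rule Fourier_inversion_at[OF damped_integrable[OF c] d B])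
  then have "((\<lambda>R. of_real (exp (c * t)) * ?I R / (2 * pi)) \<longlongrightarrow> of_real (exp (c * t)) * (2 * pi * damped c \<xi> t) / (2 * pi)) at_top"
    by (intro tendsto_intros) auto
  also have "of_real (exp (c * t)) * (2 * pi * damped c \<xi> t) / (2 * pi) = kt \<xi> t"
  proof -
    have "complex_of_real (exp (c * t)) * of_real (exp (- (c * t))) = 1"
      by (simp flip: of_real_mult exp_add)
    then show ?thesis using t by (simp add: damped_def mult.assoc[symmetric])
  qed
  finally have lim: "((\<lambda>R. of_real (exp (c * t)) * ?I R / (2 * pi)) \<longlongrightarrow> kt \<xi> t) at_top" .
  show "((\<lambda>R. contour_integral (linepath (Complex c (- R)) (Complex c R))
        (\<lambda>s. exp (s * complex_of_real t) * (1 / symbol \<alpha> p \<xi> s)) / (2 * of_real pi * \<i>)) \<longlongrightarrow> kt \<xi> t) at_top"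
  proof (rule Lim_transform_eventually[OF lim])
    show "eventually (\<lambda>R. of_real (exp (c * t)) * ?I R / (2 * pi) = contour_integral (linepath (Complex c (- R)) (Complex c R))
        (\<lambda>s. exp (s * complex_of_real t) * (1 / symbol \<alpha> p \<xi> s)) / (2 * of_real pi * \<i>)) at_top"
      using eventually_gt_at_top[of 0]
    proof eventually_elim
      case (elim R)
      have "contour_integral (linepath (Complex c (- R)) (Complex c R)) (\<lambda>s. exp (s * complex_of_real t) * (1 / symbol \<alpha> p \<xi> s))
         = \<i> * integral {-R..R} (\<lambda>x. exp (Complex c x * complex_of_real t) * (1 / symbol \<alpha> p \<xi> (Complex c x)))"
        using elim by (intro contour_integral_linepath_same_Re) auto
      also have "(\<lambda>x. exp (Complex c x * complex_of_real t) * (1 / symbol \<alpha> p \<xi> (Complex c x))) =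
          (\<lambda>x. of_real (exp (c * t)) * (cis (x * t) * cfourier (damped c \<xi>) x))"
      proof
        fix x
        have "exp (Complex c x * complex_of_real t) = of_real (exp (c * t)) * cis (x * t)"
          unfolding cis_conv_exp exp_of_real[symmetric] exp_add[symmetric]
          by (rule arg_cong[where f = exp]) (auto simp: complex_eq_iff)
        then show "exp (Complex c x * complex_of_real t) * (1 / symbol \<alpha> p \<xi> (Complex c x)) = of_real (exp (c * t)) * (cis (x * t) * cfourier (damped c \<xi>) x)"
          by (simp add: cfourier_damped[OF c])
      qed
      also have "integral {-R..R} (\<lambda>x. of_real (exp (c * t)) * (cis (x * t) * cfourier (damped c \<xi>) x)) = of_real (exp (c * t)) * ?I R"
      proof -
        have "set_integrable lborel {-R..R} (\<lambda>x. cis (x * t) * cfourier (damped c \<xi>) x)"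
          by (intro borel_integrable_atLeastAtMost' continuous_intros
              continuous_on_subset[OF continuous_cfourier[OF damped_integrable[OF c]]]) auto
        then have "integral {-R..R} (\<lambda>x. cis (x * t) * cfourier (damped c \<xi>) x) = ?I R"
          by (simp add: set_borel_integral_eq_integral)
        then show ?thesis by simp
      qed
      finally show ?case by (simp add: field_simps)
    qed
  qed
qed

definition G :: "real \<Rightarrow> real measure" where
  "G t = density (distr \<mu> borel (\<lambda>x. t * x)) (\<lambda>_. ennreal (t powr (\<alpha> - 1)))"

lemma sets_G [simp, measurable_cong]: "sets (G t) = sets borel"
  by (simp add: G_def)

lemma finite_measure_G: "finite_measure (G t)"
proof (rule finite_measureI)
  interpret D: finite_measure "distr \<mu> borel (\<lambda>x. t * x)" by (rule finite_measure_distr) simp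
  have "emeasure (G t) (space (G t)) = ennreal (t powr (\<alpha> - 1)) * emeasure (distr \<mu> borel (\<lambda>x. t * x)) UNIV"
    unfolding G_def by (subst emeasure_density) auto
  then show "emeasure (G t) (space (G t)) \<noteq> \<infinity>"
    by (simp add: ennreal_mult_eq_top_iff)
qed

lemma integral_G:
  fixes h :: "real \<Rightarrow> 'b::{banach, second_countable_topology}"
  assumes [measurable]: "h \<in> borel_measurable borel"
  shows "(LINT z|G t. h z) = t powr (\<alpha> - 1) *\<^sub>R (LINT x|\<mu>. h (t * x))"
  unfolding G_def by (subst integral_density) (auto simp: integral_distr)

text \<open>Fubini moves the frequency integral onto the test function, where inversion is known.
  The inner integral has the sign opposite to \<open>fourier\<close>, hence the reflections of the
  frequency.\<close>

lemma has_inverse_fourier_kt: "has_inverse_fourier (\<lambda>\<xi>. kt \<xi> t) (G t)"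
  unfolding has_inverse_fourier_def
proof (intro conjI allI impI)
  fix \<psi> assume \<psi>: "test_function \<psi>"
  interpret LM: pair_sigma_finite lborel \<mu> ..
  have [measurable]: "\<psi> \<in> borel_measurable borel" by (rule test_function_measurable[OF \<psi>])
  have f\<psi> [measurable]: "fourier \<psi> \<in> borel_measurable borel"
    using borel_measurable_integrable[OF integrable_fourier_test_function[OF \<psi>]] by simp
  have ktm [measurable]: "(\<lambda>\<xi>. kt \<xi> t) \<in> borel_measurable borel" unfolding kt_eq by measurable
  have eq: "(LINT x|lborel. cis (\<xi> * x) * complex_of_real (\<psi> x)) = fourier \<psi> (- \<xi>)" for \<xi>
    by (simp add: fourier_def)
  have bnd: "norm (kt \<xi> t) \<le> t powr (\<alpha> - 1) * mass" for \<xi>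
    unfolding kt_eq norm_mult using norm_mchar_le by (auto intro!: mult_left_mono)
  have i: "integrable lborel (\<lambda>\<eta>. kt (- \<eta>) t * fourier \<psi> \<eta>)"
  proof (rule integrable_mult_fourier_test_function[OF \<psi>])
    show "norm (kt (- \<xi>) t) \<le> (t powr (\<alpha> - 1) * mass) * (1 + \<xi>\<^sup>2)" for \<xi>
    proof -
      have "(t powr (\<alpha> - 1) * mass) * 1 \<le> (t powr (\<alpha> - 1) * mass) * (1 + \<xi>\<^sup>2)"
        using mass_nonneg by (intro mult_left_mono) auto
      then show ?thesis using bnd[of "- \<xi>"] by linarith
    qed
  qed measurable
  have "integrable lborel (\<lambda>\<xi>. kt (- (0 + (- 1) * \<xi>)) t * fourier \<psi> (0 + (- 1) * \<xi>))"
    by (rule lborel_integrable_real_affine[OF i]) simp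
  then show "integrable lborel (\<lambda>\<xi>. kt \<xi> t * (LINT x|lborel. cis (\<xi> * x) * complex_of_real (\<psi> x)))"
    unfolding eq by simp
  have "(LINT \<xi>|lborel. kt \<xi> t * (LINT x|lborel. cis (\<xi> * x) * complex_of_real (\<psi> x))) = (LINT \<eta>|lborel. kt (- \<eta>) t * fourier \<psi> \<eta>)"
    unfolding eq by (subst lborel_integral_real_affine[of "-1" _ 0]) auto
  also have "\<dots> = (LINT \<eta>|lborel. LINT x|\<mu>. of_real (t powr (\<alpha> - 1)) * (cis (\<eta> * (t * x)) * fourier \<psi> \<eta>))"
    by (intro Bochner_Integration.integral_cong refl)
       (simp add: kernel_transform_def mult_ac flip: integral_mult_right_zero integral_mult_left_zero)
  also have "\<dots> = (LINT x|\<mu>. LINT \<eta>|lborel. of_real (t powr (\<alpha> - 1)) * (cis (\<eta> * (t * x)) * fourier \<psi> \<eta>))"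
  proof (rule LM.Fubini_integral[symmetric])
    have "integrable (lborel \<Otimes>\<^sub>M \<mu>) (\<lambda>(\<eta>, x). (of_real (t powr (\<alpha> - 1)) * fourier \<psi> \<eta>) * 1)"
      by (intro LM.integrable_mult_prod integrable_mult_right integrable_fourier_test_function \<psi>) auto
    then show "integrable (lborel \<Otimes>\<^sub>M \<mu>) (\<lambda>(\<eta>, x). of_real (t powr (\<alpha> - 1)) * (cis (\<eta> * (t * x)) * fourier \<psi> \<eta>))"
      by (rule Bochner_Integration.integrable_bound) (auto simp: norm_mult)
  qed
  also have "\<dots> = (LINT x|\<mu>. of_real (t powr (\<alpha> - 1)) * (of_real (2 * pi * \<psi> (t * x))))"
    by (simp add: test_function_inversion[OF \<psi>])
  also have "\<dots> = of_real (2 * pi * (LINT z|G t. \<psi> z))"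
    by (simp add: integral_G flip: of_real_mult)
  finally show "complex_of_real (LINT x|G t. \<psi> x) = (LINT \<xi>|lborel. kt \<xi> t * (LINT x|lborel. cis (\<xi> * x) * complex_of_real (\<psi> x))) / (2 * of_real pi)"
    by simp
qed (simp_all add: finite_measure_G)

lemma is_kernel_G: "is_kernel \<alpha> p G"
  unfolding is_kernel_def
proof (intro allI impI)
  fix t :: real assume "t > 0"
  then show "\<exists>v. (\<forall>\<xi>. has_inverse_laplace 0 (\<lambda>s. 1 / symbol \<alpha> p \<xi> s) t (v \<xi>)) \<and> has_inverse_fourier v (G t)"
    by (intro exI[of _ "\<lambda>\<xi>. kt \<xi> t"] conjI allI has_inverse_laplace_kt has_inverse_fourier_kt)
qed

end

subsection \<open>The representation formula\<close>

text \<open>One-dimensional uniqueness is applied in time for each \<xi> and then in space. The null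
  set of times depends on \<xi>, so only rational \<xi> are kept, and continuity of the transform
  restores the others.\<close>

lemma cfourier2_eq_0_imp_AE_0:
  fixes H :: "real \<Rightarrow> real \<Rightarrow> complex"
  assumes H: "integrable (lborel \<Otimes>\<^sub>M lborel) (\<lambda>(x, t). H x t)"
    and 0: "\<And>\<xi> \<eta>. (LINT (x, t)|(lborel \<Otimes>\<^sub>M lborel). cis (- (\<xi> * x + \<eta> * t)) * H x t) = 0"
  shows "AE (x, t) in lborel \<Otimes>\<^sub>M lborel. H x t = 0"
proof -
  have [measurable]: "(\<lambda>(x, t). H x t) \<in> borel_measurable (lborel \<Otimes>\<^sub>M lborel)"
    using H by auto
  have Hx: "AE t in lborel. integrable lborel (\<lambda>x. H x t)"
    using lborel_pair.AE_integrable_snd[of "\<lambda>x t. H x t"] H by simp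
  have ht: "AE t in lborel. cfourier (\<lambda>x. H x t) \<xi> = 0" for \<xi>
  proof (rule cfourier_eq_0_imp_AE_0)
    have i: "integrable (lborel \<Otimes>\<^sub>M lborel) (\<lambda>(x, t). cis (- (\<xi> * x)) * H x t)"
      using integrable_cis_mult[OF H, of "\<lambda>(x, t). - (\<xi> * x)"] by (simp add: case_prod_unfold)
    then show "integrable lborel (\<lambda>t. cfourier (\<lambda>x. H x t) \<xi>)"
      unfolding cfourier_def using lborel_pair.integrable_snd[OF i] by simp
    fix \<eta>
    have i2: "integrable (lborel \<Otimes>\<^sub>M lborel) (\<lambda>(x, t). cis (- (\<xi> * x + \<eta> * t)) * H x t)"
      using integrable_cis_mult[OF H, of "\<lambda>(x, t). - (\<xi> * x + \<eta> * t)"] by (simp add: case_prod_unfold)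
    have "cfourier (\<lambda>t. cfourier (\<lambda>x. H x t) \<xi>) \<eta> = (LINT t|lborel. LINT x|lborel. cis (- (\<xi> * x + \<eta> * t)) * H x t)"
      unfolding cfourier_def integral_mult_right_zero[symmetric]
      by (intro Bochner_Integration.integral_cong refl) (simp add: cis_mult algebra_simps flip: mult.assoc)
    also have "\<dots> = (LINT (x, t)|(lborel \<Otimes>\<^sub>M lborel). cis (- (\<xi> * x + \<eta> * t)) * H x t)"
      using lborel_pair.integral_snd[OF i2] by simp
    finally show "cfourier (\<lambda>t. cfourier (\<lambda>x. H x t) \<xi>) \<eta> = 0" unfolding 0 .
  qed
  have "AE t in lborel. \<forall>q\<in>\<rat>. cfourier (\<lambda>x. H x t) q = 0"
    by (intro AE_ball_countable' countable_rat ht)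
  with Hx have "AE t in lborel. AE x in lborel. H x t = 0"
  proof eventually_elim
    case (elim t)
    show ?case
    proof (rule cfourier_eq_0_imp_AE_0[OF elim(1)])
      have cl: "closed {\<xi>. cfourier (\<lambda>x. H x t) \<xi> = 0}"
        using continuous_cfourier[OF elim(1)] by (intro closed_Collect_eq continuous_intros)
      have "closure \<rat> \<subseteq> {\<xi>. cfourier (\<lambda>x. H x t) \<xi> = 0}"
        using elim(2) by (intro closure_minimal cl) auto
      then show "cfourier (\<lambda>x. H x t) \<xi> = 0" for \<xi>
        unfolding Rats_closure_real by auto
    qed
  qed
  moreover have Hm [measurable]: "(\<lambda>z. H (fst z) (snd z)) \<in> borel_measurable (lborel \<Otimes>\<^sub>M lborel)"
    using borel_measurable_integrable[OF H] unfolding case_prod_unfold .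
  have Hs: "{z \<in> space (lborel \<Otimes>\<^sub>M lborel). H (fst z) (snd z) = 0} \<in> sets (lborel \<Otimes>\<^sub>M lborel)"
    by measurable
  ultimately have "AE x in lborel. AE t in lborel. H x t = 0"
    by (subst lborel_pair.AE_commute)
  then show ?thesis
    by (intro lborel_pair.AE_pair_measure) (use Hs in \<open>simp_all add: case_prod_unfold\<close>)
qed

text \<open>Extension by 0 to negative times, together with damping, turns the Fourier--Laplace
  transform on Re s = c into a Fourier transform in the plane.\<close>

definition damp :: "real \<Rightarrow> (real \<Rightarrow> real \<Rightarrow> real) \<Rightarrow> real \<Rightarrow> real \<Rightarrow> real" where
  "damp c v x t = indicator {0<..} t * (exp (- (c * t)) * v x t)"

lemma fl_transformable_damp:
  assumes v: "fl_transformable \<sigma> v" and c: "c \<ge> \<sigma>"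
  shows "integrable (lborel \<Otimes>\<^sub>M lborel) (\<lambda>(x, t). damp c v x t)"
proof -
  have i: "integrable (lborel \<Otimes>\<^sub>M lborel) (\<lambda>z. indicator (UNIV \<times> {0<..}) z *\<^sub>R (case z of (x, t) \<Rightarrow> exp (- \<sigma> * t) * v x t))"
    using v unfolding fl_transformable_def set_integrable_def .
  have m: "(\<lambda>z. indicator (UNIV \<times> {0<..}) z *\<^sub>R (case z of (x, t) \<Rightarrow> exp (- \<sigma> * t) * v x t)) \<in> borel_measurable (lborel \<Otimes>\<^sub>M lborel)"
    using i by (rule borel_measurable_integrable)
  have eq: "damp c v x t = exp (- ((c - \<sigma>) * t)) * (indicator (UNIV \<times> {0<..}) (x, t) *\<^sub>R (case (x, t) of (x, t) \<Rightarrow> exp (- \<sigma> * t) * v x t))" for x t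
    by (auto simp: damp_def indicator_def algebra_simps simp flip: exp_add)
  show ?thesis
  proof (rule Bochner_Integration.integrable_bound[OF i])
    have "(\<lambda>z. exp (- ((c - \<sigma>) * snd z)) * (indicator (UNIV \<times> {0<..}) z *\<^sub>R (case z of (x, t) \<Rightarrow> exp (- \<sigma> * t) * v x t))) \<in> borel_measurable (lborel \<Otimes>\<^sub>M lborel)"
      by (intro borel_measurable_times m) measurable
    then show "(\<lambda>(x, t). damp c v x t) \<in> borel_measurable (lborel \<Otimes>\<^sub>M lborel)"
      by (rule measurable_cong[THEN iffD1, rotated]) (auto simp: eq)
    show "AE z in lborel \<Otimes>\<^sub>M lborel. norm (case z of (x, t) \<Rightarrow> damp c v x t) \<le>
        norm (indicator (UNIV \<times> {0<..}) z *\<^sub>R (case z of (x, t) \<Rightarrow> exp (- \<sigma> * t) * v x t))"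
    proof (rule AE_I2)
      fix z :: "real \<times> real"
      obtain x t where z: "z = (x, t)" by (cases z)
      show "norm (case z of (x, t) \<Rightarrow> damp c v x t) \<le>
        norm (indicator (UNIV \<times> {0<..}) z *\<^sub>R (case z of (x, t) \<Rightarrow> exp (- \<sigma> * t) * v x t))"
      proof (cases "t > 0")
        case True
        have "exp (- ((c - \<sigma>) * t)) \<le> 1" using True c by simp
        then show ?thesis unfolding z prod.case eq by (simp add: abs_mult mult_left_le_one_le)
      qed (simp add: z damp_def)
    qed
  qed
qed

lemma fourier_laplace_damp:
  assumes v: "integrable (lborel \<Otimes>\<^sub>M lborel) (\<lambda>(x, t). damp c v x t)"
  shows "(LINT (x, t)|(lborel \<Otimes>\<^sub>M lborel). cis (- (\<xi> * x + \<eta> * t)) * of_real (damp c v x t)) = fourier_laplace v \<xi> (Complex c \<eta>)"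
proof -
  have "integrable (lborel \<Otimes>\<^sub>M lborel) (\<lambda>z. complex_of_real (case z of (x, t) \<Rightarrow> damp c v x t))"
    using v by (rule integrable_of_real)
  from integrable_cis_mult[OF this, of "\<lambda>(x, t). - (\<xi> * x + \<eta> * t)"]
  have i: "integrable (lborel \<Otimes>\<^sub>M lborel) (\<lambda>(x, t). cis (- (\<xi> * x + \<eta> * t)) * complex_of_real (damp c v x t))"
    by (simp add: case_prod_unfold)
  have "(LINT (x, t)|(lborel \<Otimes>\<^sub>M lborel). cis (- (\<xi> * x + \<eta> * t)) * of_real (damp c v x t)) =
    (LINT t|lborel. LINT x|lborel. cis (- (\<xi> * x + \<eta> * t)) * complex_of_real (damp c v x t))"
    using lborel_pair.integral_snd[OF i] by simp
  also have "\<dots> = fourier_laplace v \<xi> (Complex c \<eta>)"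
    unfolding fourier_laplace_def set_lebesgue_integral_def
  proof (rule Bochner_Integration.integral_cong[OF refl])
    fix t :: real
    have "(LINT x|lborel. cis (- (\<xi> * x + \<eta> * t)) * complex_of_real (damp c v x t)) =
       (LINT x|lborel. (indicator {0<..} t *\<^sub>R exp (- (Complex c \<eta> * of_real t))) * (cis (- (\<xi> * x)) * complex_of_real (v x t)))"
    proof (rule Bochner_Integration.integral_cong[OF refl])
      fix x
      have "cis (- (\<xi> * x + \<eta> * t)) = cis (- (\<eta> * t)) * cis (- (\<xi> * x))"
        by (simp add: cis_mult algebra_simps)
      then show "cis (- (\<xi> * x + \<eta> * t)) * complex_of_real (damp c v x t) =
        (indicator {0<..} t *\<^sub>R exp (- (Complex c \<eta> * of_real t))) * (cis (- (\<xi> * x)) * complex_of_real (v x t))"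
        unfolding exp_Complex_mult by (simp add: damp_def indicator_def mult_ac)
    qed
    also have "\<dots> = indicator {0<..} t *\<^sub>R (exp (- (Complex c \<eta> * of_real t)) * fourier (\<lambda>x. v x t) \<xi>)"
      unfolding integral_mult_right_zero fourier_def by simp
    finally show "(LINT x|lborel. cis (- (\<xi> * x + \<eta> * t)) * complex_of_real (damp c v x t)) =
      indicator {0<..} t *\<^sub>R (exp (- (Complex c \<eta> * of_real t)) * fourier (\<lambda>x. v x t) \<xi>)" .
  qed
  finally show ?thesis .
qed

lemma lborel_integral_translate:
  fixes h :: "'a::euclidean_space \<Rightarrow> 'b::{banach, second_countable_topology}"
  assumes [measurable]: "h \<in> borel_measurable borel"
  shows "(LINT X|lborel. h (X - b)) = (LINT X|lborel. h X)"
  using integral_distr[of "(+) (- b)" lborel borel h] lborel_distr_plus[of "- b"] by simp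

text \<open>The convolution theorem in a form suited to a kernel that is only a measure: averaging
  translates over \<open>N\<close> multiplies the transform by that of the law of \<open>a\<close>,
  because translation multiplies it by a character.\<close>

lemma
  fixes F :: "real \<times> real \<Rightarrow> real" and N :: "'w measure" and a :: "'w \<Rightarrow> real \<times> real"
  assumes F: "integrable lborel F" and N: "finite_measure N" and a [measurable]: "a \<in> borel_measurable N"
  shows integrable_translate_prod: "integrable (lborel \<Otimes>\<^sub>M N) (\<lambda>(X, \<omega>). F (X - a \<omega>))"
    and integral_cis_translate_prod:
      "(LINT X|lborel. cis (\<xi> * fst X + \<eta> * snd X) * of_real (LINT \<omega>|N. F (X - a \<omega>))) =
       (LINT X|lborel. cis (\<xi> * fst X + \<eta> * snd X) * of_real (F X)) * (LINT \<omega>|N. cis (\<xi> * fst (a \<omega>) + \<eta> * snd (a \<omega>)))"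
proof -
  interpret N: finite_measure N by (rule N)
  interpret LN: pair_sigma_finite "lborel :: (real \<times> real) measure" N ..
  interpret NL: pair_sigma_finite N "lborel :: (real \<times> real) measure" ..
  have Fm [measurable]: "F \<in> borel_measurable borel" using F by auto
  note shift = lborel_integral_translate
  have shifti: "integrable lborel (\<lambda>X. F (X - b))" for b
    using integrable_distr_eq[of "(+) (- b)" lborel borel F] F lborel_distr_plus[of "- b"] by simp
  have "integrable (N \<Otimes>\<^sub>M lborel) (\<lambda>(\<omega>, X). F (X - a \<omega>))"
  proof (rule NL.Fubini_integrable)
    have "(LINT X|lborel. norm (F (X - a \<omega>))) = (LINT X|lborel. norm (F X))" for \<omega>
      by (rule shift[where h = "\<lambda>X. norm (F X)"]) measurable
    then show "integrable N (\<lambda>\<omega>. LINT X|lborel. norm (case (\<omega>, X) of (\<omega>, X) \<Rightarrow> F (X - a \<omega>)))" by simp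
  qed (auto intro: shifti)
  from NL.integrable_product_swap[OF this]
  show i: "integrable (lborel \<Otimes>\<^sub>M N) (\<lambda>(X, \<omega>). F (X - a \<omega>))" by simp
  let ?c = "\<lambda>X. cis (\<xi> * fst X + \<eta> * snd X)"
  have "integrable (lborel \<Otimes>\<^sub>M N) (\<lambda>z. complex_of_real (case z of (X, \<omega>) \<Rightarrow> F (X - a \<omega>)))"
    using i by (rule integrable_of_real)
  moreover have "(\<lambda>z. \<xi> * fst (fst z) + \<eta> * snd (fst z)) \<in> borel_measurable (lborel \<Otimes>\<^sub>M N)"
  proof (rule measurable_compose[OF measurable_fst])
    show "(\<lambda>X. \<xi> * fst X + \<eta> * snd X) \<in> lborel \<rightarrow>\<^sub>M borel"
      by (simp, intro borel_measurable_continuous_onI continuous_intros)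
  qed
  ultimately have "integrable (lborel \<Otimes>\<^sub>M N) (\<lambda>z. ?c (fst z) * complex_of_real (case z of (X, \<omega>) \<Rightarrow> F (X - a \<omega>)))"
    by (rule integrable_cis_mult)
  then
  have ic: "integrable (lborel \<Otimes>\<^sub>M N) (\<lambda>(X, \<omega>). ?c X * complex_of_real (F (X - a \<omega>)))"
    by (simp add: case_prod_unfold)
  have "(LINT X|lborel. ?c X * of_real (LINT \<omega>|N. F (X - a \<omega>))) = (LINT X|lborel. LINT \<omega>|N. ?c X * of_real (F (X - a \<omega>)))"
    by simp
  also have "\<dots> = (LINT \<omega>|N. LINT X|lborel. ?c X * of_real (F (X - a \<omega>)))"
    by (rule LN.Fubini_integral[OF ic, symmetric])
  also have "\<dots> = (LINT \<omega>|N. (LINT X|lborel. ?c X * of_real (F X)) * ?c (a \<omega>))"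
  proof (rule Bochner_Integration.integral_cong[OF refl])
    fix \<omega>
    have "(LINT X|lborel. ?c X * of_real (F (X - a \<omega>))) = (LINT X|lborel. (\<lambda>Y. ?c (Y + a \<omega>) * of_real (F Y)) (X - a \<omega>))"
      by simp
    also have "\<dots> = (LINT Y|lborel. ?c (Y + a \<omega>) * of_real (F Y))"
    proof (rule shift)
      have "(\<lambda>Y. ?c (Y + a \<omega>)) \<in> borel_measurable borel"
        by (intro borel_measurable_continuous_onI continuous_intros)
      from borel_measurable_times[OF this measurable_compose[OF Fm borel_measurable_of_real]]
      show "(\<lambda>Y. ?c (Y + a \<omega>) * complex_of_real (F Y)) \<in> borel_measurable borel" .
    qed
    also have "\<dots> = (LINT Y|lborel. (?c Y * of_real (F Y)) * ?c (a \<omega>))"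
    proof (rule Bochner_Integration.integral_cong[OF refl])
      fix Y :: "real \<times> real"
      have "?c (Y + a \<omega>) = ?c Y * ?c (a \<omega>)" by (simp add: cis_mult algebra_simps)
      then show "?c (Y + a \<omega>) * complex_of_real (F Y) = (?c Y * of_real (F Y)) * ?c (a \<omega>)" by simp
    qed
    also have "\<dots> = (LINT Y|lborel. ?c Y * of_real (F Y)) * ?c (a \<omega>)"
      by (rule integral_mult_left_zero)
    finally show "(LINT X|lborel. ?c X * of_real (F (X - a \<omega>))) = (LINT Y|lborel. ?c Y * of_real (F Y)) * ?c (a \<omega>)" .
  qed
  also have "\<dots> = (LINT X|lborel. ?c X * of_real (F X)) * (LINT \<omega>|N. ?c (a \<omega>))"
    by (rule integral_mult_right_zero)
  finally show "(LINT X|lborel. ?c X * of_real (LINT \<omega>|N. F (X - a \<omega>))) =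
       (LINT X|lborel. ?c X * of_real (F X)) * (LINT \<omega>|N. ?c (a \<omega>))" .
qed

section \<open>The damped kernel as a space-time measure\<close>

context transport_kernel
begin

text \<open>Pairs of a delay r and a velocity y. The image under \<open>shift\<close> is the
  space-time measure e^(-cr) G_r(dx) dr, the damped kernel; keeping the pairs makes it a plain
  product measure.\<close>

definition N :: "real \<Rightarrow> (real \<times> real) measure" where
  "N c = density lborel (\<lambda>r. ennreal (indicator {0<..} r * (r powr (\<alpha> - 1) * exp (- (c * r))))) \<Otimes>\<^sub>M \<mu>"

lemma finite_measure_radial:
  assumes c: "c > 0"
  shows "finite_measure (density lborel (\<lambda>r. ennreal (indicator {0<..} r * (r powr (\<alpha> - 1) * exp (- (c * r))))))"
proof (rule finite_measureI)
  have "(\<integral>\<^sup>+r. ennreal (indicator {0<..} r * (r powr (\<alpha> - 1) * exp (- (c * r)))) \<partial>lborel) =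
     ennreal (LINT r|lborel. indicator {0<..} r * (r powr (\<alpha> - 1) * exp (- (c * r))))"
    using \<alpha> c by (intro nn_integral_eq_integral integrable_powr_exp) auto
  then show "emeasure (density lborel (\<lambda>r. ennreal (indicator {0<..} r * (r powr (\<alpha> - 1) * exp (- (c * r))))))
     (space (density lborel (\<lambda>r. ennreal (indicator {0<..} r * (r powr (\<alpha> - 1) * exp (- (c * r))))))) \<noteq> \<infinity>"
    by (simp add: emeasure_density)
qed

lemma sets_N [measurable_cong]: "sets (N c) = sets (borel \<Otimes>\<^sub>M borel)"
  unfolding N_def by (intro sets_pair_measure_cong) auto

lemma finite_measure_N:
  assumes c: "c > 0" shows "finite_measure (N c)"
  unfolding N_def by (intro finite_measure_pair_measure finite_measure_radial c fin)

lemma integral_N: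
  fixes h :: "real \<times> real \<Rightarrow> 'b::{banach, second_countable_topology}"
  assumes c: "c > 0" and h: "integrable (N c) h"
  shows "(LINT \<omega>|N c. h \<omega>) = (LINT r|lborel. (indicator {0<..} r * (r powr (\<alpha> - 1) * exp (- (c * r)))) *\<^sub>R (LINT y|\<mu>. h (r, y)))"
proof -
  let ?R = "density lborel (\<lambda>r. ennreal (indicator {0<..} r * (r powr (\<alpha> - 1) * exp (- (c * r)))))"
  interpret R: finite_measure ?R by (rule finite_measure_radial[OF c])
  interpret RM: pair_sigma_finite ?R \<mu> ..
  have [measurable]: "h \<in> borel_measurable (borel \<Otimes>\<^sub>M borel)"
    using borel_measurable_integrable[OF h] measurable_cong_sets[OF sets_N refl] by blast
  have "(LINT \<omega>|N c. h \<omega>) = (LINT r|?R. LINT y|\<mu>. h (r, y))"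
    using RM.integral_fst'[of h] h unfolding N_def by simp
  also have "\<dots> = (LINT r|lborel. (indicator {0<..} r * (r powr (\<alpha> - 1) * exp (- (c * r)))) *\<^sub>R (LINT y|\<mu>. h (r, y)))"
    by (rule integral_density) auto
  finally show ?thesis .
qed

definition shift :: "real \<times> real \<Rightarrow> real \<times> real" where "shift \<omega> = (fst \<omega> * snd \<omega>, fst \<omega>)"

lemma measurable_shift: "shift \<in> borel_measurable (N c)"
proof -
  have "shift \<in> borel_measurable borel"
    unfolding shift_def[abs_def] by (intro borel_measurable_continuous_onI continuous_intros)
  moreover have "sets (N c) = sets borel" unfolding sets_N borel_prod ..
  ultimately show ?thesis using measurable_cong_sets[OF _ refl] by blast
qed

lemma integral_cis_shift:
  assumes c: "c > 0"
  shows "(LINT \<omega>|N c. cis (- \<xi> * fst (shift \<omega>) + - \<eta> * snd (shift \<omega>))) = 1 / symbol \<alpha> p \<xi> (Complex c \<eta>)"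
proof -
  interpret Nc: finite_measure "N c" by (rule finite_measure_N[OF c])
  have i: "integrable (N c) (\<lambda>\<omega>. cis (- \<xi> * fst (shift \<omega>) + - \<eta> * snd (shift \<omega>)))"
    by (rule Nc.integrable_const_bound[where B = 1]) (auto simp: shift_def)
  have "(LINT \<omega>|N c. cis (- \<xi> * fst (shift \<omega>) + - \<eta> * snd (shift \<omega>))) = cfourier (damped c \<xi>) \<eta>"
    unfolding integral_N[OF c i] cfourier_def
  proof (rule Bochner_Integration.integral_cong[OF refl])
    fix r :: real
    have "cis (- \<xi> * fst (shift (r, y)) + - \<eta> * snd (shift (r, y))) = cis (- (\<eta> * r)) * cis (- (\<xi> * (r * y)))" for y
      by (simp add: shift_def cis_mult algebra_simps)
    then have "(LINT y|\<mu>. cis (- \<xi> * fst (shift (r, y)) + - \<eta> * snd (shift (r, y)))) = cis (- (\<eta> * r)) * (LINT y|\<mu>. cis (- (\<xi> * (r * y))))"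
      by simp
    then show "(indicator {0<..} r * (r powr (\<alpha> - 1) * exp (- (c * r)))) *\<^sub>R (LINT y|\<mu>. cis (- \<xi> * fst (shift (r, y)) + - \<eta> * snd (shift (r, y)))) =
      cis (- (\<eta> * r)) * damped c \<xi> r"
      by (simp add: damped_def kernel_transform_def scaleR_conv_of_real mult_ac)
  qed
  then show ?thesis by (simp add: cfourier_damped[OF c])
qed

lemma measure_convolution_G:
  assumes "h \<in> borel_measurable borel"
  shows "measure_convolution (G r) h x = r powr (\<alpha> - 1) * (LINT y|\<mu>. h (x - r * y))"
  using assms unfolding measure_convolution_def by (subst integral_G) auto

text \<open>The delay becomes t - \<tau>. The two cut-offs at 0, one for the delay and one for the
  time argument of \<open>f\<close>, leave 0 < \<tau> < t, and the dampings combine to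
  e^(-ct).\<close>

lemma integral_translate_N:
  assumes c: "c > 0" and t: "t > 0"
    and f_meas: "\<And>\<tau>. \<tau> > 0 \<Longrightarrow> (\<lambda>x. f x \<tau>) \<in> borel_measurable borel"
    and i: "integrable (N c) (\<lambda>\<omega>. (\<lambda>(x, t). damp c f x t) ((x, t) - shift \<omega>))"
  shows "(LINT \<omega>|N c. (\<lambda>(x, t). damp c f x t) ((x, t) - shift \<omega>)) =
    exp (- (c * t)) * (LINT \<tau>:{0<..<t}|lborel. measure_convolution (G (t - \<tau>)) (\<lambda>y. f y \<tau>) x)"
proof -
  have "(LINT \<omega>|N c. (\<lambda>(x, t). damp c f x t) ((x, t) - shift \<omega>)) =
    (LINT r|lborel. (indicator {0<..} r * (r powr (\<alpha> - 1) * exp (- (c * r)))) * (LINT y|\<mu>. damp c f (x - r * y) (t - r)))"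
    unfolding integral_N[OF c i] by (simp add: shift_def)
  also have "\<dots> = (LINT \<tau>|lborel. (indicator {0<..} (t - \<tau>) * ((t - \<tau>) powr (\<alpha> - 1) * exp (- (c * (t - \<tau>))))) * (LINT y|\<mu>. damp c f (x - (t - \<tau>) * y) \<tau>))"
    by (subst lborel_integral_real_affine[of "-1" _ t]) auto
  also have "\<dots> = (LINT \<tau>|lborel. exp (- (c * t)) * (indicator {0<..<t} \<tau> *\<^sub>R measure_convolution (G (t - \<tau>)) (\<lambda>y. f y \<tau>) x))"
  proof (rule Bochner_Integration.integral_cong[OF refl])
    fix \<tau> :: real
    show "(indicator {0<..} (t - \<tau>) * ((t - \<tau>) powr (\<alpha> - 1) * exp (- (c * (t - \<tau>))))) * (LINT y|\<mu>. damp c f (x - (t - \<tau>) * y) \<tau>) =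
       exp (- (c * t)) * (indicator {0<..<t} \<tau> *\<^sub>R measure_convolution (G (t - \<tau>)) (\<lambda>y. f y \<tau>) x)"
    proof (cases "0 < \<tau> \<and> \<tau> < t")
      case True
      have "(LINT y|\<mu>. damp c f (x - (t - \<tau>) * y) \<tau>) = exp (- (c * \<tau>)) * (LINT y|\<mu>. f (x - (t - \<tau>) * y) \<tau>)"
        using True by (simp add: damp_def)
      moreover have "exp (- (c * (t - \<tau>))) * exp (- (c * \<tau>)) = exp (- (c * t))"
        by (simp add: algebra_simps flip: exp_add)
      moreover have "measure_convolution (G (t - \<tau>)) (\<lambda>y. f y \<tau>) x = (t - \<tau>) powr (\<alpha> - 1) * (LINT y|\<mu>. f (x - (t - \<tau>) * y) \<tau>)"
        using True f_meas by (intro measure_convolution_G) auto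
      ultimately show ?thesis using True by (simp add: mult_ac)
    next
      case False
      then show ?thesis by (auto simp: damp_def indicator_def)
    qed
  qed
  also have "\<dots> = exp (- (c * t)) * (LINT \<tau>:{0<..<t}|lborel. measure_convolution (G (t - \<tau>)) (\<lambda>y. f y \<tau>) x)"
    unfolding set_lebesgue_integral_def by simp
  finally show ?thesis .
qed

text \<open>Damped \<open>u\<close> and the average \<open>W\<close> of translates of damped
  \<open>f\<close> have the same Fourier transform in the plane, because dividing by the symbol is
  multiplying by the transform of the damped kernel.\<close>

theorem convolution_representation:
  assumes u: "fl_transformable \<sigma> u" and f: "fl_transformable \<sigma> f" and \<sigma>: "\<sigma> \<ge> 0"
    and f_meas: "\<And>\<tau>. \<tau> > 0 \<Longrightarrow> (\<lambda>x. f x \<tau>) \<in> borel_measurable borel"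
    and eq: "\<And>\<xi> s. Re s > \<sigma> \<Longrightarrow> symbol \<alpha> p \<xi> s * fourier_laplace u \<xi> s = fourier_laplace f \<xi> s"
  shows "AE (x, t) in lborel \<Otimes>\<^sub>M lborel. t > 0 \<longrightarrow>
     u x t = (LINT \<tau>:{0<..<t}|lborel. measure_convolution (G (t - \<tau>)) (\<lambda>y. f y \<tau>) x)"
proof -
  define c where "c = \<sigma> + 1"
  have c: "c > 0" "c > \<sigma>" using \<sigma> by (auto simp: c_def)
  define F where "F = (\<lambda>(x, t). damp c f x t)"
  have ui: "integrable (lborel \<Otimes>\<^sub>M lborel) (\<lambda>(x, t). damp c u x t)"
    by (rule fl_transformable_damp[OF u]) (use c in simp)
  have fi: "integrable (lborel \<Otimes>\<^sub>M lborel) (\<lambda>(x, t). damp c f x t)"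
    by (rule fl_transformable_damp[OF f]) (use c in simp)
  then have Fi: "integrable lborel F" unfolding F_def lborel_prod .
  note N = finite_measure_N[OF c(1)]
  interpret Nc: finite_measure "N c" by (rule N)
  interpret LN: pair_sigma_finite "lborel :: (real \<times> real) measure" "N c" ..
  note ip = integrable_translate_prod[OF Fi N measurable_shift]
  define W where "W X = (LINT \<omega>|N c. F (X - shift \<omega>))" for X
  have Wi: "integrable (lborel \<Otimes>\<^sub>M lborel) W"
    using LN.integrable_fst'[OF ip] unfolding W_def lborel_prod by simp
  define H where "H x t = complex_of_real (damp c u x t - W (x, t))" for x t
  have Hi: "integrable (lborel \<Otimes>\<^sub>M lborel) (\<lambda>(x, t). H x t)"
    using integrable_of_real[OF Bochner_Integration.integrable_diff[OF ui Wi]]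
    by (simp add: H_def case_prod_unfold del: of_real_diff)
  have "AE (x, t) in lborel \<Otimes>\<^sub>M lborel. H x t = 0"
  proof (rule cfourier2_eq_0_imp_AE_0[OF Hi])
    fix \<xi> \<eta>
    let ?c = "\<lambda>X. cis (- \<xi> * fst X + - \<eta> * snd X)"
    have c2: "cis (- (\<xi> * x + \<eta> * t)) = ?c (x, t)" for x t by simp
    have cm: "?c \<in> borel_measurable (lborel \<Otimes>\<^sub>M lborel)" by measurable
    have "(LINT (x, t)|(lborel \<Otimes>\<^sub>M lborel). cis (- (\<xi> * x + \<eta> * t)) * H x t) =
      (LINT X|(lborel \<Otimes>\<^sub>M lborel). ?c X * of_real (case X of (x, t) \<Rightarrow> damp c u x t) - ?c X * of_real (W X))"
      unfolding c2 by (intro Bochner_Integration.integral_cong refl) (auto simp: H_def right_diff_distrib)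
    also have "\<dots> = (LINT X|(lborel \<Otimes>\<^sub>M lborel). ?c X * of_real (case X of (x, t) \<Rightarrow> damp c u x t)) - (LINT X|(lborel \<Otimes>\<^sub>M lborel). ?c X * of_real (W X))"
      using ui Wi by (intro Bochner_Integration.integral_diff integrable_cis_mult integrable_of_real) measurable
    also have "(LINT X|(lborel \<Otimes>\<^sub>M lborel). ?c X * of_real (case X of (x, t) \<Rightarrow> damp c u x t)) = fourier_laplace u \<xi> (Complex c \<eta>)"
      unfolding fourier_laplace_damp[OF ui, symmetric] c2 by (intro Bochner_Integration.integral_cong refl) auto
    also have "(LINT X|(lborel \<Otimes>\<^sub>M lborel). ?c X * of_real (W X)) = (LINT X|lborel. ?c X * of_real (F X)) * (1 / symbol \<alpha> p \<xi> (Complex c \<eta>))"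
      unfolding W_def lborel_prod integral_cis_translate_prod[OF Fi N measurable_shift] integral_cis_shift[OF c(1)] ..
    also have "(LINT X|lborel. ?c X * of_real (F X)) = fourier_laplace f \<xi> (Complex c \<eta>)"
      unfolding fourier_laplace_damp[OF fi, symmetric] c2 lborel_prod F_def by (intro Bochner_Integration.integral_cong refl) auto
    also have "fourier_laplace u \<xi> (Complex c \<eta>) - fourier_laplace f \<xi> (Complex c \<eta>) * (1 / symbol \<alpha> p \<xi> (Complex c \<eta>)) = 0"
    proof -
      have "Re (symbol \<alpha> p \<xi> (Complex c \<eta>)) > 0" using c by (intro Re_symbol_pos \<alpha> p) simp
      then have "symbol \<alpha> p \<xi> (Complex c \<eta>) \<noteq> 0" by auto
      then show ?thesis using eq[of "Complex c \<eta>" \<xi>] c by (simp add: field_simps)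
    qed
    finally show "(LINT (x, t)|(lborel \<Otimes>\<^sub>M lborel). cis (- (\<xi> * x + \<eta> * t)) * H x t) = 0" .
  qed
  \<comment> \<open>Only where the translates are integrable can the Bochner integral be unfolded
    into an iterated one; Fubini provides this almost everywhere.\<close>
  moreover have "AE X in lborel \<Otimes>\<^sub>M lborel. integrable (N c) (\<lambda>\<omega>. F (X - shift \<omega>))"
    using LN.AE_integrable_fst'[OF ip] unfolding lborel_prod by simp
  ultimately show ?thesis
  proof eventually_elim
    case (elim X)
    obtain x t where X: "X = (x, t)" by (cases X)
    show ?case
      unfolding X prod.case
    proof
      assume t: "t > 0"
      have "damp c u x t = W (x, t)" using elim(1) by (simp add: X H_def)
      also have "\<dots> = exp (- (c * t)) * (LINT \<tau>:{0<..<t}|lborel. measure_convolution (G (t - \<tau>)) (\<lambda>y. f y \<tau>) x)"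
        unfolding W_def F_def
        by (rule integral_translate_N[OF c(1) t f_meas]) (use elim(2) in \<open>auto simp: X F_def\<close>)
      finally show "u x t = (LINT \<tau>:{0<..<t}|lborel. measure_convolution (G (t - \<tau>)) (\<lambda>y. f y \<tau>) x)"
        using t by (simp add: damp_def)
    qed
  qed
qed

end

subsection \<open>Vanishing of the initial datum\<close>

lemma continuous_integral_cis:
  fixes k :: "'a \<Rightarrow> complex"
  assumes k: "integrable M k" and [measurable]: "\<phi> \<in> borel_measurable M"
  shows "continuous_on UNIV (\<lambda>\<xi>. LINT x|M. cis (\<xi> * \<phi> x) * k x)"
proof -
  have [measurable]: "k \<in> borel_measurable M" using k by auto
  have "(\<lambda>n. LINT x|M. cis (X n * \<phi> x) * k x) \<longlonglongrightarrow> (LINT x|M. cis (\<xi> * \<phi> x) * k x)" if "X \<longlonglongrightarrow> \<xi>" for X \<xi>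
  proof (rule integral_dominated_convergence[where w = "\<lambda>x. norm (k x)"])
    show "AE x in M. (\<lambda>n. cis (X n * \<phi> x) * k x) \<longlonglongrightarrow> cis (\<xi> * \<phi> x) * k x"
      using that by (auto intro!: tendsto_intros)
  qed (use k in \<open>auto simp: norm_mult\<close>)
  then show ?thesis
    by (simp add: continuous_on_sequentially o_def)
qed

lemma AE_continuous_eq:
  fixes f g :: "real \<Rightarrow> 'a::real_normed_vector"
  assumes S: "open S" and f: "continuous_on S f" and g: "continuous_on S g"
    and AE: "AE t in lborel. t \<in> S \<longrightarrow> f t = g t" and t: "t \<in> S"
  shows "f t = g t"
proof (rule ccontr)
  assume "f t \<noteq> g t"
  have "continuous_on S (\<lambda>t. f t - g t)" by (intro continuous_intros f g)
  then have "open (S \<inter> (\<lambda>t. f t - g t) -` (- {0}))"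
    using S by (intro continuous_open_preimage) auto
  moreover have "t \<in> S \<inter> (\<lambda>t. f t - g t) -` (- {0})"
    using t \<open>f t \<noteq> g t\<close> by simp
  ultimately obtain e where e: "e > 0" "ball t e \<subseteq> S \<inter> (\<lambda>t. f t - g t) -` (- {0})"
    by (rule openE)
  from AE have "AE x in lborel. \<not> x \<in> ball t e"
    by eventually_elim (use e in auto)
  then have "emeasure lborel {x \<in> space lborel. x \<in> ball t e} = 0"
    by (rule emeasure_eq_0_AE)
  also have "{x \<in> space lborel. x \<in> ball t e} = {t - e<..<t + e}"
    by (auto simp: dist_real_def abs_less_iff)
  finally show False using e by (simp add: emeasure_lborel_Ioo)
qed

lemma norm_powr_le:
  fixes z :: complex
  assumes "0 < a" "a < 1"
  shows "norm (z powr of_real a) \<le> 1 + norm z"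
proof (cases "z = 0")
  case False
  then have "norm (z powr of_real a) = norm z powr a"
    by (simp add: powr_def norm_exp_eq_Re powr_def[of "norm z"])
  also have "\<dots> \<le> 1 + norm z"
  proof (cases "norm z \<le> 1")
    case True
    then have "norm z powr a \<le> 1" using assms by (intro powr_le1) auto
    then show ?thesis by (rule order_trans) simp
  next
    case False
    then have "norm z powr a \<le> norm z powr 1" using assms by (intro powr_mono) auto
    then show ?thesis using False by simp
  qed
  finally show ?thesis .
qed simp

text \<open>Crude on purpose: only polynomial growth in \<xi> matters against the decay of
  transforms of test functions.\<close>

lemma norm_symbol_le:
  assumes \<alpha>: "0 < \<alpha>" "\<alpha> < 1" and p: "0 \<le> p" "p \<le> 1" and c: "c \<ge> 0"
  shows "norm (symbol \<alpha> p \<xi> (of_real c)) \<le> 1 + c + \<bar>\<xi>\<bar>"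
proof -
  have n: "norm (of_real c + w) \<le> c + \<bar>\<xi>\<bar>" if "norm w = \<bar>\<xi>\<bar>" for w :: complex
    using norm_triangle_ineq[of "of_real c" w] that c by simp
  let ?A = "(complex_of_real c - \<i> * \<xi>) powr of_real \<alpha>" and ?B = "(complex_of_real c + \<i> * \<xi>) powr of_real \<alpha>"
  have "norm ?A \<le> 1 + (c + \<bar>\<xi>\<bar>)"
    using norm_powr_le[OF \<alpha>, of "complex_of_real c - \<i> * \<xi>"] n[of "- (\<i> * \<xi>)"] by (simp add: norm_mult)
  moreover have "norm ?B \<le> 1 + (c + \<bar>\<xi>\<bar>)"
    using norm_powr_le[OF \<alpha>, of "complex_of_real c + \<i> * \<xi>"] n[of "\<i> * \<xi>"] by (simp add: norm_mult)
  ultimately have "p * norm ?A + (1 - p) * norm ?B \<le> p * (1 + (c + \<bar>\<xi>\<bar>)) + (1 - p) * (1 + (c + \<bar>\<xi>\<bar>))"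
    using p by (intro add_mono mult_left_mono) auto
  moreover have "norm (symbol \<alpha> p \<xi> (of_real c)) \<le> p * norm ?A + (1 - p) * norm ?B"
  proof -
    have "norm (symbol \<alpha> p \<xi> (of_real c)) \<le> norm (of_real p * ?A) + norm (of_real (1 - p) * ?B)"
      unfolding symbol_def by (rule norm_triangle_ineq)
    then show ?thesis unfolding norm_mult norm_of_real using p by simp
  qed
  ultimately show ?thesis by (simp add: algebra_simps)
qed

lemma continuous_symbol:
  assumes \<alpha>: "0 < \<alpha>" and c: "c > 0"
  shows "continuous_on UNIV (\<lambda>\<xi>. symbol \<alpha> p \<xi> (of_real c))"
  unfolding symbol_def using assms
  by (intro continuous_on_add continuous_on_mult continuous_on_const continuous_on_powr_complex
      continuous_on_diff continuous_on_of_real continuous_on_id) auto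

text \<open>By homogeneity, pulling out c^\<alpha> leaves the symbol at s = 1 and frequency \<xi> /
  c, which tends to p + (1 - p).\<close>

lemma powr_div_symbol_tendsto:
  assumes \<alpha>: "0 < \<alpha>" "\<alpha> < 1" and c: "\<And>n. c n > 0" and lim: "filterlim c at_top sequentially"
  shows "(\<lambda>n. of_real (c n powr \<alpha>) / symbol \<alpha> p \<xi> (of_real (c n))) \<longlonglongrightarrow> 1"
proof -
  have ic: "(\<lambda>n. complex_of_real (\<xi> / c n)) \<longlonglongrightarrow> of_real 0"
    by (intro tendsto_of_real tendsto_divide_0[OF tendsto_const] filterlim_at_top_imp_at_infinity lim)
  define k where "k n = of_real p * (1 - \<i> * of_real (\<xi> / c n)) powr of_real \<alpha> + of_real (1 - p) * (1 + \<i> * of_real (\<xi> / c n)) powr complex_of_real \<alpha>" for n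
  have "k \<longlonglongrightarrow> of_real p * (1 - \<i> * of_real 0) powr of_real \<alpha> + of_real (1 - p) * (1 + \<i> * of_real 0) powr complex_of_real \<alpha>"
    unfolding k_def by (intro tendsto_intros ic) auto
  then have k: "k \<longlonglongrightarrow> 1" by (simp flip: of_real_add)
  have "of_real (c n powr \<alpha>) / symbol \<alpha> p \<xi> (of_real (c n)) = 1 / k n" for n
  proof -
    have "complex_of_real (c n) - \<i> * \<xi> = of_real (c n) * (1 - \<i> * of_real (\<xi> / c n))"
      and "complex_of_real (c n) + \<i> * \<xi> = of_real (c n) * (1 + \<i> * of_real (\<xi> / c n))"
      using c[of n] by (simp_all add: field_simps)
    then have "symbol \<alpha> p \<xi> (of_real (c n)) = of_real (c n powr \<alpha>) * k n"
      unfolding symbol_def k_def by (simp only: powr_scale_of_real[OF c]) (simp add: algebra_simps)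
    then show ?thesis using c[of n] by simp
  qed
  moreover have "(\<lambda>n. 1 / k n) \<longlonglongrightarrow> 1 / 1" by (intro tendsto_intros k) simp
  ultimately show ?thesis by simp
qed

text \<open>The limit at 0 bounds \<open>h\<close> by \<open>M\<close> near 0, which contributes at
  most M / c; the rest is exponentially small in c. The gain 1 / c beats c^\<alpha> because \<alpha>
  < 1.\<close>

lemma laplace_near_0_decay:
  fixes h :: "real \<Rightarrow> real"
  assumes \<alpha>: "0 < \<alpha>" "\<alpha> < 1" and c0: "c0 > 0"
    and h: "integrable lborel (\<lambda>t. indicator {0<..} t * (exp (- (c0 * t)) * h t))"
    and lim: "(h \<longlongrightarrow> l) (at_right 0)"
  shows "(\<lambda>n. (c0 + real n) powr \<alpha> * (LINT t|lborel. indicator {0<..} t * (exp (- ((c0 + real n) * t)) * h t))) \<longlonglongrightarrow> 0"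
proof -
  define M where "M = \<bar>l\<bar> + 1"
  have M: "M > 0" by (simp add: M_def)
  have "eventually (\<lambda>t. dist (h t) l < 1) (at_right 0)" using lim by (intro tendstoD) auto
  then obtain \<delta> where \<delta>: "\<delta> > 0" "\<And>t. 0 < t \<Longrightarrow> t < \<delta> \<Longrightarrow> \<bar>h t\<bar> \<le> M"
    unfolding eventually_at_right_field M_def dist_real_def by (smt (verit))
  define A where "A = (LINT t|lborel. \<bar>indicator {0<..} t * (exp (- (c0 * t)) * h t)\<bar>)"
  have ei: "einterval 0 \<infinity> = {0::real<..}" by (auto simp: einterval_def)
  have bound: "\<bar>LINT t|lborel. indicator {0<..} t * (exp (- (c * t)) * h t)\<bar> \<le> M / c + exp (- ((c - c0) * \<delta>)) * A"
    if c: "c \<ge> c0" for c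
  proof -
    have c_pos: "c > 0" using c c0 by simp
    have ie: "integrable lborel (\<lambda>t::real. indicator {0<..} t * exp (- (t * c)))"
      using integrable_I0i_exp_mscale[OF c_pos] by (simp add: set_integrable_def)
    have ie_eq: "(LINT t|lborel. indicator {0<..} t * exp (- (t * c))) = 1 / c"
      using LBINT_I0i_exp_mscale[OF c_pos] by (simp add: interval_lebesgue_integral_def set_lebesgue_integral_def ei)
    have "\<bar>LINT t|lborel. indicator {0<..} t * (exp (- (c * t)) * h t)\<bar> \<le> (LINT t|lborel. \<bar>indicator {0<..} t * (exp (- (c * t)) * h t)\<bar>)"
      by (rule integral_abs_bound)
    \<comment> \<open>The first summand covers t < \<delta>; the second covers t \<ge> \<delta>,
      where a factor \<open>exp (- ((c - c0) * \<delta>))\<close> can be split off.\<close>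
    also have "\<dots> \<le> (LINT t|lborel. M * (indicator {0<..} t * exp (- (t * c))) + exp (- ((c - c0) * \<delta>)) * \<bar>indicator {0<..} t * (exp (- (c0 * t)) * h t)\<bar>)"
    proof (rule integral_mono')
      show "integrable lborel (\<lambda>t. M * (indicator {0<..} t * exp (- (t * c))) + exp (- ((c - c0) * \<delta>)) * \<bar>indicator {0<..} t * (exp (- (c0 * t)) * h t)\<bar>)"
        by (intro Bochner_Integration.integrable_add integrable_mult_right integrable_abs h ie)
      fix t :: real
      show "\<bar>indicator {0<..} t * (exp (- (c * t)) * h t)\<bar> \<le> M * (indicator {0<..} t * exp (- (t * c))) + exp (- ((c - c0) * \<delta>)) * \<bar>indicator {0<..} t * (exp (- (c0 * t)) * h t)\<bar>"
      proof (cases "t > 0")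
        case True
        show ?thesis
        proof (cases "t < \<delta>")
          case lt: True
          have "exp (- (c * t)) * \<bar>h t\<bar> \<le> exp (- (c * t)) * M"
            using \<delta>(2)[OF True lt] by (intro mult_left_mono) auto
          then have "exp (- (c * t)) * \<bar>h t\<bar> \<le> M * exp (- (t * c))" by (simp add: mult.commute)
          also have "\<dots> \<le> M * exp (- (t * c)) + exp (- ((c - c0) * \<delta>)) * (exp (- (c0 * t)) * \<bar>h t\<bar>)" by simp
          finally show ?thesis using True by (simp add: abs_mult)
        next
          case False
          have "(c - c0) * \<delta> \<le> (c - c0) * t" using False c by (intro mult_left_mono) auto
          then have "exp (- (c * t)) \<le> exp (- ((c - c0) * \<delta>)) * exp (- (c0 * t))"
            by (simp add: algebra_simps flip: exp_add)
          then have "exp (- (c * t)) * \<bar>h t\<bar> \<le> exp (- ((c - c0) * \<delta>)) * exp (- (c0 * t)) * \<bar>h t\<bar>"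
            by (rule mult_right_mono) simp
          also have "\<dots> \<le> M * exp (- (t * c)) + exp (- ((c - c0) * \<delta>)) * (exp (- (c0 * t)) * \<bar>h t\<bar>)"
            using M by simp
          finally show ?thesis using True by (simp add: abs_mult)
        qed
      qed simp
    qed (use M in \<open>auto intro!: add_nonneg_nonneg mult_nonneg_nonneg\<close>)
    also have "\<dots> = M * (1 / c) + exp (- ((c - c0) * \<delta>)) * A"
      unfolding A_def using h ie
      by (subst Bochner_Integration.integral_add) (auto simp: ie_eq intro!: integrable_abs integrable_mult_right)
    finally show ?thesis by simp
  qed
  have A: "A \<ge> 0" unfolding A_def by (rule Bochner_Integration.integral_nonneg) simp
  show ?thesis
  proof (rule Lim_null_comparison)
    show "eventually (\<lambda>n. norm ((c0 + real n) powr \<alpha> * (LINT t|lborel. indicator {0<..} t * (exp (- ((c0 + real n) * t)) * h t))) \<le>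
        (c0 + real n) powr \<alpha> * (M / (c0 + real n) + exp (- (real n * \<delta>)) * A)) sequentially"
      using bound[of "c0 + real n" for n] by (intro always_eventually allI) (auto simp: abs_mult intro!: mult_left_mono)
    show "(\<lambda>n. (c0 + real n) powr \<alpha> * (M / (c0 + real n) + exp (- (real n * \<delta>)) * A)) \<longlonglongrightarrow> 0"
      using \<alpha> \<delta>(1) c0 by real_asymp
  qed
qed

theorem dirac_imp_datum_transform_0:
  assumes \<alpha>: "0 < \<alpha>" "\<alpha> < 1" and p: "0 \<le> p" "p \<le> 1" and \<sigma>: "\<sigma> \<ge> 0"
    and u: "fl_transformable \<sigma> u" and f: "fl_transformable \<sigma> f"
    and eq: "\<And>\<xi> s. Re s > \<sigma> \<Longrightarrow> symbol \<alpha> p \<xi> s * fourier_laplace u \<xi> s = fourier_laplace f \<xi> s + \<gamma> \<xi>"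
    and dirac: "tends_to_dirac u"
  shows "\<gamma> \<xi> = 0"
proof -
  define c0 where "c0 = \<sigma> + 1"
  define C where "C n = c0 + real n" for n :: nat
  have c0: "c0 > 0" and C: "C n > 0" "C n > \<sigma>" "C n \<ge> c0" for n using \<sigma> by (auto simp: C_def c0_def)
  let ?P = "lborel \<Otimes>\<^sub>M lborel :: (real \<times> real) measure"
  define T where "T v c \<xi> = fourier_laplace v \<xi> (of_real c)" for v c \<xi>
  have di: "integrable ?P (\<lambda>(x, t). damp c v x t)" if "fl_transformable \<sigma> v" "c > \<sigma>" for v c
    using that by (intro fl_transformable_damp) auto
  have dci: "integrable ?P (\<lambda>X. complex_of_real (damp c v (fst X) (snd X)))" if "fl_transformable \<sigma> v" "c > \<sigma>" for v c
    using integrable_of_real[OF di[OF that]] by (simp add: case_prod_unfold)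
  have T_eq: "T v c (- \<xi>) = (LINT X|?P. cis (\<xi> * fst X) * of_real (damp c v (fst X) (snd X)))"
    if "fl_transformable \<sigma> v" "c > \<sigma>" for v c \<xi>
    unfolding T_def using fourier_laplace_damp[OF di[OF that], of "- \<xi>" 0]
    by (simp add: case_prod_unfold complex_of_real_def)
  have T_cont: "continuous_on UNIV (\<lambda>\<xi>. T v c (- \<xi>))" if "fl_transformable \<sigma> v" "c > \<sigma>" for v c
    unfolding T_eq[OF that] using dci[OF that] by (intro continuous_integral_cis) auto
  define I where "I v c = (LINT X|?P. \<bar>damp c v (fst X) (snd X)\<bar>)" for v c
  have T_le: "norm (T v c (- \<xi>)) \<le> I v c" if "fl_transformable \<sigma> v" "c > \<sigma>" for v c \<xi>
    unfolding T_eq[OF that] I_def using norm_integral_cis_mult_le[OF dci[OF that]] by simp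
  \<comment> \<open>Reflected, so that pairing with \<open>fourier \<psi>\<close> fits the inversion
    formula with its e^(+i\<eta>x).\<close>
  define \<Gamma> where "\<Gamma> \<eta> = \<gamma> (- \<eta>)" for \<eta>
  have \<Gamma>_eq: "symbol \<alpha> p (- \<eta>) (of_real c) * T u c (- \<eta>) = T f c (- \<eta>) + \<Gamma> \<eta>" if "c > \<sigma>" for c \<eta>
    unfolding T_def \<Gamma>_def by (rule eq) (use that in simp)
  \<comment> \<open>No regularity of \<gamma> is given; the equation at \<open>c0\<close> expresses
    it through continuous functions of the frequency. The growth bound \<open>\<Gamma>_le\<close>
    arises in the same way.\<close>
  have \<Gamma>_cont: "continuous_on UNIV \<Gamma>"
  proof -
    have "\<Gamma> = (\<lambda>\<eta>. symbol \<alpha> p (- \<eta>) (of_real c0) * T u c0 (- \<eta>) - T f c0 (- \<eta>))"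
      using \<Gamma>_eq[of c0] by (auto simp: fun_eq_iff c0_def)
    moreover have "continuous_on UNIV (\<lambda>\<eta>. symbol \<alpha> p (- \<eta>) (of_real c0))"
      by (rule continuous_on_compose2[OF continuous_symbol[OF \<alpha>(1) c0]]) (auto intro: continuous_intros)
    ultimately show ?thesis
      using T_cont[OF u, of c0] T_cont[OF f, of c0] by (simp add: c0_def continuous_on_diff continuous_on_mult)
  qed
  then have \<Gamma>m [measurable]: "\<Gamma> \<in> borel_measurable borel" by (rule borel_measurable_continuous_onI)
  have I0: "I v c \<ge> 0" for v c unfolding I_def by (rule Bochner_Integration.integral_nonneg) simp
  define D where "D = (2 + c0) * I u c0 + I f c0"
  have \<Gamma>_le: "norm (\<Gamma> \<eta>) \<le> D * (1 + \<eta>\<^sup>2)" for \<eta>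
  proof -
    have "norm (\<Gamma> \<eta>) \<le> norm (symbol \<alpha> p (- \<eta>) (of_real c0)) * norm (T u c0 (- \<eta>)) + norm (T f c0 (- \<eta>))"
    proof -
      have "\<Gamma> \<eta> = symbol \<alpha> p (- \<eta>) (of_real c0) * T u c0 (- \<eta>) - T f c0 (- \<eta>)"
        using \<Gamma>_eq[of c0 \<eta>] by (simp add: c0_def)
      then show ?thesis by (metis norm_triangle_ineq4 norm_mult)
    qed
    also have "\<dots> \<le> (1 + c0 + \<bar>\<eta>\<bar>) * I u c0 + I f c0"
      using norm_symbol_le[OF \<alpha> p, of c0 "- \<eta>"] c0 T_le[OF u, of c0 \<eta>] T_le[OF f, of c0 \<eta>]
      by (intro add_mono mult_mono) (auto simp: c0_def)
    also have "\<dots> \<le> ((2 + c0) * (1 + \<eta>\<^sup>2)) * I u c0 + I f c0 * (1 + \<eta>\<^sup>2)"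
    proof (intro add_mono mult_right_mono I0)
      have l: "\<bar>\<eta>\<bar> \<le> 1 + \<eta>\<^sup>2"
      proof -
        have "(\<bar>\<eta>\<bar> - 1)\<^sup>2 = \<eta>\<^sup>2 + 1 - 2 * \<bar>\<eta>\<bar>" by (simp add: power2_diff)
        moreover have "0 \<le> (\<bar>\<eta>\<bar> - 1)\<^sup>2" by (rule zero_le_power2)
        ultimately show ?thesis by linarith
      qed
      have l': "0 \<le> c0 * \<eta>\<^sup>2" using c0 by simp
      show "1 + c0 + \<bar>\<eta>\<bar> \<le> (2 + c0) * (1 + \<eta>\<^sup>2)" 
      proof -
        have "(2 + c0) * (1 + \<eta>\<^sup>2) = 2 + c0 + 2 * \<eta>\<^sup>2 + c0 * \<eta>\<^sup>2" by (simp add: algebra_simps)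
        moreover have "0 \<le> \<eta>\<^sup>2" by simp
        ultimately show ?thesis using l l' by linarith
      qed
      show "I f c0 \<le> I f c0 * (1 + \<eta>\<^sup>2)" using I0[of f c0] by (simp add: algebra_simps)
    qed
    also have "\<dots> = D * (1 + \<eta>\<^sup>2)" by (simp add: D_def algebra_simps)
    finally show ?thesis .
  qed
  \<comment> \<open>Multiply the equation by \<open>C n powr \<alpha> / symbol\<close>: the
    multiplier tends to 1 and the source to 0, leaving the pairing with \<open>\<Gamma>\<close>.
    Inversion turns the left side into 2 pi times the quantity that
    \<open>laplace_near_0_decay\<close> sends to 0.\<close>
  have key: "(LINT \<eta>|lborel. \<Gamma> \<eta> * fourier \<psi> \<eta>) = 0" if \<psi>: "test_function \<psi>" for \<psi>
  proof -
    have \<psi>m [measurable]: "\<psi> \<in> borel_measurable borel" by (rule test_function_measurable[OF \<psi>])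
    have f\<psi>i: "integrable lborel (fourier \<psi>)" by (rule integrable_fourier_test_function[OF \<psi>])
    have f\<psi>m [measurable]: "fourier \<psi> \<in> borel_measurable borel"
      using borel_measurable_integrable[OF f\<psi>i] by simp
    define h where "h t = (LINT x|lborel. u x t * \<psi> x)" for t
    obtain K where K: "\<And>x. \<bar>\<psi> x\<bar> \<le> K" "K \<ge> 0" by (rule test_function_bounded[OF \<psi>]) blast
    have iu: "integrable ?P (\<lambda>(x, t). damp c u x t * \<psi> x)" if "c > \<sigma>" for c
    proof (rule Bochner_Integration.integrable_bound[OF integrable_mult_left[OF di[OF u that], of K]])
      have "(\<lambda>X. damp c u (fst X) (snd X)) \<in> borel_measurable ?P"
        using borel_measurable_integrable[OF di[OF u that]] by (simp add: case_prod_unfold)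
      then show "(\<lambda>(x, t). damp c u x t * \<psi> x) \<in> borel_measurable ?P"
        unfolding case_prod_unfold by measurable
      show "AE X in ?P. norm (case X of (x, t) \<Rightarrow> damp c u x t * \<psi> x) \<le> norm ((case X of (x, t) \<Rightarrow> damp c u x t) * K)"
        using K by (intro AE_I2) (auto simp: abs_mult intro!: mult_left_mono)
    qed
    have L_eq: "(LINT X|?P. (case X of (x, t) \<Rightarrow> damp c u x t * \<psi> x)) = (LINT t|lborel. indicator {0<..} t * (exp (- (c * t)) * h t))"
      and L_int: "integrable lborel (\<lambda>t. indicator {0<..} t * (exp (- (c * t)) * h t))" if c: "c > \<sigma>" for c
    proof -
      have inner: "(LINT x|lborel. damp c u x t * \<psi> x) = indicator {0<..} t * (exp (- (c * t)) * h t)" for t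
        unfolding h_def damp_def by (simp add: mult.assoc)
      show "(LINT X|?P. (case X of (x, t) \<Rightarrow> damp c u x t * \<psi> x)) = (LINT t|lborel. indicator {0<..} t * (exp (- (c * t)) * h t))"
        using lborel_pair.integral_snd[OF iu[OF c]] unfolding inner by simp
      show "integrable lborel (\<lambda>t. indicator {0<..} t * (exp (- (c * t)) * h t))"
        using lborel_pair.integrable_snd[OF iu[OF c]] unfolding inner by simp
    qed
    have parseval: "(LINT \<eta>|lborel. fourier \<psi> \<eta> * T u c (- \<eta>)) = 2 * pi * complex_of_real (LINT X|?P. (case X of (x, t) \<Rightarrow> damp c u x t * \<psi> x))"
      if c: "c > \<sigma>" for c
    proof -
      interpret LP: pair_sigma_finite lborel ?P by unfold_locales
      let ?d = "\<lambda>X. complex_of_real (damp c u (fst X) (snd X))"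
      have "integrable (lborel \<Otimes>\<^sub>M ?P) (\<lambda>(\<eta>, X). fourier \<psi> \<eta> * ?d X)"
        by (intro LP.integrable_mult_prod f\<psi>i dci u c)
      then have "integrable (lborel \<Otimes>\<^sub>M ?P) (\<lambda>z. cis (fst z * fst (snd z)) * (case z of (\<eta>, X) \<Rightarrow> fourier \<psi> \<eta> * ?d X))"
        by (rule integrable_cis_mult) measurable
      then have ii: "integrable (lborel \<Otimes>\<^sub>M ?P) (\<lambda>(\<eta>, X). fourier \<psi> \<eta> * (cis (\<eta> * fst X) * ?d X))"
        by (simp add: case_prod_unfold mult_ac)
      have "(LINT \<eta>|lborel. fourier \<psi> \<eta> * T u c (- \<eta>)) = (LINT \<eta>|lborel. LINT X|?P. fourier \<psi> \<eta> * (cis (\<eta> * fst X) * ?d X))"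
        unfolding T_eq[OF u c] by simp
      also have "\<dots> = (LINT X|?P. LINT \<eta>|lborel. fourier \<psi> \<eta> * (cis (\<eta> * fst X) * ?d X))"
        by (rule LP.Fubini_integral[OF ii, symmetric])
      also have "\<dots> = (LINT X|?P. 2 * pi * complex_of_real (case X of (x, t) \<Rightarrow> damp c u x t * \<psi> x))"
      proof (rule Bochner_Integration.integral_cong[OF refl])
        fix X :: "real \<times> real"
        have "(LINT \<eta>|lborel. fourier \<psi> \<eta> * (cis (\<eta> * fst X) * ?d X)) = (LINT \<eta>|lborel. ?d X * (cis (\<eta> * fst X) * fourier \<psi> \<eta>))"
          by (simp only: mult_ac)
        also have "\<dots> = ?d X * complex_of_real (2 * pi * \<psi> (fst X))"
          unfolding integral_mult_right_zero test_function_inversion[OF \<psi>] ..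
        finally show "(LINT \<eta>|lborel. fourier \<psi> \<eta> * (cis (\<eta> * fst X) * ?d X)) = 2 * pi * complex_of_real (case X of (x, t) \<Rightarrow> damp c u x t * \<psi> x)"
          by (simp add: case_prod_unfold)
      qed
      also have "\<dots> = 2 * pi * complex_of_real (LINT X|?P. (case X of (x, t) \<Rightarrow> damp c u x t * \<psi> x))"
        unfolding integral_mult_right_zero integral_complex_of_real ..
      finally show ?thesis .
    qed
    define \<rho> where "\<rho> n \<eta> = of_real (C n powr \<alpha>) / symbol \<alpha> p (- \<eta>) (of_real (C n))" for n \<eta>
    have sym_nz: "symbol \<alpha> p \<eta> (of_real (C n)) \<noteq> 0" for n \<eta>
      using Re_symbol_pos[OF \<alpha> p, of "of_real (C n)" \<eta>] C[of n] by auto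
    define \<kappa> where "\<kappa> = cos (\<alpha> * pi / 2)"
    have \<kappa>: "\<kappa> > 0" unfolding \<kappa>_def by (rule cos_half_pi_pos[OF \<alpha>])
    \<comment> \<open>The lower bound for the symbol is uniform in frequency, so one constant
      dominates the multiplier for all \<open>n\<close>.\<close>
    have \<rho>_le: "norm (\<rho> n \<eta>) \<le> 1 / \<kappa>" for n \<eta>
    proof -
      have "C n powr \<alpha> * \<kappa> \<le> norm (symbol \<alpha> p (- \<eta>) (of_real (C n)))"
        using Re_symbol_ge[OF \<alpha> p, of "of_real (C n)" "- \<eta>"] C(1)[of n] complex_Re_le_cmod order_trans
        unfolding \<kappa>_def by (metis Re_complex_of_real)
      then show ?thesis
        using \<kappa> sym_nz[of "- \<eta>" n] by (simp add: \<rho>_def norm_divide field_simps)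
    qed
    have Cn_lim: "filterlim C at_top sequentially"
      unfolding C_def by real_asymp
    have symm: "(\<lambda>\<eta>. symbol \<alpha> p (- \<eta>) (of_real (C n))) \<in> borel_measurable borel" for n
      by (intro borel_measurable_continuous_onI continuous_on_compose2[OF continuous_symbol[OF \<alpha>(1) C(1)]])
         (auto intro: continuous_intros)
    have Tfm: "(\<lambda>\<eta>. T f (C n) (- \<eta>)) \<in> borel_measurable borel" for n
      by (intro borel_measurable_continuous_onI T_cont f C)
    \<comment> \<open>The damping tends to 0 at every positive time, so the source drops out of the
      limit.\<close>
    have If_lim: "(\<lambda>n. I f (C n)) \<longlonglongrightarrow> 0" and If_le: "I f (C n) \<le> I f c0" for n
    proof -
      have le: "\<bar>damp (C n) f x t\<bar> \<le> \<bar>damp c0 f x t\<bar>" for n x t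
        by (auto simp: damp_def abs_mult indicator_def C_def intro!: mult_right_mono)
      have c0\<sigma>: "c0 > \<sigma>" by (simp add: c0_def)
      have if0: "integrable ?P (\<lambda>X. damp c f (fst X) (snd X))" if "c > \<sigma>" for c
        using di[OF f that] by (simp add: case_prod_unfold)
      show "I f (C n) \<le> I f c0" for n
        unfolding I_def using le C(2)[of n] c0\<sigma> by (intro integral_mono integrable_abs if0) auto
      have "(\<lambda>n. I f (C n)) \<longlonglongrightarrow> (LINT X|?P. (0::real))"
        unfolding I_def
      proof (rule integral_dominated_convergence[where w = "\<lambda>X. \<bar>damp c0 f (fst X) (snd X)\<bar>"])
        show "(\<lambda>X. \<bar>damp (C i) f (fst X) (snd X)\<bar>) \<in> borel_measurable ?P" for i
          using if0[OF C(2)] by (intro borel_measurable_integrable integrable_abs)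
        show "integrable ?P (\<lambda>X. \<bar>damp c0 f (fst X) (snd X)\<bar>)" using if0[OF c0\<sigma>] by (rule integrable_abs)
        show "AE X in ?P. norm \<bar>damp (C i) f (fst X) (snd X)\<bar> \<le> \<bar>damp c0 f (fst X) (snd X)\<bar>" for i
          using le by (intro AE_I2) simp
        show "AE X in ?P. (\<lambda>i. \<bar>damp (C i) f (fst X) (snd X)\<bar>) \<longlonglongrightarrow> 0"
        proof (rule AE_I2)
          fix X :: "real \<times> real"
          show "(\<lambda>i. \<bar>damp (C i) f (fst X) (snd X)\<bar>) \<longlonglongrightarrow> 0"
          proof (cases "snd X > 0")
            case True
            then have "(\<lambda>i. exp (- (C i * snd X)) * \<bar>f (fst X) (snd X)\<bar>) \<longlonglongrightarrow> 0 * \<bar>f (fst X) (snd X)\<bar>"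
              unfolding C_def by (intro tendsto_mult tendsto_const) real_asymp
            then show ?thesis using True by (simp add: damp_def abs_mult)
          qed (simp add: damp_def)
        qed
      qed simp
      then show "(\<lambda>n. I f (C n)) \<longlonglongrightarrow> 0" by simp
    qed
    have l1: "(\<lambda>n. LINT \<eta>|lborel. \<rho> n \<eta> * (T f (C n) (- \<eta>) + \<Gamma> \<eta>) * fourier \<psi> \<eta>) \<longlonglongrightarrow> (LINT \<eta>|lborel. \<Gamma> \<eta> * fourier \<psi> \<eta>)"
    proof (rule integral_dominated_convergence[where w = "\<lambda>\<eta>. norm ((of_real ((1 / \<kappa>) * (I f c0 + D * (1 + \<eta>\<^sup>2))) :: complex) * fourier \<psi> \<eta>)"])
      show "(\<lambda>\<eta>. \<Gamma> \<eta> * fourier \<psi> \<eta>) \<in> borel_measurable lborel" by measurable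
      show "(\<lambda>\<eta>. \<rho> n \<eta> * (T f (C n) (- \<eta>) + \<Gamma> \<eta>) * fourier \<psi> \<eta>) \<in> borel_measurable lborel" for n
        unfolding \<rho>_def using symm Tfm by measurable
      show "integrable lborel (\<lambda>\<eta>. norm ((of_real ((1 / \<kappa>) * (I f c0 + D * (1 + \<eta>\<^sup>2))) :: complex) * fourier \<psi> \<eta>))"
      proof (intro integrable_norm integrable_mult_fourier_test_function[OF \<psi>])
        have D0: "D \<ge> 0" unfolding D_def using I0 c0 by (intro add_nonneg_nonneg mult_nonneg_nonneg) auto
        show "norm (complex_of_real ((1 / \<kappa>) * (I f c0 + D * (1 + \<xi>\<^sup>2)))) \<le> ((1 / \<kappa>) * (I f c0 + D)) * (1 + \<xi>\<^sup>2)" for \<xi>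
        proof -
          have "0 \<le> I f c0 * \<xi>\<^sup>2" using I0 by simp
          then have "I f c0 + D * (1 + \<xi>\<^sup>2) \<le> (I f c0 + D) * (1 + \<xi>\<^sup>2)" by (simp add: algebra_simps)
          then have "(1 / \<kappa>) * (I f c0 + D * (1 + \<xi>\<^sup>2)) \<le> (1 / \<kappa>) * ((I f c0 + D) * (1 + \<xi>\<^sup>2))"
            using \<kappa> by (intro mult_left_mono) auto
          moreover have "(1 / \<kappa>) * (I f c0 + D * (1 + \<xi>\<^sup>2)) \<ge> 0"
            using \<kappa> I0 D0 by (intro mult_nonneg_nonneg add_nonneg_nonneg) auto
          ultimately show ?thesis unfolding norm_of_real by (simp only: abs_of_nonneg mult.assoc)
        qed
      qed measurable
      show "AE \<eta> in lborel. (\<lambda>n. \<rho> n \<eta> * (T f (C n) (- \<eta>) + \<Gamma> \<eta>) * fourier \<psi> \<eta>) \<longlonglongrightarrow> \<Gamma> \<eta> * fourier \<psi> \<eta>"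
      proof (rule AE_I2)
        fix \<eta>
        have "(\<lambda>n. \<rho> n \<eta>) \<longlonglongrightarrow> 1"
          unfolding \<rho>_def by (rule powr_div_symbol_tendsto[OF \<alpha> C(1) Cn_lim])
        moreover have "(\<lambda>n. T f (C n) (- \<eta>)) \<longlonglongrightarrow> 0"
          by (rule Lim_null_comparison[OF _ If_lim]) (use T_le[OF f C(2)] in auto)
        ultimately have "(\<lambda>n. \<rho> n \<eta> * (T f (C n) (- \<eta>) + \<Gamma> \<eta>) * fourier \<psi> \<eta>) \<longlonglongrightarrow> 1 * (0 + \<Gamma> \<eta>) * fourier \<psi> \<eta>"
          by (intro tendsto_intros)
        then show "(\<lambda>n. \<rho> n \<eta> * (T f (C n) (- \<eta>) + \<Gamma> \<eta>) * fourier \<psi> \<eta>) \<longlonglongrightarrow> \<Gamma> \<eta> * fourier \<psi> \<eta>" by simp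
      qed
      show "AE \<eta> in lborel. norm (\<rho> n \<eta> * (T f (C n) (- \<eta>) + \<Gamma> \<eta>) * fourier \<psi> \<eta>) \<le>
         norm ((of_real ((1 / \<kappa>) * (I f c0 + D * (1 + \<eta>\<^sup>2))) :: complex) * fourier \<psi> \<eta>)" for n
      proof (rule AE_I2)
        fix \<eta>
        have "norm (T f (C n) (- \<eta>) + \<Gamma> \<eta>) \<le> I f c0 + D * (1 + \<eta>\<^sup>2)"
          by (intro order_trans[OF norm_triangle_ineq] add_mono \<Gamma>_le order_trans[OF T_le[OF f C(2)] If_le])
        then have "norm (\<rho> n \<eta> * (T f (C n) (- \<eta>) + \<Gamma> \<eta>)) \<le> (1 / \<kappa>) * (I f c0 + D * (1 + \<eta>\<^sup>2))"
          unfolding norm_mult using \<rho>_le \<kappa> by (intro mult_mono) auto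
        also have "\<dots> \<le> norm (complex_of_real ((1 / \<kappa>) * (I f c0 + D * (1 + \<eta>\<^sup>2))))"
          unfolding norm_of_real by (rule abs_ge_self)
        finally show "norm (\<rho> n \<eta> * (T f (C n) (- \<eta>) + \<Gamma> \<eta>) * fourier \<psi> \<eta>) \<le>
          norm ((of_real ((1 / \<kappa>) * (I f c0 + D * (1 + \<eta>\<^sup>2))) :: complex) * fourier \<psi> \<eta>)"
          unfolding norm_mult[of _ "fourier \<psi> \<eta>"] by (rule mult_right_mono) simp
      qed
    qed
    have l2: "(LINT \<eta>|lborel. \<rho> n \<eta> * (T f (C n) (- \<eta>) + \<Gamma> \<eta>) * fourier \<psi> \<eta>) =
      2 * pi * complex_of_real (C n powr \<alpha> * (LINT t|lborel. indicator {0<..} t * (exp (- (C n * t)) * h t)))" for n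
    proof -
      have e: "\<rho> n \<eta> * (T f (C n) (- \<eta>) + \<Gamma> \<eta>) * fourier \<psi> \<eta> = of_real (C n powr \<alpha>) * (fourier \<psi> \<eta> * T u (C n) (- \<eta>))" for \<eta>
        using sym_nz[of "- \<eta>" n] by (simp add: \<rho>_def \<Gamma>_eq[OF C(2), symmetric])
      show ?thesis
        unfolding e integral_mult_right_zero parseval[OF C(2)] L_eq[OF C(2)] by (simp add: mult_ac)
    qed
    have l3: "(\<lambda>n. 2 * pi * complex_of_real (C n powr \<alpha> * (LINT t|lborel. indicator {0<..} t * (exp (- (C n * t)) * h t)))) \<longlonglongrightarrow> 2 * pi * complex_of_real 0"
      unfolding C_def
    proof (intro tendsto_mult tendsto_const tendsto_of_real laplace_near_0_decay[OF \<alpha> c0])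
      show "integrable lborel (\<lambda>t. indicator {0<..} t * (exp (- (c0 * t)) * h t))"
        by (rule L_int) (simp add: c0_def)
      show "(h \<longlongrightarrow> \<psi> 0) (at_right 0)"
        using dirac \<psi> unfolding tends_to_dirac_def h_def by blast
    qed
    show ?thesis using LIMSEQ_unique[OF l1[unfolded l2] l3] by simp
  qed
  \<comment> \<open>One test function suffices: translating it multiplies its transform by
    characters, so \<open>key\<close> says that the Fourier transform of
    \<open>\<Gamma> \<eta> * fourier \<psi> \<eta>\<close> is 0. The product then vanishes, and
    \<open>\<psi>\<close> was chosen so that this decides the value at the given frequency.\<close>
  obtain \<psi> where \<psi>: "test_function \<psi>" and nz: "fourier \<psi> (- \<xi>) \<noteq> 0"
    using exists_test_function_fourier_nonzero by blast
  have f\<psi>c: "continuous_on UNIV (fourier \<psi>)"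
    unfolding fourier_eq_cfourier by (intro continuous_cfourier integrable_of_real test_function_integrable \<psi>)
  have i: "integrable lborel (\<lambda>\<eta>. \<Gamma> \<eta> * fourier \<psi> \<eta>)"
    by (rule integrable_mult_fourier_test_function[OF \<psi> \<Gamma>m \<Gamma>_le])
  have "AE \<eta> in lborel. \<Gamma> \<eta> * fourier \<psi> \<eta> = 0"
  proof (rule cfourier_eq_0_imp_AE_0[OF i])
    fix a
    have t: "test_function (\<lambda>x. \<psi> (1 * x + (- a)))" by (rule test_function_affine[OF \<psi>]) simp
    have ft: "fourier (\<lambda>x. \<psi> (1 * x + (- a))) \<eta> = cis (- (a * \<eta>)) * fourier \<psi> \<eta>" for \<eta>
      using cfourier_translate[of "\<lambda>x. complex_of_real (\<psi> x)" "- a" \<eta>]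
      unfolding fourier_eq_cfourier by (simp add: mult.commute)
    show "cfourier (\<lambda>\<eta>. \<Gamma> \<eta> * fourier \<psi> \<eta>) a = 0"
      using key[OF t] unfolding ft cfourier_def by (simp add: mult_ac)
  qed
  then have AE: "AE \<eta> in lborel. \<eta> \<in> UNIV \<longrightarrow> \<Gamma> \<eta> * fourier \<psi> \<eta> = 0" by simp
  have "\<Gamma> (- \<xi>) * fourier \<psi> (- \<xi>) = 0"
    by (rule AE_continuous_eq[OF open_UNIV continuous_on_mult[OF \<Gamma>_cont f\<psi>c] continuous_on_const AE UNIV_I])
  then show ?thesis using nz by (simp add: \<Gamma>_def)
qed

subsection \<open>Total masses\<close>

lemma laplace_powr:
  assumes a: "0 < a" "a < 1" and s: "Re s > 0"
  shows "(LINT t:{0<..}|lborel. exp (- (s * of_real t)) * of_real (t powr (a - 1) / Gamma a)) = 1 / s powr of_real a"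
proof -
  text \<open>The kernel at frequency \<open>0\<close> extends the Gamma integral to complex \<open>s\<close>.\<close>
  obtain \<mu> :: "real measure" where \<mu>: "\<And>\<xi> s. Re s > 0 \<Longrightarrow>
       (LINT t:{0<..}|lborel. exp (- (s * of_real t)) * kernel_transform a \<mu> \<xi> t) = 1 / symbol a 0 \<xi> s"
    by (rule kernel_measure_exists[of a 0]) (use a in auto)
  define m where "m = measure \<mu> (space \<mu>)"
  have k0: "kernel_transform a \<mu> 0 t = of_real (t powr (a - 1) * m)" for t
    by (simp add: kernel_transform_def m_def scaleR_conv_of_real)
  have "complex_of_real (Gamma a * m) = (LINT t|lborel. complex_of_real ((indicator {0<..} t * (t powr (a - 1) * exp (- t))) * m))"
    unfolding integral_complex_of_real using Gamma_integral_lborel(2)[OF a(1)] by simp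
  also have "\<dots> = (LINT t:{0<..}|lborel. exp (- (1 * of_real t)) * kernel_transform a \<mu> 0 t)"
    unfolding set_lebesgue_integral_def k0
    by (intro Bochner_Integration.integral_cong) (auto simp: indicator_def simp flip: exp_of_real)
  also have "\<dots> = 1" by (subst \<mu>) (auto simp: symbol_0)
  finally have "Gamma a * m = 1" by (simp only: of_real_eq_1_iff)
  moreover from this have "Gamma a \<noteq> 0" by auto
  ultimately have "m = 1 / Gamma a" by (simp add: field_simps)
  then have "of_real (t powr (a - 1) / Gamma a) = kernel_transform a \<mu> 0 t" for t
    by (simp add: k0)
  then show ?thesis using \<mu>[OF s, of 0] by (simp add: symbol_0)
qed

lemma cfourier_eq_iff_AE:
  assumes f: "integrable lborel f" and g: "integrable lborel g"
  shows "(\<forall>\<eta>. cfourier f \<eta> = cfourier g \<eta>) \<longleftrightarrow> (AE t in lborel. f t = g t)"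
proof
  assume "\<forall>\<eta>. cfourier f \<eta> = cfourier g \<eta>"
  then have "AE t in lborel. f t - g t = 0"
    using f g by (intro cfourier_eq_0_imp_AE_0) (auto simp: cfourier_diff)
  then show "AE t in lborel. f t = g t" by simp
next
  assume AE: "AE t in lborel. f t = g t"
  show "\<forall>\<eta>. cfourier f \<eta> = cfourier g \<eta>"
    unfolding cfourier_def
  proof (intro allI integral_cong_AE)
    fix \<eta>
    have [measurable]: "f \<in> borel_measurable borel" "g \<in> borel_measurable borel" using f g by auto
    show "(\<lambda>t. cis (- (\<eta> * t)) * f t) \<in> borel_measurable lborel"
      "(\<lambda>t. cis (- (\<eta> * t)) * g t) \<in> borel_measurable lborel" by measurable
    show "AE t in lborel. cis (- (\<eta> * t)) * f t = cis (- (\<eta> * t)) * g t"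
      using AE by eventually_elim simp
  qed
qed

definition damp_time :: "real \<Rightarrow> (real \<Rightarrow> real) \<Rightarrow> real \<Rightarrow> complex" where
  "damp_time c m t = of_real (indicator {0<..} t * (exp (- (c * t)) * m t))"

lemma damp_time_eq_iff: "damp_time c m t = damp_time c m' t \<longleftrightarrow> (t > 0 \<longrightarrow> m t = m' t)"
proof (cases "t > 0")
  case True
  then have "damp_time c m t = damp_time c m' t \<longleftrightarrow> exp (- (c * t)) * m t = exp (- (c * t)) * m' t"
    unfolding damp_time_def of_real_eq_iff by simp
  then show ?thesis using True by simp
next
  case False
  then show ?thesis by (simp add: damp_time_def)
qed

lemma cfourier_damp_time:
  "cfourier (damp_time c m) \<eta> = (LINT t:{0<..}|lborel. exp (- (Complex c \<eta> * of_real t)) * of_real (m t))"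
  unfolding cfourier_def set_lebesgue_integral_def
proof (rule Bochner_Integration.integral_cong[OF refl])
  fix t
  show "cis (- (\<eta> * t)) * damp_time c m t = indicator {0<..} t *\<^sub>R (exp (- (Complex c \<eta> * of_real t)) * of_real (m t))"
    unfolding exp_Complex_mult by (simp add: damp_time_def indicator_def)
qed

text \<open>At frequency 0 the spatial transform is the total mass, so the equation becomes one for
  functions of time.\<close>

lemma fourier_laplace_0_eq:
  "fourier_laplace v 0 (Complex c \<eta>) = cfourier (damp_time c (\<lambda>t. LINT x|lborel. v x t)) \<eta>"
proof -
  have "fourier (\<lambda>x. v x t) 0 = complex_of_real (LINT x|lborel. v x t)" for t
    unfolding fourier_def by simp
  then show ?thesis unfolding cfourier_damp_time fourier_laplace_def by simp
qed

lemma damp_time_integrable: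
  assumes "fl_transformable \<sigma> v" "c \<ge> \<sigma>"
  shows "integrable lborel (damp_time c (\<lambda>t. LINT x|lborel. v x t))"
proof -
  have "integrable lborel (\<lambda>t. LINT x|lborel. damp c v x t)"
    using lborel_pair.integrable_snd[OF fl_transformable_damp[OF assms]] by simp
  then show ?thesis
    unfolding damp_time_def[abs_def] damp_def by (intro integrable_of_real) simp
qed

text \<open>Multiplication by s^\<alpha> is injective and carries 1 / s, the transform of the
  constant 1, to s^(\<alpha>-1), the transform of the power on the other side. Uniqueness on a
  single vertical line yields equality at almost every time.\<close>

theorem mass_equivalence:
  assumes \<alpha>: "0 < \<alpha>" "\<alpha> < 1" and \<sigma>: "\<sigma> \<ge> 0"
    and u: "fl_transformable \<sigma> u" and f: "fl_transformable \<sigma> f"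
    and eq: "\<And>\<xi> s. Re s > \<sigma> \<Longrightarrow> symbol \<alpha> p \<xi> s * fourier_laplace u \<xi> s = fourier_laplace f \<xi> s"
  shows "(AE t in lborel. t > 0 \<longrightarrow> (LINT x|lborel. u x t) = 1) \<longleftrightarrow>
    (AE t in lborel. t > 0 \<longrightarrow> (LINT x|lborel. f x t) = t powr (- \<alpha>) / Gamma (1 - \<alpha>))"
proof -
  define c where "c = \<sigma> + 1"
  have c: "c > 0" "c > \<sigma>" using \<sigma> by (auto simp: c_def)
  let ?mu = "\<lambda>t. LINT x|lborel. u x t" and ?mf = "\<lambda>t. LINT x|lborel. f x t"
  let ?one = "\<lambda>t::real. 1::real" and ?pow = "\<lambda>t. t powr (- \<alpha>) / Gamma (1 - \<alpha>)"
  have ui: "integrable lborel (damp_time c ?mu)" and fi: "integrable lborel (damp_time c ?mf)"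
    using damp_time_integrable[OF u] damp_time_integrable[OF f] c by auto
  have "integrable lborel (\<lambda>t. complex_of_real (indicator {0<..} t * (t powr (1 - 1) * exp (- (c * t)))))"
    using c by (intro integrable_of_real integrable_powr_exp) auto
  also have "(\<lambda>t. complex_of_real (indicator {0<..} t * (t powr (1 - 1) * exp (- (c * t))))) = damp_time c ?one"
    by (auto simp: damp_time_def fun_eq_iff indicator_def)
  finally have onei: "integrable lborel (damp_time c ?one)" .
  have "integrable lborel (\<lambda>t. complex_of_real ((indicator {0<..} t * (t powr ((1 - \<alpha>) - 1) * exp (- (c * t)))) / Gamma (1 - \<alpha>)))"
    using c \<alpha> by (intro integrable_of_real integrable_divide integrable_powr_exp) auto
  also have "(\<lambda>t. complex_of_real ((indicator {0<..} t * (t powr ((1 - \<alpha>) - 1) * exp (- (c * t)))) / Gamma (1 - \<alpha>))) = damp_time c ?pow"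
    by (auto simp: damp_time_def fun_eq_iff indicator_def)
  finally have powi: "integrable lborel (damp_time c ?pow)" .
  have rel: "(cfourier (damp_time c ?mu) \<eta> = cfourier (damp_time c ?one) \<eta>) \<longleftrightarrow> (cfourier (damp_time c ?mf) \<eta> = cfourier (damp_time c ?pow) \<eta>)" for \<eta>
  proof -
    define s where "s = Complex c \<eta>"
    have s: "Re s > 0" "Re s > \<sigma>" "s \<noteq> 0" using c by (auto simp: s_def complex_eq_iff)
    have one: "cfourier (damp_time c ?one) \<eta> = 1 / s"
    proof -
      \<comment> \<open>The transform of the constant 1 is the case of exponent 1 in
        \<open>integral_powr_exp_powr\<close>.\<close>
      have "cfourier (damp_time c ?one) \<eta> = (LINT r:{0<..}|lborel. of_real (1 * r powr (1 - 1)) * exp (- (of_real (r powr 1) * s)))"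
        unfolding cfourier_damp_time set_lebesgue_integral_def s_def[symmetric]
        by (intro Bochner_Integration.integral_cong) (auto simp: indicator_def mult.commute)
      also have "\<dots> = 1 / s" by (rule integral_powr_exp_powr(2)) (use s in auto)
      finally show ?thesis .
    qed
    have pow: "cfourier (damp_time c ?pow) \<eta> = 1 / s powr of_real (1 - \<alpha>)"
      unfolding cfourier_damp_time s_def[symmetric] using laplace_powr[of "1 - \<alpha>" s] \<alpha> s by simp
    have sp: "s powr of_real \<alpha> * s powr of_real (1 - \<alpha>) = s"
      using s by (simp flip: powr_add)
    have nz: "s powr of_real \<alpha> \<noteq> 0" "s powr of_real (1 - \<alpha>) \<noteq> 0" using s by auto
    have "s powr of_real \<alpha> * cfourier (damp_time c ?mu) \<eta> = cfourier (damp_time c ?mf) \<eta>"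
      using eq[of s 0] s unfolding symbol_0 s_def fourier_laplace_0_eq by simp
    moreover have "s powr of_real \<alpha> * (1 / s) = 1 / s powr of_real (1 - \<alpha>)"
      using sp s nz by (simp add: field_simps)
    ultimately show ?thesis unfolding one pow using nz by (metis mult_left_cancel)
  qed
  have "(AE t in lborel. t > 0 \<longrightarrow> ?mu t = 1) \<longleftrightarrow> (AE t in lborel. damp_time c ?mu t = damp_time c ?one t)"
    by (simp add: damp_time_eq_iff)
  also have "\<dots> \<longleftrightarrow> (AE t in lborel. damp_time c ?mf t = damp_time c ?pow t)"
    unfolding cfourier_eq_iff_AE[OF ui onei, symmetric] cfourier_eq_iff_AE[OF fi powi, symmetric] rel ..
  also have "\<dots> \<longleftrightarrow> (AE t in lborel. t > 0 \<longrightarrow> ?mf t = ?pow t)"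
    by (simp add: damp_time_eq_iff)
  finally show ?thesis .
qed

text \<open>Transforms determine masses only almost everywhere; a nonempty open set has positive
  measure, so continuity extends the equality to all positive times.\<close>

lemma AE_pos_iff_all_pos:
  fixes f g :: "real \<Rightarrow> real"
  assumes "continuous_on {0<..} f" "continuous_on {0<..} g"
  shows "(AE t in lborel. t > 0 \<longrightarrow> f t = g t) \<longleftrightarrow> (\<forall>t>0. f t = g t)"
proof
  assume AE: "AE t in lborel. t > 0 \<longrightarrow> f t = g t"
  have "f t = g t" if "t > 0" for t
    by (rule AE_continuous_eq[OF open_greaterThan assms]) (use AE that in simp_all)
  then show "\<forall>t>0. f t = g t" by blast
next
  assume "\<forall>t>0. f t = g t"
  then show "AE t in lborel. t > 0 \<longrightarrow> f t = g t" by (intro AE_I2) simp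
qed

lemma has_fourier_AE_0:
  assumes g: "AE x in lborel. g x = 0" and \<gamma>: "has_fourier g \<gamma>"
  shows "\<gamma> \<xi> = 0"
proof -
  have z0: "(LINT x:{-R..R}|lborel. cis (- (\<xi> * x)) * complex_of_real (g x)) = 0" for R
    unfolding set_lebesgue_integral_def
    by (rule integral_eq_zero_AE) (use g in eventually_elim, auto)
  have "((\<lambda>R::real. 0) \<longlongrightarrow> \<gamma> \<xi>) at_top"
    using \<gamma>[unfolded has_fourier_def, rule_format, of \<xi>] unfolding z0 .
  then show ?thesis by (simp add: tendsto_const_iff)
qed

text \<open>Masses alone cannot locate the limit at time 0: translating the whole problem in space
  moves that limit and leaves every mass unchanged, so \<open>tends_to_dirac\<close> stands on both
  sides. Continuity of the masses leads from almost all times to all. The remaining claims need the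
  datum to disappear from the transformed equation, where it would otherwise contribute a further
  convolution of the kernel with \<open>g\<close>; either alternative in the premise ensures
  this.\<close>

theorem proposition4:
  fixes \<alpha> p :: real
    and f u :: "real \<Rightarrow> real \<Rightarrow> real"
    and g :: "real \<Rightarrow> real"
  assumes alpha: "0 < \<alpha>" "\<alpha> < 1"
    and p: "0 \<le> p" "p \<le> 1"
    and g_loc: "locally_integrable_on UNIV g"
    and f_space: "\<And>t. t > 0 \<Longrightarrow> integrable lborel (\<lambda>x. f x t)"
    and f_time: "\<And>x. locally_integrable_on {0<..} (f x)"
    and solution: "mild_solution \<alpha> p f g u"
    and vanishing: "\<And>t. t > 0 \<Longrightarrow> ((\<lambda>x. u x t) \<longlongrightarrow> 0) at_infinity"
  shows
    "(continuous_on {0<..} (\<lambda>t. LINT x|lborel. u x t) \<and>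
      continuous_on {0<..} (\<lambda>t. LINT x|lborel. f x t) \<longrightarrow>
        (is_pdf_from_origin u \<longleftrightarrow>
          (\<forall>t>0. (LINT x|lborel. f x t) = t powr (- \<alpha>) / Gamma (1 - \<alpha>)) \<and> tends_to_dirac u))
     \<and>
     (tends_to_dirac u \<or> (AE x in lborel. g x = 0) \<longrightarrow>
        ((AE t in lborel. t > 0 \<longrightarrow> (LINT x|lborel. u x t) = 1) \<longleftrightarrow>
         (AE t in lborel. t > 0 \<longrightarrow> (LINT x|lborel. f x t) = t powr (- \<alpha>) / Gamma (1 - \<alpha>))) \<and>
        (\<exists>G. is_kernel \<alpha> p G \<and>
          (AE (x, t) in lborel \<Otimes>\<^sub>M lborel. t > 0 \<longrightarrow>
             u x t = (LINT \<tau>:{0<..<t}|lborel.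
                        measure_convolution (G (t - \<tau>)) (\<lambda>y. f y \<tau>) x))))"
proof -
  obtain \<sigma> \<gamma> where \<sigma>: "\<sigma> \<ge> 0" and u: "fl_transformable \<sigma> u" and f: "fl_transformable \<sigma> f"
    and \<gamma>: "has_fourier g \<gamma>"
    and eq: "\<And>\<xi> s. Re s > \<sigma> \<Longrightarrow> symbol \<alpha> p \<xi> s * fourier_laplace u \<xi> s = fourier_laplace f \<xi> s + \<gamma> \<xi>"
    using solution unfolding mild_solution_def by blast
  have eq0: "symbol \<alpha> p \<xi> s * fourier_laplace u \<xi> s = fourier_laplace f \<xi> s"
    if "tends_to_dirac u \<or> (AE x in lborel. g x = 0)" "Re s > \<sigma>" for \<xi> s
  proof -
    have "\<gamma> \<xi> = 0"
      using that(1)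
    proof
      assume "tends_to_dirac u"
      from dirac_imp_datum_transform_0[OF alpha p \<sigma> u f eq this] show ?thesis .
    next
      assume "AE x in lborel. g x = 0"
      from has_fourier_AE_0[OF this \<gamma>] show ?thesis .
    qed
    then show ?thesis using eq[OF that(2)] by simp
  qed
  have mass: "(AE t in lborel. t > 0 \<longrightarrow> (LINT x|lborel. u x t) = 1) \<longleftrightarrow>
      (AE t in lborel. t > 0 \<longrightarrow> (LINT x|lborel. f x t) = t powr (- \<alpha>) / Gamma (1 - \<alpha>))"
    if "tends_to_dirac u \<or> (AE x in lborel. g x = 0)"
    using mass_equivalence[OF alpha \<sigma> u f eq0[OF that]] .
  show ?thesis
  proof (intro conjI impI)
    assume cont: "continuous_on {0<..} (\<lambda>t. LINT x|lborel. u x t) \<and> continuous_on {0<..} (\<lambda>t. LINT x|lborel. f x t)"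
    have pw: "continuous_on {0<..} (\<lambda>t. t powr (- \<alpha>) / Gamma (1 - \<alpha>))"
    proof -
      have "Gamma (1 - \<alpha>) > 0" using alpha by (intro Gamma_real_pos) simp
      then have "Gamma (1 - \<alpha>) \<noteq> 0" by simp
      moreover have "continuous_on {0<..} (\<lambda>t::real. t powr (- \<alpha>))"
        by (intro continuous_on_powr continuous_on_id continuous_on_const) auto
      ultimately show ?thesis by (intro continuous_on_divide continuous_on_const) auto
    qed
    \<comment> \<open>The Dirac limit is a conjunct on both sides, so the mass conditions need only
      be compared under it.\<close>
    have "(\<forall>t>0. (LINT x|lborel. u x t) = 1) \<longleftrightarrow> (\<forall>t>0. (LINT x|lborel. f x t) = t powr (- \<alpha>) / Gamma (1 - \<alpha>))"
      if "tends_to_dirac u"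
      using mass that AE_pos_iff_all_pos[of "\<lambda>t. LINT x|lborel. u x t" "\<lambda>_. 1"]
        AE_pos_iff_all_pos[OF _ pw, of "\<lambda>t. LINT x|lborel. f x t"] cont by simp
    then show "is_pdf_from_origin u \<longleftrightarrow>
        (\<forall>t>0. (LINT x|lborel. f x t) = t powr (- \<alpha>) / Gamma (1 - \<alpha>)) \<and> tends_to_dirac u"
      unfolding is_pdf_from_origin_def by blast
  next
    assume d: "tends_to_dirac u \<or> (AE x in lborel. g x = 0)"
    show "(AE t in lborel. t > 0 \<longrightarrow> (LINT x|lborel. u x t) = 1) \<longleftrightarrow>
      (AE t in lborel. t > 0 \<longrightarrow> (LINT x|lborel. f x t) = t powr (- \<alpha>) / Gamma (1 - \<alpha>))"
      by (rule mass[OF d])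
    obtain \<mu> :: "real measure" where \<mu>: "finite_measure \<mu>" "sets \<mu> = sets borel" "AE x in \<mu>. \<bar>x\<bar> \<le> 1"
      "\<And>\<xi> s. Re s > 0 \<Longrightarrow>
       (LINT t:{0<..}|lborel. exp (- (s * of_real t)) * kernel_transform \<alpha> \<mu> \<xi> t) = 1 / symbol \<alpha> p \<xi> s"
      by (rule kernel_measure_exists[OF alpha p]) blast
    interpret transport_kernel \<alpha> p \<mu>
      by (rule transport_kernel.intro[OF alpha p \<mu>])
    have f_meas: "(\<lambda>x. f x \<tau>) \<in> borel_measurable borel" if "\<tau> > 0" for \<tau>
      using borel_measurable_integrable[OF f_space[OF that]] by simp
    show "\<exists>G. is_kernel \<alpha> p G \<and>
          (AE (x, t) in lborel \<Otimes>\<^sub>M lborel. t > 0 \<longrightarrow>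
             u x t = (LINT \<tau>:{0<..<t}|lborel. measure_convolution (G (t - \<tau>)) (\<lambda>y. f y \<tau>) x))"
    proof (intro exI conjI)
      show "is_kernel \<alpha> p G" by (rule is_kernel_G)
      show "AE (x, t) in lborel \<Otimes>\<^sub>M lborel. t > 0 \<longrightarrow>
             u x t = (LINT \<tau>:{0<..<t}|lborel. measure_convolution (G (t - \<tau>)) (\<lambda>y. f y \<tau>) x)"
        by (rule convolution_representation[OF u f \<sigma> f_meas eq0[OF d]])
    qed
  qed
qed

end
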